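(* Let $G$ be a (discrete) group, let $\mathcal{S}=\{S_i\}_{i\in I}$ be a non-empty family of (not necessarily distinct) subgroups of $G$, and let $A$ be a $G$-module. There is a natural bijection between $H^2(G,\mathcal{S};A)$ and the set of equivalence classes of relative extensions of $(G,\mathcal{S})$ by $A$.
   Context: **Relative cohomology.** Put $\mathbb{Z}[G/\mathcal{S}]=\bigoplus_{i\in I}\mathbb{Z}[G/S_i]$, a $G$-module. Let $\mathrm{ev}\colon \mathbb{Z}[G/\mathcal{S}]\to\mathbb{Z}$ be the augmentation (every coset maps to $1$), let $\Delta=\ker(\mathrm{ev})$ and let $\mathrm{in}\colon\Delta\to\mathbb{Z}[G/\mathcal{S}]$ be the inclusion, so that $0\to\Delta\to\mathbb{Z}[G/\mathcal{S}]\to\mathbb{Z}\to 0$ is exact. For a $G$-module $A$ and a $G$-module $M$, $\mathrm{Hom}(M,A)$ denotes the group of all additive homomorphisms, with diagonal $G$-action $(g\cdot f)(m)=g f(g^{-1}m)$. Define $$H^n(G,\mathcal{S};A)=H^{n-1}(G;\mathrm{Hom}(\Delta,A))=\mathrm{Ext}_{G}^{n-1}(\mathbb{Z},\mathrm{Hom}(\Delta,A)).$$ **Relative extensions.** A relative extension of $(G,\mathcal{S})$ by $A$ is a pair $(E,(q_i)_{i\in I})$ where $0\to A\to E\xrightarrow{p}G\to 1$ is an extension of $G$ by $A$ (inducing the given $G$-action on $A$ by conjugation) and $q_i\colon S_i\to E$ are homomorphisms with $pq_i=\mathrm{id}_{S_i}$ for all $i\in I$. Two relative extensions $(E,(q_i))$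 and $(\widetilde E,(\tilde q_i))$ are equivalent if there is an equivalence of extensions $f\colon E\to\widetilde E$ (an isomorphism inducing the identity on $A$ and on $G$) such that for each $i$ there exists $a_i\in A$ with $\tilde q_i(s)=a_i\cdot f(q_i(s))\cdot a_i^{-1}$ for all $s\in S_i$. **The natural bijection.** Let $C_n(G)$ be the free $\mathbb{Z}G$-module on symbols $[g_1,\dots,g_n]$ (the standard resolution of $\mathbb{Z}$), and put $C^n(G;A)=\mathrm{Hom}_G(C_n(G),A)$, $C^n(\mathcal{S};A)=\mathrm{Hom}_G(C_n(G),\mathrm{Hom}(\mathbb{Z}[G/\mathcal{S}],A))$, $C^{n+1}(G,\mathcal{S};A)=\mathrm{Hom}_G(C_n(G),\mathrm{Hom}(\Delta,A))$, with coboundaries $d$ given by precomposition with the boundary maps of $C_\bullet(G)$ and with maps $\mathrm{ev}^*\colon C^n(G;A)\to C^n(\mathcal{S};A)$ and $\mathrm{in}^*\colon C^n(\mathcal{S};A)\to C^{n+1}(G,\mathcal{S};A)$. The natural bijection referred to is induced by the following construction. Given a cocycle $\xi\in C^2(G,\mathcal{S};A)$, choose $\eta\in C^1(\mathcal{S};A)$ with $\mathrm{in}^*\eta=\xi$, and let $\zeta\in C^2(G;A)$ be the unique cochain with $\mathrm{ev}^*\zeta=d\eta$. Let $E_\zeta$ be the set $A\times G$ with multiplication $(a_1,g_1)\star(a_2,g_2)=(a_1+g_1a_2+\zeta([g_1,g_2]),g_1g_2)$ (with $A$ embedded by $a\mapsto(a-\zeta([1,1]),1)$), and let $q_i(s)=(-\eta([s])(1S_i),s)$.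 The class $[\xi]$ corresponds to the class of $(E_\zeta,(q_i))$. *)

theory Defs
  imports
    "HOL-Algebra.Coset"
    "HOL-Algebra.Left_Coset"
    "HOL-Algebra.Group_Action"
    "HOL-Algebra.Elementary_Groups"
    "HOL-Algebra.Free_Abelian_Groups"
begin

text \<open>
  Abelian groups are commutative groups of HOL-Algebra, hence written multiplicatively: \<open>a + b\<close>
  is \<open>a \<otimes> b\<close>, zero is \<open>\<one>\<close>, and the integer multiple \<open>k a\<close> is \<open>a [^] k\<close>.
  Functions that are elements of a group are \<open>extensional\<close> on their domain, so that equality of
  such functions is equality on the domain.
\<close>

section \<open>Modules over a group\<close>

locale gmodule = group_action G "carrier M" act + comm_group M
  for G :: "('g, 'b) monoid_scheme" (structure)
    and M :: "('m, 'c) monoid_scheme" and act :: "'g \<Rightarrow> 'm \<Rightarrow> 'm" +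
  assumes act_hom: "g \<in> carrier G \<Longrightarrow> act g \<in> hom M M"

definition hom_module ::
    "('m, 'b) monoid_scheme \<Rightarrow> ('n, 'c) monoid_scheme \<Rightarrow> ('m \<Rightarrow> 'n) monoid" where
  "hom_module M N =
    \<lparr>carrier = hom M N \<inter> extensional (carrier M),
     monoid.mult = (\<lambda>f f'. \<lambda>m\<in>carrier M. f m \<otimes>\<^bsub>N\<^esub> f' m),
     one = (\<lambda>m\<in>carrier M. \<one>\<^bsub>N\<^esub>)\<rparr>"

definition hom_act ::
    "('g, 'd) monoid_scheme \<Rightarrow> ('m, 'b) monoid_scheme \<Rightarrow> ('g \<Rightarrow> 'm \<Rightarrow> 'm) \<Rightarrow>
     ('n, 'c) monoid_scheme \<Rightarrow> ('g \<Rightarrow> 'n \<Rightarrow> 'n) \<Rightarrow> 'g \<Rightarrow> ('m \<Rightarrow> 'n) \<Rightarrow> 'm \<Rightarrow> 'n" where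
  "hom_act G M actM N actN g =
    (\<lambda>f\<in>carrier (hom_module M N). \<lambda>m\<in>carrier M. actN g (f (actM (inv\<^bsub>G\<^esub> g) m)))"

definition equivariant_hom ::
    "('g, 'd) monoid_scheme \<Rightarrow> ('m, 'b) monoid_scheme \<Rightarrow> ('g \<Rightarrow> 'm \<Rightarrow> 'm) \<Rightarrow>
     ('n, 'c) monoid_scheme \<Rightarrow> ('g \<Rightarrow> 'n \<Rightarrow> 'n) \<Rightarrow> ('m \<Rightarrow> 'n) monoid" where
  "equivariant_hom G M actM N actN = (hom_module M N)
    \<lparr>carrier := {f \<in> carrier (hom_module M N).
       \<forall>g\<in>carrier G. \<forall>m\<in>carrier M. f (actM g m) = actN g (f m)}\<rparr>"


section \<open>The standard resolution and group cohomology\<close>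

text \<open>
  The free \<open>\<int>G\<close>-module on the symbols \<open>[g\<^sub>1,\<dots>,g\<^sub>n]\<close> has the elements \<open>h[g\<^sub>1,\<dots>,g\<^sub>n]\<close> as a
  \<open>\<int>\<close>-basis; such an element is encoded as the pair \<open>(h, [g\<^sub>1,\<dots>,g\<^sub>n])\<close>.
\<close>

definition bar_basis :: "('g, 'd) monoid_scheme \<Rightarrow> nat \<Rightarrow> ('g \<times> 'g list) set" where
  "bar_basis G n = carrier G \<times> {gs. length gs = n \<and> set gs \<subseteq> carrier G}"

definition bar :: "('g, 'd) monoid_scheme \<Rightarrow> nat \<Rightarrow> (('g \<times> 'g list) \<Rightarrow>\<^sub>0 int) monoid" where
  "bar G n = free_Abelian_group (bar_basis G n)"

definition bar_act ::
    "('g, 'd) monoid_scheme \<Rightarrow> nat \<Rightarrow> 'g \<Rightarrow> (('g \<times> 'g list) \<Rightarrow>\<^sub>0 int) \<Rightarrow> (('g \<times> 'g list) \<Rightarrow>\<^sub>0 int)"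
    where
  "bar_act G n g = (\<lambda>c\<in>carrier (bar G n). frag_extend (\<lambda>(h, gs). frag_of (g \<otimes>\<^bsub>G\<^esub> h, gs)) c)"

definition bar_symbol :: "('g, 'd) monoid_scheme \<Rightarrow> 'g list \<Rightarrow> (('g \<times> 'g list) \<Rightarrow>\<^sub>0 int)" where
  "bar_symbol G gs = frag_of (\<one>\<^bsub>G\<^esub>, gs)"

definition merge_at :: "('g, 'd) monoid_scheme \<Rightarrow> nat \<Rightarrow> 'g list \<Rightarrow> 'g list" where
  "merge_at G i gs = take (i - 1) gs @ [gs ! (i - 1) \<otimes>\<^bsub>G\<^esub> gs ! i] @ drop (i + 1) gs"

text \<open>
  With \<open>n = length gs \<ge> 1\<close>, the boundary of \<open>[g\<^sub>1,\<dots>,g\<^sub>n]\<close> is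
  \<open>g\<^sub>1[g\<^sub>2,\<dots>,g\<^sub>n] + (\<Sum>i=1..n-1. (-1)^i [\<dots>,g\<^sub>i g\<^sub>i\<^sub>+\<^sub>1,\<dots>]) + (-1)^n [g\<^sub>1,\<dots>,g\<^sub>n\<^sub>-\<^sub>1]\<close>;
  lists are indexed from 0, so \<open>g\<^sub>i\<close> is \<open>gs ! (i - 1)\<close>. The value at an element with \<open>n = 0\<close> is
  never used.
\<close>

definition bar_boundary ::
    "('g, 'd) monoid_scheme \<Rightarrow> (('g \<times> 'g list) \<Rightarrow>\<^sub>0 int) \<Rightarrow> (('g \<times> 'g list) \<Rightarrow>\<^sub>0 int)" where
  "bar_boundary G = frag_extend (\<lambda>(h, gs).
     frag_of (h \<otimes>\<^bsub>G\<^esub> hd gs, tl gs)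
     + (\<Sum>i = 1..<length gs. frag_cmul ((- 1) ^ i) (frag_of (h, merge_at G i gs)))
     + frag_cmul ((- 1) ^ length gs) (frag_of (h, butlast gs)))"

definition cochains ::
    "('g, 'd) monoid_scheme \<Rightarrow> ('m, 'c) monoid_scheme \<Rightarrow> ('g \<Rightarrow> 'm \<Rightarrow> 'm) \<Rightarrow> nat \<Rightarrow>
     ((('g \<times> 'g list) \<Rightarrow>\<^sub>0 int) \<Rightarrow> 'm) monoid" where
  "cochains G M act n = equivariant_hom G (bar G n) (bar_act G n) M act"

definition coboundary ::
    "('g, 'd) monoid_scheme \<Rightarrow> nat \<Rightarrow> ((('g \<times> 'g list) \<Rightarrow>\<^sub>0 int) \<Rightarrow> 'm) \<Rightarrow>
     (('g \<times> 'g list) \<Rightarrow>\<^sub>0 int) \<Rightarrow> 'm" where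
  "coboundary G n f = (\<lambda>c\<in>carrier (bar G (Suc n)). f (bar_boundary G c))"

definition cocycles ::
    "('g, 'd) monoid_scheme \<Rightarrow> ('m, 'c) monoid_scheme \<Rightarrow> ('g \<Rightarrow> 'm \<Rightarrow> 'm) \<Rightarrow> nat \<Rightarrow>
     ((('g \<times> 'g list) \<Rightarrow>\<^sub>0 int) \<Rightarrow> 'm) monoid" where
  "cocycles G M act n = (cochains G M act n)
    \<lparr>carrier := kernel (cochains G M act n) (cochains G M act (Suc n)) (coboundary G n)\<rparr>"

definition coboundaries ::
    "('g, 'd) monoid_scheme \<Rightarrow> ('m, 'c) monoid_scheme \<Rightarrow> ('g \<Rightarrow> 'm \<Rightarrow> 'm) \<Rightarrow> nat \<Rightarrow>
     ((('g \<times> 'g list) \<Rightarrow>\<^sub>0 int) \<Rightarrow> 'm) set" where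
  "coboundaries G M act n = (case n of
      0 \<Rightarrow> {\<one>\<^bsub>cochains G M act 0\<^esub>}
    | Suc k \<Rightarrow> coboundary G k ` carrier (cochains G M act k))"

text \<open>
  \<open>H\<^sup>n(G; M) = Ext\<^sup>n(\<int>, M)\<close>, computed from the standard resolution of \<open>\<int>\<close>.
\<close>

definition cohomology ::
    "('g, 'd) monoid_scheme \<Rightarrow> ('m, 'c) monoid_scheme \<Rightarrow> ('g \<Rightarrow> 'm \<Rightarrow> 'm) \<Rightarrow> nat \<Rightarrow>
     ((('g \<times> 'g list) \<Rightarrow>\<^sub>0 int) \<Rightarrow> 'm) set monoid" where
  "cohomology G M act n = cocycles G M act n Mod coboundaries G M act n"

definition cohomology_class ::
    "('g, 'd) monoid_scheme \<Rightarrow> ('m, 'c) monoid_scheme \<Rightarrow> ('g \<Rightarrow> 'm \<Rightarrow> 'm) \<Rightarrow> nat \<Rightarrow>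
     ((('g \<times> 'g list) \<Rightarrow>\<^sub>0 int) \<Rightarrow> 'm) \<Rightarrow> ((('g \<times> 'g list) \<Rightarrow>\<^sub>0 int) \<Rightarrow> 'm) set" where
  "cohomology_class G M act n \<xi> = coboundaries G M act n #>\<^bsub>cocycles G M act n\<^esub> \<xi>"


section \<open>Relative cohomology\<close>

text \<open>
  The direct sum over \<open>i\<close> in \<open>I\<close> of the groups \<open>\<int>[G/S\<^sub>i]\<close> is the free abelian group on the
  disjoint union of the coset sets \<open>G/S\<^sub>i\<close>; the coset \<open>C\<close> in \<open>G/S\<^sub>i\<close> is encoded as \<open>(i, C)\<close>.
\<close>

definition coset_basis ::
    "('g, 'd) monoid_scheme \<Rightarrow> 'i set \<Rightarrow> ('i \<Rightarrow> 'g set) \<Rightarrow> ('i \<times> 'g set) set" where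
  "coset_basis G I S = (SIGMA i:I. lcosets\<^bsub>G\<^esub> (S i))"

definition coset_module ::
    "('g, 'd) monoid_scheme \<Rightarrow> 'i set \<Rightarrow> ('i \<Rightarrow> 'g set) \<Rightarrow> (('i \<times> 'g set) \<Rightarrow>\<^sub>0 int) monoid" where
  "coset_module G I S = free_Abelian_group (coset_basis G I S)"

definition coset_act ::
    "('g, 'd) monoid_scheme \<Rightarrow> 'g \<Rightarrow> (('i \<times> 'g set) \<Rightarrow>\<^sub>0 int) \<Rightarrow> (('i \<times> 'g set) \<Rightarrow>\<^sub>0 int)" where
  "coset_act G g = frag_extend (\<lambda>(i, C). frag_of (i, g <#\<^bsub>G\<^esub> C))"

definition ev :: "(('i \<times> 'g set) \<Rightarrow>\<^sub>0 int) \<Rightarrow> int" where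
  "ev x = (\<Sum>k\<in>Poly_Mapping.keys x. Poly_Mapping.lookup x k)"

definition Delta ::
    "('g, 'd) monoid_scheme \<Rightarrow> 'i set \<Rightarrow> ('i \<Rightarrow> 'g set) \<Rightarrow> (('i \<times> 'g set) \<Rightarrow>\<^sub>0 int) monoid" where
  "Delta G I S = (coset_module G I S)
    \<lparr>carrier := kernel (coset_module G I S) integer_group ev\<rparr>"

abbreviation Hom_coset ::
    "('g, 'd) monoid_scheme \<Rightarrow> 'i set \<Rightarrow> ('i \<Rightarrow> 'g set) \<Rightarrow> ('a, 'c) monoid_scheme \<Rightarrow>
     ((('i \<times> 'g set) \<Rightarrow>\<^sub>0 int) \<Rightarrow> 'a) monoid" where
  "Hom_coset G I S A \<equiv> hom_module (coset_module G I S) A"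

abbreviation Hom_coset_act ::
    "('g, 'd) monoid_scheme \<Rightarrow> 'i set \<Rightarrow> ('i \<Rightarrow> 'g set) \<Rightarrow> ('a, 'c) monoid_scheme \<Rightarrow>
     ('g \<Rightarrow> 'a \<Rightarrow> 'a) \<Rightarrow> 'g \<Rightarrow> ((('i \<times> 'g set) \<Rightarrow>\<^sub>0 int) \<Rightarrow> 'a) \<Rightarrow> (('i \<times> 'g set) \<Rightarrow>\<^sub>0 int) \<Rightarrow> 'a" where
  "Hom_coset_act G I S A act \<equiv> hom_act G (coset_module G I S) (coset_act G) A act"

abbreviation Hom_Delta ::
    "('g, 'd) monoid_scheme \<Rightarrow> 'i set \<Rightarrow> ('i \<Rightarrow> 'g set) \<Rightarrow> ('a, 'c) monoid_scheme \<Rightarrow>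
     ((('i \<times> 'g set) \<Rightarrow>\<^sub>0 int) \<Rightarrow> 'a) monoid" where
  "Hom_Delta G I S A \<equiv> hom_module (Delta G I S) A"

abbreviation Hom_Delta_act ::
    "('g, 'd) monoid_scheme \<Rightarrow> 'i set \<Rightarrow> ('i \<Rightarrow> 'g set) \<Rightarrow> ('a, 'c) monoid_scheme \<Rightarrow>
     ('g \<Rightarrow> 'a \<Rightarrow> 'a) \<Rightarrow> 'g \<Rightarrow> ((('i \<times> 'g set) \<Rightarrow>\<^sub>0 int) \<Rightarrow> 'a) \<Rightarrow> (('i \<times> 'g set) \<Rightarrow>\<^sub>0 int) \<Rightarrow> 'a" where
  "Hom_Delta_act G I S A act \<equiv> hom_act G (Delta G I S) (coset_act G) A act"

definition family_cochains ::
    "('g, 'd) monoid_scheme \<Rightarrow> 'i set \<Rightarrow> ('i \<Rightarrow> 'g set) \<Rightarrow> ('a, 'c) monoid_scheme \<Rightarrow>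
     ('g \<Rightarrow> 'a \<Rightarrow> 'a) \<Rightarrow> nat \<Rightarrow>
     ((('g \<times> 'g list) \<Rightarrow>\<^sub>0 int) \<Rightarrow> (('i \<times> 'g set) \<Rightarrow>\<^sub>0 int) \<Rightarrow> 'a) monoid" where
  "family_cochains G I S A act n = cochains G (Hom_coset G I S A) (Hom_coset_act G I S A act) n"

text \<open>
  Relative cochains of degree \<open>n\<close> are cochains of degree \<open>n - 1\<close> with values in \<open>Hom(\<Delta>, A)\<close>;
  these notions are meant for \<open>n \<ge> 1\<close> only.
\<close>

definition rel_cochains ::
    "('g, 'd) monoid_scheme \<Rightarrow> 'i set \<Rightarrow> ('i \<Rightarrow> 'g set) \<Rightarrow> ('a, 'c) monoid_scheme \<Rightarrow>
     ('g \<Rightarrow> 'a \<Rightarrow> 'a) \<Rightarrow> nat \<Rightarrow>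
     ((('g \<times> 'g list) \<Rightarrow>\<^sub>0 int) \<Rightarrow> (('i \<times> 'g set) \<Rightarrow>\<^sub>0 int) \<Rightarrow> 'a) monoid" where
  "rel_cochains G I S A act n =
     cochains G (Hom_Delta G I S A) (Hom_Delta_act G I S A act) (n - 1)"

definition rel_cocycles ::
    "('g, 'd) monoid_scheme \<Rightarrow> 'i set \<Rightarrow> ('i \<Rightarrow> 'g set) \<Rightarrow> ('a, 'c) monoid_scheme \<Rightarrow>
     ('g \<Rightarrow> 'a \<Rightarrow> 'a) \<Rightarrow> nat \<Rightarrow>
     ((('g \<times> 'g list) \<Rightarrow>\<^sub>0 int) \<Rightarrow> (('i \<times> 'g set) \<Rightarrow>\<^sub>0 int) \<Rightarrow> 'a) monoid" where
  "rel_cocycles G I S A act n =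
     cocycles G (Hom_Delta G I S A) (Hom_Delta_act G I S A act) (n - 1)"

definition rel_cohomology ::
    "('g, 'd) monoid_scheme \<Rightarrow> 'i set \<Rightarrow> ('i \<Rightarrow> 'g set) \<Rightarrow> ('a, 'c) monoid_scheme \<Rightarrow>
     ('g \<Rightarrow> 'a \<Rightarrow> 'a) \<Rightarrow> nat \<Rightarrow>
     ((('g \<times> 'g list) \<Rightarrow>\<^sub>0 int) \<Rightarrow> (('i \<times> 'g set) \<Rightarrow>\<^sub>0 int) \<Rightarrow> 'a) set monoid" where
  "rel_cohomology G I S A act n =
     cohomology G (Hom_Delta G I S A) (Hom_Delta_act G I S A act) (n - 1)"

definition rel_cohomology_class ::
    "('g, 'd) monoid_scheme \<Rightarrow> 'i set \<Rightarrow> ('i \<Rightarrow> 'g set) \<Rightarrow> ('a, 'c) monoid_scheme \<Rightarrow>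
     ('g \<Rightarrow> 'a \<Rightarrow> 'a) \<Rightarrow> nat \<Rightarrow>
     ((('g \<times> 'g list) \<Rightarrow>\<^sub>0 int) \<Rightarrow> (('i \<times> 'g set) \<Rightarrow>\<^sub>0 int) \<Rightarrow> 'a) \<Rightarrow>
     ((('g \<times> 'g list) \<Rightarrow>\<^sub>0 int) \<Rightarrow> (('i \<times> 'g set) \<Rightarrow>\<^sub>0 int) \<Rightarrow> 'a) set" where
  "rel_cohomology_class G I S A act n \<xi> =
     cohomology_class G (Hom_Delta G I S A) (Hom_Delta_act G I S A act) (n - 1) \<xi>"

text \<open>
  \<open>ev_star\<close> uses the identification of \<open>A\<close> with \<open>Hom(\<int>, A)\<close>, under which \<open>a\<close> composed with
  \<open>ev\<close> is the map sending \<open>x\<close> to the multiple of \<open>a\<close> by \<open>ev x\<close>.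
\<close>

definition ev_star ::
    "('g, 'd) monoid_scheme \<Rightarrow> 'i set \<Rightarrow> ('i \<Rightarrow> 'g set) \<Rightarrow> ('a, 'c) monoid_scheme \<Rightarrow> nat \<Rightarrow>
     ((('g \<times> 'g list) \<Rightarrow>\<^sub>0 int) \<Rightarrow> 'a) \<Rightarrow>
     (('g \<times> 'g list) \<Rightarrow>\<^sub>0 int) \<Rightarrow> (('i \<times> 'g set) \<Rightarrow>\<^sub>0 int) \<Rightarrow> 'a" where
  "ev_star G I S A n \<zeta> =
    (\<lambda>c\<in>carrier (bar G n). \<lambda>x\<in>carrier (coset_module G I S). \<zeta> c [^]\<^bsub>A\<^esub> ev x)"

definition in_star ::
    "('g, 'd) monoid_scheme \<Rightarrow> 'i set \<Rightarrow> ('i \<Rightarrow> 'g set) \<Rightarrow> nat \<Rightarrow>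
     ((('g \<times> 'g list) \<Rightarrow>\<^sub>0 int) \<Rightarrow> (('i \<times> 'g set) \<Rightarrow>\<^sub>0 int) \<Rightarrow> 'a) \<Rightarrow>
     (('g \<times> 'g list) \<Rightarrow>\<^sub>0 int) \<Rightarrow> (('i \<times> 'g set) \<Rightarrow>\<^sub>0 int) \<Rightarrow> 'a" where
  "in_star G I S n \<eta> = (\<lambda>c\<in>carrier (bar G n). restrict (\<eta> c) (carrier (Delta G I S)))"


section \<open>Relative extensions\<close>

record ('e, 'a, 'g, 'i) rel_ext =
  total :: "'e monoid"
  incl :: "'a \<Rightarrow> 'e"
  proj :: "'e \<Rightarrow> 'g"
  sect :: "'i \<Rightarrow> 'g \<Rightarrow> 'e"

definition group_extension ::
    "('g, 'd) monoid_scheme \<Rightarrow> ('a, 'c) monoid_scheme \<Rightarrow> ('g \<Rightarrow> 'a \<Rightarrow> 'a) \<Rightarrow>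
     'e monoid \<Rightarrow> ('a \<Rightarrow> 'e) \<Rightarrow> ('e \<Rightarrow> 'g) \<Rightarrow> bool" where
  "group_extension G A act E \<iota> p \<longleftrightarrow>
     group E \<and> \<iota> \<in> mon A E \<and> p \<in> epi E G \<and> \<iota> ` carrier A = kernel E G p \<and>
     (\<forall>e\<in>carrier E. \<forall>a\<in>carrier A. e \<otimes>\<^bsub>E\<^esub> \<iota> a \<otimes>\<^bsub>E\<^esub> inv\<^bsub>E\<^esub> e = \<iota> (act (p e) a))"

definition rel_extensions ::
    "('g, 'd) monoid_scheme \<Rightarrow> 'i set \<Rightarrow> ('i \<Rightarrow> 'g set) \<Rightarrow> ('a, 'c) monoid_scheme \<Rightarrow>
     ('g \<Rightarrow> 'a \<Rightarrow> 'a) \<Rightarrow> ('e, 'a, 'g, 'i) rel_ext set" where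
  "rel_extensions G I S A act =
    {X. group_extension G A act (total X) (incl X) (proj X) \<and>
        (\<forall>i\<in>I. sect X i \<in> hom (G\<lparr>carrier := S i\<rparr>) (total X) \<and>
               (\<forall>s\<in>S i. proj X (sect X i s) = s))}"

definition rel_ext_equivalent ::
    "'i set \<Rightarrow> ('i \<Rightarrow> 'g set) \<Rightarrow> ('a, 'c) monoid_scheme \<Rightarrow>
     ('e, 'a, 'g, 'i) rel_ext \<Rightarrow> ('f, 'a, 'g, 'i) rel_ext \<Rightarrow> bool" where
  "rel_ext_equivalent I S A X Y \<longleftrightarrow>
    (\<exists>f\<in>iso (total X) (total Y).
       (\<forall>a\<in>carrier A. f (incl X a) = incl Y a) \<and>
       (\<forall>e\<in>carrier (total X). proj Y (f e) = proj X e) \<and>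
       (\<forall>i\<in>I. \<exists>a\<in>carrier A. \<forall>s\<in>S i.
          sect Y i s = incl Y a \<otimes>\<^bsub>total Y\<^esub> f (sect X i s) \<otimes>\<^bsub>total Y\<^esub> inv\<^bsub>total Y\<^esub> (incl Y a)))"

definition rel_ext_classes ::
    "('g, 'd) monoid_scheme \<Rightarrow> 'i set \<Rightarrow> ('i \<Rightarrow> 'g set) \<Rightarrow> ('a, 'c) monoid_scheme \<Rightarrow>
     ('g \<Rightarrow> 'a \<Rightarrow> 'a) \<Rightarrow> ('e, 'a, 'g, 'i) rel_ext set set" where
  "rel_ext_classes G I S A act =
     rel_extensions G I S A act //
       {(X, Y). X \<in> rel_extensions G I S A act \<and> Y \<in> rel_extensions G I S A act \<and>
                rel_ext_equivalent I S A X Y}"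

text \<open>
  The relative extensions with total group in the type \<open>'e\<close> that are equivalent to \<open>X\<close>, whose
  total group may live in another type \<open>'f\<close>.
\<close>

definition rel_ext_class ::
    "('g, 'd) monoid_scheme \<Rightarrow> 'i set \<Rightarrow> ('i \<Rightarrow> 'g set) \<Rightarrow> ('a, 'c) monoid_scheme \<Rightarrow>
     ('g \<Rightarrow> 'a \<Rightarrow> 'a) \<Rightarrow> ('f, 'a, 'g, 'i) rel_ext \<Rightarrow> ('e, 'a, 'g, 'i) rel_ext set" where
  "rel_ext_class G I S A act X =
     {Y \<in> rel_extensions G I S A act. rel_ext_equivalent I S A X Y}"


section \<open>The relative extension of a relative cocycle\<close>

definition twisted_product ::
    "('g, 'd) monoid_scheme \<Rightarrow> ('a, 'c) monoid_scheme \<Rightarrow> ('g \<Rightarrow> 'a \<Rightarrow> 'a) \<Rightarrow>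
     ((('g \<times> 'g list) \<Rightarrow>\<^sub>0 int) \<Rightarrow> 'a) \<Rightarrow> ('a \<times> 'g) monoid" where
  "twisted_product G A act \<zeta> =
    \<lparr>carrier = carrier A \<times> carrier G,
     monoid.mult = (\<lambda>(a\<^sub>1, g\<^sub>1) (a\<^sub>2, g\<^sub>2).
       (a\<^sub>1 \<otimes>\<^bsub>A\<^esub> act g\<^sub>1 a\<^sub>2 \<otimes>\<^bsub>A\<^esub> \<zeta> (bar_symbol G [g\<^sub>1, g\<^sub>2]), g\<^sub>1 \<otimes>\<^bsub>G\<^esub> g\<^sub>2)),
     one = (inv\<^bsub>A\<^esub> \<zeta> (bar_symbol G [\<one>\<^bsub>G\<^esub>, \<one>\<^bsub>G\<^esub>]), \<one>\<^bsub>G\<^esub>)\<rparr>"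

definition cocycle_rel_ext ::
    "('g, 'd) monoid_scheme \<Rightarrow> ('i \<Rightarrow> 'g set) \<Rightarrow> ('a, 'c) monoid_scheme \<Rightarrow> ('g \<Rightarrow> 'a \<Rightarrow> 'a) \<Rightarrow>
     ((('g \<times> 'g list) \<Rightarrow>\<^sub>0 int) \<Rightarrow> 'a) \<Rightarrow>
     ((('g \<times> 'g list) \<Rightarrow>\<^sub>0 int) \<Rightarrow> (('i \<times> 'g set) \<Rightarrow>\<^sub>0 int) \<Rightarrow> 'a) \<Rightarrow>
     ('a \<times> 'g, 'a, 'g, 'i) rel_ext" where
  "cocycle_rel_ext G S A act \<zeta> \<eta> =
    \<lparr>total = twisted_product G A act \<zeta>,
     incl = (\<lambda>a. (a \<otimes>\<^bsub>A\<^esub> inv\<^bsub>A\<^esub> \<zeta> (bar_symbol G [\<one>\<^bsub>G\<^esub>, \<one>\<^bsub>G\<^esub>]), \<one>\<^bsub>G\<^esub>)),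
     proj = snd,
     sect = (\<lambda>i s. (inv\<^bsub>A\<^esub> \<eta> (bar_symbol G [s]) (frag_of (i, \<one>\<^bsub>G\<^esub> <#\<^bsub>G\<^esub> S i)), s))\<rparr>"

end

theory Submission
  imports Defs
begin

text \<open>
  A cochain \<open>\<eta>\<close> in \<open>C\<^sup>1(S; A)\<close> amounts to elements \<open>F g k\<close> of \<open>A\<close>, for \<open>g\<close> in \<open>G\<close> and cosets
  \<open>k\<close>, and \<open>in\<^sup>*\<eta>\<close> is a cocycle iff \<open>g F h (g\<inverse>k) + F g k - F (gh) k\<close> does not depend on \<open>k\<close>; the
  common value \<open>Z g h\<close> is then a factor set, and the equation at the coset \<open>S\<^sub>i\<close> says that
  \<open>s \<mapsto> (-F s S\<^sub>i, s)\<close> is a section over \<open>S\<^sub>i\<close>. Two such families \<open>F\<close>, \<open>F'\<close> give the same class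
  iff \<open>F g k - F' g k = c g + g T (g\<inverse>k) - T k\<close> for some \<open>c\<close> and \<open>T\<close>, and then
  \<open>(a, g) \<mapsto> (a + c g, g)\<close> is an equivalence of the extensions that conjugates the sections by the
  elements \<open>-T S\<^sub>i\<close>. Conversely, an equivalence provides \<open>c\<close> and the values of \<open>T\<close> at the cosets
  \<open>S\<^sub>i\<close>, and Shapiro's lemma provides the rest of \<open>T\<close>.
\<close>

section \<open>Groups acting by endomorphisms of an abelian group\<close>

text \<open>Both sides of the bijection are quotients of one set, the pairs of \<eta> and \<zeta>
  such that \<open>in_star\<close> \<eta> is a cocycle and \<open>ev_star\<close> \<zeta> = d
  \<eta>. Well-definedness and injectivity therefore become a single equivalence: two pairs give the
  same cohomology class iff they give equivalent extensions. The elements c g are forced by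
  \<Delta>: a homomorphism on the coset module vanishes on \<Delta> iff it takes one value at all
  cosets and this value is then arbitrary, so an equation in Hom(\<Delta>, A) lifted to cosets holds
  only up to such a value. Surjectivity needs F on all cosets, whereas an extension only comes with
  sections over the S_i; the other values result from lifting a representative of each coset to the
  total group. Two features shape the details. Nothing is normalised, since \<eta> is any lift of
  \<xi>: Z 1 1 need not vanish, and the unit and the inclusion carry it along. And the total groups
  live in the type \<open>'e\<close>, not in pairs, so extensions are compared across types and
  copied along an injection.\<close>

definition quot :: "('a, 'b) monoid_scheme \<Rightarrow> 'a \<Rightarrow> 'a \<Rightarrow> 'a" where
  "quot M a b = a \<otimes>\<^bsub>M\<^esub> inv\<^bsub>M\<^esub> b"

text \<open>
  The identities \<open>quot_simps\<close> together with \<open>m_ac\<close> decide equations in an abelian group, in the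
  way in which \<open>field_simps\<close> and \<open>ac_simps\<close> do for fractions.
\<close>

context comm_group
begin

lemma quot_closed [simp]: "a \<in> carrier G \<Longrightarrow> b \<in> carrier G \<Longrightarrow> quot G a b \<in> carrier G"
  by (simp add: quot_def)

lemma inv_eq_quot: "a \<in> carrier G \<Longrightarrow> inv a = quot G \<one> a"
  by (simp add: quot_def)

lemma mult_quot:
  "\<lbrakk>a \<in> carrier G; b \<in> carrier G; c \<in> carrier G\<rbrakk> \<Longrightarrow> c \<otimes> quot G a b = quot G (c \<otimes> a) b"
  by (simp add: quot_def m_assoc)

lemma quot_mult:
  "\<lbrakk>a \<in> carrier G; b \<in> carrier G; c \<in> carrier G\<rbrakk> \<Longrightarrow> quot G a b \<otimes> c = quot G (a \<otimes> c) b"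
  by (simp add: quot_def m_ac)

lemma quot_quot_left:
  "\<lbrakk>a \<in> carrier G; b \<in> carrier G; c \<in> carrier G\<rbrakk> \<Longrightarrow> quot G (quot G a b) c = quot G a (b \<otimes> c)"
  by (simp add: quot_def m_ac inv_mult)

lemma quot_quot_right:
  "\<lbrakk>a \<in> carrier G; b \<in> carrier G; c \<in> carrier G\<rbrakk> \<Longrightarrow> quot G c (quot G a b) = quot G (c \<otimes> b) a"
  by (simp add: quot_def m_ac inv_mult)

lemma quot_eq_iff:
  "\<lbrakk>a \<in> carrier G; b \<in> carrier G; c \<in> carrier G\<rbrakk> \<Longrightarrow> quot G a b = c \<longleftrightarrow> a = c \<otimes> b"
  by (simp add: quot_def inv_solve_right')

lemma eq_quot_iff:
  "\<lbrakk>a \<in> carrier G; b \<in> carrier G; c \<in> carrier G\<rbrakk> \<Longrightarrow> c = quot G a b \<longleftrightarrow> c \<otimes> b = a"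
  by (metis quot_eq_iff)

lemma quot_self [simp]: "a \<in> carrier G \<Longrightarrow> quot G a a = \<one>"
  by (simp add: quot_def)

lemmas quot_simps =
  inv_eq_quot mult_quot quot_mult quot_quot_left quot_quot_right quot_eq_iff eq_quot_iff

end

lemma group_hom_quot:
  assumes "group_hom G H h" "a \<in> carrier G" "b \<in> carrier G"
  shows "h (quot G a b) = quot H (h a) (h b)"
proof -
  interpret group_hom G H h by fact
  show ?thesis using assms(2,3) by (simp add: quot_def)
qed

text \<open>Module axioms stated pointwise. \<open>gmodule\<close> asks for a homomorphism into
  \<open>BijGroup\<close>, whose elements are extensional; \<open>coset_act\<close> is not
  restricted to a carrier, so it is treated as a module structure in this weaker form.\<close>

locale linear_action = group G + M: comm_group M
  for G (structure) and M :: "('m, 'c) monoid_scheme" and act :: "'a \<Rightarrow> 'm \<Rightarrow> 'm" +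
  assumes act_closed [simp]: "g \<in> carrier G \<Longrightarrow> m \<in> carrier M \<Longrightarrow> act g m \<in> carrier M"
    and act_mult: "\<lbrakk>g \<in> carrier G; m \<in> carrier M; n \<in> carrier M\<rbrakk> \<Longrightarrow>
      act g (m \<otimes>\<^bsub>M\<^esub> n) = act g m \<otimes>\<^bsub>M\<^esub> act g n"
    and act_act: "\<lbrakk>g \<in> carrier G; h \<in> carrier G; m \<in> carrier M\<rbrakk> \<Longrightarrow>
      act g (act h m) = act (g \<otimes> h) m"
    and act_one [simp]: "m \<in> carrier M \<Longrightarrow> act \<one> m = m"
begin

lemma act_group_hom: "g \<in> carrier G \<Longrightarrow> group_hom M M (act g)"
  by unfold_locales (auto simp: hom_def act_mult)

lemma act_unit [simp]: "g \<in> carrier G \<Longrightarrow> act g \<one>\<^bsub>M\<^esub> = \<one>\<^bsub>M\<^esub>"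
  using group_hom.hom_one[OF act_group_hom] .

lemma act_inv: "g \<in> carrier G \<Longrightarrow> m \<in> carrier M \<Longrightarrow> act g (inv\<^bsub>M\<^esub> m) = inv\<^bsub>M\<^esub> act g m"
  using group_hom.hom_inv[OF act_group_hom] by blast

lemma act_quot:
  "\<lbrakk>g \<in> carrier G; m \<in> carrier M; n \<in> carrier M\<rbrakk> \<Longrightarrow>
    act g (quot M m n) = quot M (act g m) (act g n)"
  using group_hom_quot[OF act_group_hom] by blast

lemma act_int_pow:
  "g \<in> carrier G \<Longrightarrow> m \<in> carrier M \<Longrightarrow> act g (m [^]\<^bsub>M\<^esub> (k::int)) = act g m [^]\<^bsub>M\<^esub> k"
  using group_hom.hom_int_pow[OF act_group_hom] by blast

lemmas action_simps = act_mult act_act act_inv act_quot M.quot_simps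

end

lemma gmodule_linear_action:
  fixes G (structure)
  assumes "gmodule G M act"
  shows "linear_action G M act"
proof -
  interpret gmodule G M act by fact
  interpret gh: group_hom G "BijGroup (carrier M)" act by (rule group_hom)
  show ?thesis
  proof unfold_locales
    fix g h m n assume g: "g \<in> carrier G" and m: "m \<in> carrier M"
    show "act g m \<in> carrier M" using act_hom[OF g] m by (auto simp: hom_def)
    show "act g (act h m) = act (g \<otimes> h) m" if "h \<in> carrier G"
      using gh.hom_mult[OF g that] gh.hom_closed[OF g] gh.hom_closed[OF that] m
      by (simp add: BijGroup_def compose_def)
    show "act g (m \<otimes>\<^bsub>M\<^esub> n) = act g m \<otimes>\<^bsub>M\<^esub> act g n" if "n \<in> carrier M"
      using act_hom[OF g] m that by (auto simp: hom_def)
  next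
    show "act \<one> m = m" if "m \<in> carrier M" for m
      using gh.hom_one that by (simp add: BijGroup_def)
  qed
qed

section \<open>Groups of homomorphisms\<close>

lemma hom_module_mult:
  "(f \<otimes>\<^bsub>hom_module M N\<^esub> f') = (\<lambda>m\<in>carrier M. f m \<otimes>\<^bsub>N\<^esub> f' m)"
  by (simp add: hom_module_def)

lemma hom_module_one: "\<one>\<^bsub>hom_module M N\<^esub> = (\<lambda>m\<in>carrier M. \<one>\<^bsub>N\<^esub>)"
  by (simp add: hom_module_def)

lemma carrier_hom_module: "carrier (hom_module M N) = hom M N \<inter> extensional (carrier M)"
  by (simp add: hom_module_def)

lemma restrict_in_hom_module:
  assumes "group M" "f \<in> hom M N"
  shows "restrict f (carrier M) \<in> carrier (hom_module M N)"
proof -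
  interpret group M by fact
  show ?thesis using assms(2) by (auto simp: carrier_hom_module hom_def)
qed

context
  fixes M :: "('m, 'b) monoid_scheme" and N :: "('n, 'c) monoid_scheme"
  assumes M: "group M" and N: "comm_group N"
begin

interpretation M: group M by (rule M)
interpretation N: comm_group N by (rule N)

lemma hom_module_inverse:
  assumes "f \<in> carrier (hom_module M N)"
  shows "(\<lambda>m\<in>carrier M. inv\<^bsub>N\<^esub> f m) \<in> carrier (hom_module M N)"
proof -
  have "(\<lambda>m. inv\<^bsub>N\<^esub> f m) \<in> hom M N"
    using assms by (auto intro!: homI simp: carrier_hom_module hom_mult hom_in_carrier N.inv_mult)
  then show ?thesis by (rule restrict_in_hom_module[OF M])
qed

lemma comm_group_hom_module: "comm_group (hom_module M N)"
proof (rule comm_groupI)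
  fix f f' f'' assume f: "f \<in> carrier (hom_module M N)" "f' \<in> carrier (hom_module M N)"
    "f'' \<in> carrier (hom_module M N)"
  have [simp]: "f m \<in> carrier N" "f' m \<in> carrier N" "f'' m \<in> carrier N"
    if "m \<in> carrier M" for m
    using f that by (auto simp: carrier_hom_module hom_def)
  have mult: "h (m \<otimes>\<^bsub>M\<^esub> n) = h m \<otimes>\<^bsub>N\<^esub> h n"
    if "h \<in> carrier (hom_module M N)" "m \<in> carrier M" "n \<in> carrier M" for h m n
    using that by (simp add: carrier_hom_module hom_def)
  have "(\<lambda>m. f m \<otimes>\<^bsub>N\<^esub> f' m) \<in> hom M N"
    using f by (intro homI) (simp_all add: mult N.m_ac)
  then show "f \<otimes>\<^bsub>hom_module M N\<^esub> f' \<in> carrier (hom_module M N)"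
    unfolding hom_module_mult by (rule restrict_in_hom_module[OF M])
  show "f \<otimes>\<^bsub>hom_module M N\<^esub> f' \<otimes>\<^bsub>hom_module M N\<^esub> f'' =
      f \<otimes>\<^bsub>hom_module M N\<^esub> (f' \<otimes>\<^bsub>hom_module M N\<^esub> f'')"
    unfolding hom_module_mult by (rule restrict_ext) (use f in \<open>simp add: N.m_assoc\<close>)
  show "f \<otimes>\<^bsub>hom_module M N\<^esub> f' = f' \<otimes>\<^bsub>hom_module M N\<^esub> f"
    unfolding hom_module_mult by (rule restrict_ext) (use f in \<open>simp add: N.m_comm\<close>)
  show "\<one>\<^bsub>hom_module M N\<^esub> \<otimes>\<^bsub>hom_module M N\<^esub> f = f"
  proof (rule extensionalityI[of _ "carrier M"])
    show "f \<in> extensional (carrier M)" using f by (simp add: carrier_hom_module)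
  qed (use f in \<open>simp_all add: hom_module_mult hom_module_one\<close>)
  show "\<exists>h\<in>carrier (hom_module M N). h \<otimes>\<^bsub>hom_module M N\<^esub> f = \<one>\<^bsub>hom_module M N\<^esub>"
    unfolding hom_module_mult hom_module_one
    by (intro bexI[OF _ hom_module_inverse[OF f(1)]] restrict_ext) (use f in simp)
next
  show "\<one>\<^bsub>hom_module M N\<^esub> \<in> carrier (hom_module M N)"
    by (auto simp: carrier_hom_module hom_module_one hom_def)
qed

lemma hom_module_closed:
  "f \<in> carrier (hom_module M N) \<Longrightarrow> m \<in> carrier M \<Longrightarrow> f m \<in> carrier N"
  by (auto simp: carrier_hom_module hom_def)

lemma hom_module_mult_apply:
  "m \<in> carrier M \<Longrightarrow> (f \<otimes>\<^bsub>hom_module M N\<^esub> f') m = f m \<otimes>\<^bsub>N\<^esub> f' m"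
  by (simp add: hom_module_mult)

lemma hom_module_inv_apply:
  assumes f: "f \<in> carrier (hom_module M N)" and m: "m \<in> carrier M"
  shows "(inv\<^bsub>hom_module M N\<^esub> f) m = inv\<^bsub>N\<^esub> f m"
proof -
  interpret H: comm_group "hom_module M N" by (rule comm_group_hom_module)
  have "(inv\<^bsub>hom_module M N\<^esub> f \<otimes>\<^bsub>hom_module M N\<^esub> f) m = \<one>\<^bsub>N\<^esub>"
    using H.l_inv[OF f] m by (simp add: hom_module_one)
  then have "(inv\<^bsub>hom_module M N\<^esub> f) m \<otimes>\<^bsub>N\<^esub> f m = \<one>\<^bsub>N\<^esub>"
    using m by (simp add: hom_module_mult)
  from N.inv_equality[OF this] show ?thesis
    using hom_module_closed[OF _ m] f H.inv_closed[OF f] by simp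
qed

lemma hom_module_quot_apply:
  assumes "f \<in> carrier (hom_module M N)" "f' \<in> carrier (hom_module M N)" "m \<in> carrier M"
  shows "quot (hom_module M N) f f' m = quot N (f m) (f' m)"
  using assms by (simp add: quot_def hom_module_mult_apply hom_module_inv_apply)

lemma hom_module_eqI:
  assumes "f \<in> carrier (hom_module M N)" "f' \<in> carrier (hom_module M N)"
    and "\<And>m. m \<in> carrier M \<Longrightarrow> f m = f' m"
  shows "f = f'"
  using assms by (auto simp: carrier_hom_module intro: extensionalityI)

end

lemma hom_act_apply:
  "f \<in> carrier (hom_module M N) \<Longrightarrow> m \<in> carrier M \<Longrightarrow>
    hom_act G M actM N actN g f m = actN g (f (actM (inv\<^bsub>G\<^esub> g) m))"
  by (simp add: hom_act_def)

text \<open>The inverse in \<open>hom_act\<close> turns precomposition into a left action, since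
  inverting a product reverses the factors. The source is later the coset module or
  \<Delta>.\<close>

lemma hom_act_linear_action:
  fixes G (structure)
  assumes "linear_action G M actM" "linear_action G N actN"
  shows "linear_action G (hom_module M N) (hom_act G M actM N actN)"
proof -
  interpret linear_action G M actM by fact
  interpret N: linear_action G N actN by fact
  interpret H: comm_group "hom_module M N"
    by (rule comm_group_hom_module[OF M.is_group N.M.comm_group_axioms])
  note closed = hom_module_closed[OF M.is_group N.M.comm_group_axioms]
  have act_in: "hom_act G M actM N actN g f \<in> carrier (hom_module M N)"
    if g: "g \<in> carrier G" and f: "f \<in> carrier (hom_module M N)" for g f
  proof -
    note [simp] = closed[OF f]
    have "f (m \<otimes>\<^bsub>M\<^esub> n) = f m \<otimes>\<^bsub>N\<^esub> f n" if "m \<in> carrier M" "n \<in> carrier M" for m n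
      using f that by (simp add: carrier_hom_module hom_def)
    then have "(\<lambda>m. actN g (f (actM (inv g) m))) \<in> hom M N"
      using f g by (auto intro!: homI simp: act_mult N.act_mult)
    then show ?thesis
      using restrict_in_hom_module[OF M.is_group] f by (simp add: hom_act_def)
  qed
  show ?thesis
  proof unfold_locales
    fix g h f f' assume g: "g \<in> carrier G" and f: "f \<in> carrier (hom_module M N)"
    show "hom_act G M actM N actN g f \<in> carrier (hom_module M N)" by (rule act_in[OF g f])
    show "hom_act G M actM N actN g (hom_act G M actM N actN h f) =
        hom_act G M actM N actN (g \<otimes> h) f" if h: "h \<in> carrier G"
      by (rule hom_module_eqI[OF M.is_group N.M.comm_group_axioms act_in[OF g act_in[OF h f]]
            act_in[OF _ f]])
        (use f g h in \<open>simp_all add: closed[OF f] hom_act_apply act_in act_act N.act_act inv_mult_group\<close>)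
    show "hom_act G M actM N actN g (f \<otimes>\<^bsub>hom_module M N\<^esub> f') =
        hom_act G M actM N actN g f \<otimes>\<^bsub>hom_module M N\<^esub> hom_act G M actM N actN g f'"
      if f': "f' \<in> carrier (hom_module M N)"
      by (rule hom_module_eqI[OF M.is_group N.M.comm_group_axioms
            act_in[OF g H.m_closed[OF f f']] H.m_closed[OF act_in[OF g f] act_in[OF g f']]])
        (use f f' g in \<open>simp_all add: closed[OF f] closed[OF f'] H.m_closed[OF f f'] hom_act_apply act_in N.act_mult
            hom_module_mult_apply[OF M.is_group N.M.comm_group_axioms]\<close>)
  next
    fix f assume f: "f \<in> carrier (hom_module M N)"
    show "hom_act G M actM N actN \<one> f = f"
      by (rule hom_module_eqI[OF M.is_group N.M.comm_group_axioms act_in f])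
        (use f in \<open>simp_all add: closed[OF f] hom_act_apply\<close>)
  qed
qed

text \<open>Identities between cochains and between maps on the coset module are reduced to
  generators in this way. The induction runs over differences, so its step is that homomorphisms
  respect \<open>quot\<close>.\<close>

lemma hom_free_Abelian_group_eq:
  assumes "group M" "f \<in> hom (free_Abelian_group B) M" "f' \<in> hom (free_Abelian_group B) M"
    and eq: "\<And>b. b \<in> B \<Longrightarrow> f (frag_of b) = f' (frag_of b)"
    and c: "c \<in> carrier (free_Abelian_group B)"
  shows "f c = f' c"
proof -
  interpret f: group_hom "free_Abelian_group B" M f
    using assms by (simp add: group_hom_def group_hom_axioms_def)
  interpret f': group_hom "free_Abelian_group B" M f'
    using assms by (simp add: group_hom_def group_hom_axioms_def)
  have "Poly_Mapping.keys c \<subseteq> B" using c by simp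
  then show ?thesis
  proof (rule free_Abelian_group_induct)
    show "f 0 = f' 0" using f.hom_one f'.hom_one by simp
  next
    fix x y assume xy: "Poly_Mapping.keys x \<subseteq> B" "Poly_Mapping.keys y \<subseteq> B"
      and eqs: "f x = f' x" "f y = f' y"
    have "h (x - y) = quot M (h x) (h y)" if "group_hom (free_Abelian_group B) M h" for h
      using group_hom_quot[OF that, of x y] xy by (simp add: quot_def)
    from this[OF f.group_hom_axioms] this[OF f'.group_hom_axioms]
    show "f (x - y) = f' (x - y)" using eqs by simp
  qed (rule eq)
qed

lemma frag_extend_hom:
  assumes "\<And>b. b \<in> B \<Longrightarrow> Poly_Mapping.keys (f b) \<subseteq> C"
  shows "frag_extend f \<in> hom (free_Abelian_group B) (free_Abelian_group C)"
proof (rule homI)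
  fix x assume "x \<in> carrier (free_Abelian_group B)"
  then show "frag_extend f x \<in> carrier (free_Abelian_group C)"
    using assms keys_frag_extend[of f x] by (simp add: UN_subset_iff subset_iff) blast
qed (simp add: frag_extend_add)

section \<open>Cochains on the standard resolution\<close>

lemma group_bar [simp]: "group (bar G n)"
  by (simp add: bar_def)

lemma carrier_bar: "c \<in> carrier (bar G n) \<longleftrightarrow> Poly_Mapping.keys c \<subseteq> bar_basis G n"
  by (simp add: bar_def)

lemma mult_bar [simp]: "c \<otimes>\<^bsub>bar G n\<^esub> d = c + d"
  by (simp add: bar_def)

lemma bar_basis_iff:
  "(h, gs) \<in> bar_basis G n \<longleftrightarrow> h \<in> carrier G \<and> length gs = n \<and> set gs \<subseteq> carrier G"
  by (auto simp: bar_basis_def)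

context group
begin

lemma bar_symbol_closed [simp]:
  "length gs = n \<Longrightarrow> set gs \<subseteq> carrier G \<Longrightarrow> bar_symbol G gs \<in> carrier (bar G n)"
  by (simp add: bar_symbol_def carrier_bar bar_basis_iff)

lemma bar_act_symbol [simp]:
  assumes "length gs = n" "set gs \<subseteq> carrier G" "h \<in> carrier G"
  shows "bar_act G n h (bar_symbol G gs) = frag_of (h, gs)"
  using assms bar_symbol_closed[OF assms(1,2)] by (simp add: bar_act_def bar_symbol_def)

lemma bar_act_hom:
  assumes "g \<in> carrier G"
  shows "bar_act G n g \<in> hom (bar G n) (bar G n)"
proof -
  have "frag_extend (\<lambda>(h, gs). frag_of (g \<otimes> h, gs)) \<in> hom (bar G n) (bar G n)"
    unfolding bar_def by (rule frag_extend_hom) (use assms in \<open>auto simp: bar_basis_iff\<close>)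
  then show ?thesis
    using restrict_in_hom_module[OF group_bar]
    by (simp add: bar_act_def carrier_hom_module)
qed

lemma bar_act_basis:
  "(h, gs) \<in> bar_basis G n \<Longrightarrow> bar_act G n g (frag_of (h, gs)) = frag_of (g \<otimes> h, gs)"
  by (simp add: bar_act_def carrier_bar)

lemma bar_boundary_basis:
  assumes "(h, gs) \<in> bar_basis G (Suc n)"
  shows "bar_boundary G (frag_of (h, gs)) \<in> carrier (bar G n)"
proof -
  have gs: "h \<in> carrier G" "length gs = Suc n" "set gs \<subseteq> carrier G"
    using assms by (auto simp: bar_basis_iff)
  then obtain x xs where x: "gs = x # xs" by (cases gs) auto
  have "(h, merge_at G i gs) \<in> bar_basis G n" if i: "1 \<le> i" "i < length gs" for i
  proof -
    have "gs ! (i - 1) \<in> carrier G" "gs ! i \<in> carrier G"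
      using gs i by (auto simp: subset_iff)
    then show ?thesis
      using gs i by (auto simp: bar_basis_iff merge_at_def dest: in_set_takeD in_set_dropD)
  qed
  then have "(\<Sum>i = 1..<length gs. frag_cmul ((- 1) ^ i) (frag_of (h, merge_at G i gs)))
      \<in> carrier (bar G n)"
    unfolding bar_def by (intro sum_closed_free_Abelian_group) auto
  moreover have "(h \<otimes> hd gs, tl gs) \<in> bar_basis G n" "(h, butlast gs) \<in> bar_basis G n"
    using gs x by (auto simp: bar_basis_iff dest: in_set_butlastD)
  ultimately have "frag_of (h \<otimes> hd gs, tl gs) \<in> carrier (bar G n)"
    "(\<Sum>i = 1..<length gs. frag_cmul ((- 1) ^ i) (frag_of (h, merge_at G i gs)))
      \<in> carrier (bar G n)"
    "frag_cmul ((- 1) ^ length gs) (frag_of (h, butlast gs)) \<in> carrier (bar G n)"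
    by (auto simp: carrier_bar)
  then have "frag_of (h \<otimes> hd gs, tl gs) \<otimes>\<^bsub>bar G n\<^esub>
      (\<Sum>i = 1..<length gs. frag_cmul ((- 1) ^ i) (frag_of (h, merge_at G i gs))) \<otimes>\<^bsub>bar G n\<^esub>
      frag_cmul ((- 1) ^ length gs) (frag_of (h, butlast gs)) \<in> carrier (bar G n)"
    by (intro monoid.m_closed group.is_monoid group_bar)
  then show ?thesis by (simp add: bar_boundary_def)
qed

lemma bar_boundary_hom: "bar_boundary G \<in> hom (bar G (Suc n)) (bar G n)"
  unfolding bar_def bar_boundary_def
  by (rule frag_extend_hom)
    (use bar_boundary_basis[unfolded bar_boundary_def, where n = n] in \<open>auto simp: carrier_bar\<close>)

lemma bar_boundary_closed [simp]:
  "c \<in> carrier (bar G (Suc n)) \<Longrightarrow> bar_boundary G c \<in> carrier (bar G n)"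
  using hom_in_carrier[OF bar_boundary_hom] .

lemma bar_act_closed [simp]:
  "g \<in> carrier G \<Longrightarrow> c \<in> carrier (bar G n) \<Longrightarrow> bar_act G n g c \<in> carrier (bar G n)"
  using hom_in_carrier[OF bar_act_hom] .

text \<open>Each term of the boundary of h[gs] keeps its coefficient on the far left, as h or as h
  g_1, so left multiplication by g commutes with the boundary by associativity.\<close>

lemma bar_boundary_act:
  assumes g: "g \<in> carrier G" and c: "c \<in> carrier (bar G (Suc n))"
  shows "bar_boundary G (bar_act G (Suc n) g c) = bar_act G n g (bar_boundary G c)"
proof -
  let ?f = "\<lambda>(h, gs). frag_of (g \<otimes> h, gs)"
  have "(bar_boundary G \<circ> frag_extend ?f) c = (frag_extend ?f \<circ> bar_boundary G) c"
  proof (rule hom_free_Abelian_group_eq[where M = "bar G n" and c = c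
        and f = "bar_boundary G \<circ> frag_extend ?f" and f' = "frag_extend ?f \<circ> bar_boundary G"])
    have 1: "frag_extend ?f \<in> hom (bar G m) (bar G m)" for m
      unfolding bar_def by (rule frag_extend_hom) (use g in \<open>auto simp: bar_basis_iff\<close>)
    show "c \<in> carrier (free_Abelian_group (bar_basis G (Suc n)))" using c by (simp add: bar_def)
    show "bar_boundary G \<circ> frag_extend ?f \<in> hom (free_Abelian_group (bar_basis G (Suc n))) (bar G n)"
      using 1 bar_boundary_hom unfolding bar_def by (rule Group.hom_compose)
    show "frag_extend ?f \<circ> bar_boundary G \<in> hom (free_Abelian_group (bar_basis G (Suc n))) (bar G n)"
      using bar_boundary_hom 1 unfolding bar_def by (rule Group.hom_compose)
    show "(bar_boundary G \<circ> frag_extend ?f) (frag_of b) = (frag_extend ?f \<circ> bar_boundary G) (frag_of b)"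
      if b_in: "b \<in> bar_basis G (Suc n)" for b
    proof -
      obtain h gs where b: "b = (h, gs)" and h: "h \<in> carrier G" "length gs = Suc n"
          "set gs \<subseteq> carrier G"
        using b_in by (cases b) (auto simp: bar_basis_iff)
      then have "hd gs \<in> carrier G" by (cases gs) auto
      then show ?thesis
        using g h by (simp add: b bar_boundary_def frag_extend_add frag_extend_sum
            frag_extend_cmul frag_extend_minus m_assoc o_def del: minus_frag_cmul)
    qed
  qed (rule group_bar)
  then show ?thesis using assms by (simp add: bar_act_def)
qed

end

context linear_action
begin

lemma cochainsD:
  assumes "f \<in> carrier (cochains G M act n)"
  shows "f \<in> hom (bar G n) M" "f \<in> extensional (carrier (bar G n))"
    and "\<And>g c. g \<in> carrier G \<Longrightarrow> c \<in> carrier (bar G n) \<Longrightarrow> f (bar_act G n g c) = act g (f c)"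
  using assms by (auto simp: cochains_def equivariant_hom_def carrier_hom_module)

lemma cochains_closed:
  "f \<in> carrier (cochains G M act n) \<Longrightarrow> c \<in> carrier (bar G n) \<Longrightarrow> f c \<in> carrier M"
  using cochainsD(1) hom_in_carrier by metis

lemma cochains_group_hom:
  "f \<in> carrier (cochains G M act n) \<Longrightarrow> group_hom (bar G n) M f"
  using cochainsD(1) by (simp add: group_hom_def group_hom_axioms_def M.is_group)

lemma cochainsI:
  assumes "f \<in> hom (bar G n) M"
    and "\<And>g c. g \<in> carrier G \<Longrightarrow> c \<in> carrier (bar G n) \<Longrightarrow> f (bar_act G n g c) = act g (f c)"
  shows "restrict f (carrier (bar G n)) \<in> carrier (cochains G M act n)"
  using restrict_in_hom_module[OF group_bar assms(1)] assms(2)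
  by (simp add: cochains_def equivariant_hom_def)

lemma cochains_basis:
  assumes "f \<in> carrier (cochains G M act n)" "(h, gs) \<in> bar_basis G n"
  shows "f (frag_of (h, gs)) = act h (f (bar_symbol G gs))"
proof -
  have "h \<in> carrier G" "length gs = n" "set gs \<subseteq> carrier G"
    using assms(2) by (auto simp: bar_basis_iff)
  then show ?thesis
    using cochainsD(3)[OF assms(1), of h "bar_symbol G gs"] by simp
qed

text \<open>Equivariance determines the value at h[gs] from the value at [gs], and the elements
  h[gs] form a \<int>-basis.\<close>

lemma cochains_eqI:
  assumes f: "f \<in> carrier (cochains G M act n)" "f' \<in> carrier (cochains G M act n)"
    and eq: "\<And>gs. length gs = n \<Longrightarrow> set gs \<subseteq> carrier G \<Longrightarrow>
      f (bar_symbol G gs) = f' (bar_symbol G gs)"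
  shows "f = f'"
proof (rule extensionalityI)
  fix c assume c: "c \<in> carrier (bar G n)"
  show "f c = f' c"
  proof (rule hom_free_Abelian_group_eq)
    show "f (frag_of b) = f' (frag_of b)" if "b \<in> bar_basis G n" for b
      using that by (cases b)
        (use eq in \<open>simp add: cochains_basis[OF f(1)] cochains_basis[OF f(2)] bar_basis_iff\<close>)
  qed (use c cochainsD(1)[OF f(1)] cochainsD(1)[OF f(2)] M.is_group in \<open>auto simp: bar_def\<close>)
qed (use cochainsD(2)[OF f(1)] cochainsD(2)[OF f(2)] in auto)

text \<open>Freeness over the group ring, derived from freeness over \<int>: h[gs] is sent to h
  \<phi>(gs), and equivariance then only has to be checked on this basis.\<close>

lemma cochain_of_symbols:
  assumes \<phi>: "\<And>gs. length gs = n \<Longrightarrow> set gs \<subseteq> carrier G \<Longrightarrow> \<phi> gs \<in> carrier M"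
  obtains f where "f \<in> carrier (cochains G M act n)"
    and "\<And>gs. length gs = n \<Longrightarrow> set gs \<subseteq> carrier G \<Longrightarrow> f (bar_symbol G gs) = \<phi> gs"
proof -
  let ?\<phi> = "\<lambda>(h, gs). act h (\<phi> gs)"
  have "?\<phi> ` bar_basis G n \<subseteq> carrier M"
    using \<phi> by (auto simp: bar_basis_iff)
  then obtain f where f: "f \<in> hom (bar G n) M"
    and f_of: "\<And>b. b \<in> bar_basis G n \<Longrightarrow> f (frag_of b) = ?\<phi> b"
    unfolding bar_def using M.free_Abelian_group_universal by metis
  have equiv: "f (bar_act G n g c) = act g (f c)"
    if g: "g \<in> carrier G" and c: "c \<in> carrier (bar G n)" for g c
  proof -
    have "(f \<circ> bar_act G n g) c = (act g \<circ> f) c"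
    proof (rule hom_free_Abelian_group_eq)
      show "f \<circ> bar_act G n g \<in> hom (free_Abelian_group (bar_basis G n)) M"
        using bar_act_hom[OF g] f unfolding bar_def by (rule Group.hom_compose)
      show "act g \<circ> f \<in> hom (free_Abelian_group (bar_basis G n)) M"
        using f group_hom.homh[OF act_group_hom[OF g]] unfolding bar_def by (rule Group.hom_compose)
      show "c \<in> carrier (free_Abelian_group (bar_basis G n))" using c by (simp add: bar_def)
      show "(f \<circ> bar_act G n g) (frag_of b) = (act g \<circ> f) (frag_of b)"
        if "b \<in> bar_basis G n" for b
      proof (cases b)
        case (Pair h gs)
        then have "(g \<otimes> h, gs) \<in> bar_basis G n" using that g by (simp add: bar_basis_iff)
        then show ?thesis
          using that g Pair f_of[of "(h, gs)"] f_of[of "(g \<otimes> h, gs)"] \<phi>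
          by (simp add: bar_act_basis act_act bar_basis_iff)
      qed
    qed (rule M.is_group)
    then show ?thesis by simp
  qed
  show thesis
  proof (rule that)
    show "restrict f (carrier (bar G n)) \<in> carrier (cochains G M act n)"
      using f equiv by (rule cochainsI)
    show "restrict f (carrier (bar G n)) (bar_symbol G gs) = \<phi> gs"
      if "length gs = n" "set gs \<subseteq> carrier G" for gs
      using that f_of[of "(\<one>, gs)"] \<phi>[OF that] bar_symbol_closed[OF that]
      by (simp add: bar_basis_iff bar_symbol_def)
  qed
qed

lemma coboundary_closed:
  assumes f: "f \<in> carrier (cochains G M act n)"
  shows "coboundary G n f \<in> carrier (cochains G M act (Suc n))"
proof -
  have "f \<circ> bar_boundary G \<in> hom (bar G (Suc n)) M"
    using bar_boundary_hom cochainsD(1)[OF f] by (rule Group.hom_compose)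
  then have "restrict (f \<circ> bar_boundary G) (carrier (bar G (Suc n)))
      \<in> carrier (cochains G M act (Suc n))"
    using f by (intro cochainsI) (auto simp: bar_boundary_act cochainsD(3))
  then show ?thesis by (simp add: coboundary_def o_def)
qed

text \<open>The boundary of [g] is g[] - [].\<close>

lemma coboundary_0:
  assumes f: "f \<in> carrier (cochains G M act 0)" and g: "g \<in> carrier G"
  shows "coboundary G 0 f (bar_symbol G [g]) =
    quot M (act g (f (bar_symbol G []))) (f (bar_symbol G []))"
proof -
  interpret f: group_hom "bar G 0" M f using f by (rule cochains_group_hom)
  have "bar_boundary G (bar_symbol G [g]) =
      quot (bar G 0) (frag_of (g, [])) (bar_symbol G [])"
    using g by (simp add: bar_symbol_def bar_boundary_def quot_def bar_def bar_basis_iff)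
  then show ?thesis
    using g group_hom_quot[OF f.group_hom_axioms, of "frag_of (g, [])" "bar_symbol G []"]
      cochains_basis[OF f, of g "[]"] bar_symbol_closed[of "[g]" 1] bar_symbol_closed[of "[]" 0]
    by (simp add: coboundary_def carrier_bar bar_basis_iff)
qed

lemma coboundary_1:
  assumes f: "f \<in> carrier (cochains G M act 1)" and g: "g \<in> carrier G" and h: "h \<in> carrier G"
  shows "coboundary G 1 f (bar_symbol G [g, h]) =
    quot M (act g (f (bar_symbol G [h])) \<otimes>\<^bsub>M\<^esub> f (bar_symbol G [g])) (f (bar_symbol G [g \<otimes> h]))"
proof -
  interpret f: group_hom "bar G 1" M f using f by (rule cochains_group_hom)
  \<comment> \<open>The boundary is g[h] - [gh] + [g]; the positive terms are collected first, so
    that a single \<open>quot\<close> remains.\<close>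
  have "bar_boundary G (bar_symbol G [g, h]) =
      quot (bar G 1) (frag_of (g, [h]) + bar_symbol G [g]) (bar_symbol G [g \<otimes> h])"
    using g h by (simp add: bar_symbol_def bar_boundary_def quot_def bar_def bar_basis_iff
        merge_at_def)
  moreover have "f (frag_of (g, [h]) + bar_symbol G [g]) =
      f (frag_of (g, [h])) \<otimes>\<^bsub>M\<^esub> f (bar_symbol G [g])"
    using f.hom_mult[of "frag_of (g, [h])" "bar_symbol G [g]"] g h
    by (simp add: carrier_bar bar_basis_iff bar_symbol_def)
  moreover have "frag_of (g, [h]) + bar_symbol G [g] \<in> carrier (bar G 1)"
    using g h keys_add[of "frag_of (g, [h])" "bar_symbol G [g]"]
    by (auto simp: carrier_bar bar_basis_iff bar_symbol_def)
  ultimately show ?thesis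
    using g h group_hom_quot[OF f.group_hom_axioms, of
        "frag_of (g, [h]) + bar_symbol G [g]" "bar_symbol G [g \<otimes> h]"]
      cochains_basis[OF f, of g "[h]"] bar_symbol_closed[of "[g, h]" 2]
    by (simp add: coboundary_def bar_basis_iff numeral_2_eq_2)
qed

lemma cocycles_iff:
  "f \<in> carrier (cocycles G M act n) \<longleftrightarrow> f \<in> carrier (cochains G M act n) \<and>
    coboundary G n f = (\<lambda>c\<in>carrier (bar G (Suc n)). \<one>\<^bsub>M\<^esub>)"
  by (auto simp: cocycles_def kernel_def cochains_def equivariant_hom_def hom_module_one)

text \<open>Crossed homomorphisms: the coboundary is a 2-cochain, so it vanishes as soon as it
  vanishes on the symbols [g, h].\<close>

lemma cocycles_1_iff:
  "f \<in> carrier (cocycles G M act 1) \<longleftrightarrow> f \<in> carrier (cochains G M act 1) \<and>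
    (\<forall>g\<in>carrier G. \<forall>h\<in>carrier G.
       f (bar_symbol G [g \<otimes> h]) = act g (f (bar_symbol G [h])) \<otimes>\<^bsub>M\<^esub> f (bar_symbol G [g]))"
  (is "_ \<longleftrightarrow> _ \<and> ?C f")
proof (cases "f \<in> carrier (cochains G M act 1)")
  case f: True
  have [simp]: "f (bar_symbol G [g]) \<in> carrier M" if "g \<in> carrier G" for g
    using f that by (simp add: cochains_closed)
  \<comment> \<open>The zero function has to be known as a cochain before
    \<open>cochains_eqI\<close> can compare with it.\<close>
  have triv: "(\<lambda>c\<in>carrier (bar G 2). \<one>\<^bsub>M\<^esub>) \<in> carrier (cochains G M act 2)"
    by (rule cochainsI) (auto intro!: homI)
  have "coboundary G 1 f = (\<lambda>c\<in>carrier (bar G 2). \<one>\<^bsub>M\<^esub>) \<longleftrightarrow>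
      (\<forall>g\<in>carrier G. \<forall>h\<in>carrier G. coboundary G 1 f (bar_symbol G [g, h]) = \<one>\<^bsub>M\<^esub>)"
  proof (intro iffI ballI)
    assume *: "\<forall>g\<in>carrier G. \<forall>h\<in>carrier G. coboundary G 1 f (bar_symbol G [g, h]) = \<one>\<^bsub>M\<^esub>"
    show "coboundary G 1 f = (\<lambda>c\<in>carrier (bar G 2). \<one>\<^bsub>M\<^esub>)"
    proof (rule cochains_eqI[OF _ triv])
      show "coboundary G 1 f \<in> carrier (cochains G M act 2)"
        using coboundary_closed[OF f] by (simp add: numeral_2_eq_2)
      show "coboundary G 1 f (bar_symbol G gs) = (\<lambda>c\<in>carrier (bar G 2). \<one>\<^bsub>M\<^esub>) (bar_symbol G gs)"
        if gs: "length gs = 2" "set gs \<subseteq> carrier G" for gs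
        using * bar_symbol_closed[OF gs] gs by (auto simp: length_Suc_conv numeral_2_eq_2)
    qed
  qed (use bar_symbol_closed[of _ 2] in simp)
  also have "\<dots> \<longleftrightarrow> ?C f"
    using coboundary_1[OF f] by (intro ball_cong refl) (auto simp: M.quot_eq_iff)
  finally show ?thesis using f by (simp add: cocycles_iff numeral_2_eq_2)
qed (simp add: cocycles_iff)

end

text \<open>Serves \<open>ev_star\<close> and \<open>in_star\<close> at once: both are
  postcomposition with an equivariant homomorphism of coefficients, from A to Hom(P, A) and from
  there to Hom(\<Delta>, A).\<close>

lemma cochains_postcompose:
  assumes M: "linear_action G M act" and N: "linear_action G N act'"
    and u: "u \<in> hom M N"
    and equiv: "\<And>g m. g \<in> carrier G \<Longrightarrow> m \<in> carrier M \<Longrightarrow> u (act g m) = act' g (u m)"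
    and f: "f \<in> carrier (cochains G M act n)"
  shows "(\<lambda>c\<in>carrier (bar G n). u (f c)) \<in> carrier (cochains G N act' n)"
proof -
  interpret linear_action G M act by fact
  interpret N: linear_action G N act' by fact
  have "u \<circ> f \<in> hom (bar G n) N" using cochainsD(1)[OF f] u by (rule Group.hom_compose)
  then have "restrict (u \<circ> f) (carrier (bar G n)) \<in> carrier (cochains G N act' n)"
    using cochainsD(3)[OF f] cochains_closed[OF f] equiv by (intro N.cochainsI) auto
  then show ?thesis by (simp add: o_def)
qed

section \<open>The coset module and its augmentation\<close>

text \<open>The augmentation is induced by collapsing the basis to one point, so its additivity is
  inherited from \<open>frag_extend\<close>.\<close>

lemma ev_conv_frag_extend:
  "ev x = Poly_Mapping.lookup (frag_extend (\<lambda>_. frag_of ()) x) ()"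
  by (simp add: ev_def frag_extend_def lookup_sum)

lemma ev_add [simp]: "ev (x + y) = ev x + ev y"
  by (simp add: ev_conv_frag_extend frag_extend_add lookup_add)

lemma ev_diff [simp]: "ev (x - y) = ev x - ev y"
  by (simp add: ev_conv_frag_extend frag_extend_diff lookup_minus)

lemma ev_cmul [simp]: "ev (frag_cmul m x) = m * ev x"
  by (simp add: ev_conv_frag_extend frag_extend_cmul)

lemma ev_frag_of [simp]: "ev (frag_of k) = 1"
  by (simp add: ev_def)

lemma ev_hom: "ev \<in> hom (free_Abelian_group B) integer_group"
  by (rule homI) simp_all

locale subgroup_family = group G for G (structure) +
  fixes I :: "'i set" and S :: "'i \<Rightarrow> 'a set"
  assumes nonempty: "I \<noteq> {}"
    and subgrp: "i \<in> I \<Longrightarrow> subgroup (S i) G"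
begin

abbreviation cosets :: "('i \<times> 'a set) set" where "cosets \<equiv> coset_basis G I S"

definition translate :: "'a \<Rightarrow> 'i \<times> 'a set \<Rightarrow> 'i \<times> 'a set" where
  "translate g k = (fst k, g <# snd k)"

lemma S_subset [simp]: "i \<in> I \<Longrightarrow> S i \<subseteq> carrier G"
  using subgroup.subset[OF subgrp] .

lemma S_carrier: "i \<in> I \<Longrightarrow> s \<in> S i \<Longrightarrow> s \<in> carrier G"
  using S_subset by blast

lemma cosetsE:
  assumes "k \<in> cosets"
  obtains i g where "i \<in> I" "g \<in> carrier G" "k = translate g (i, S i)"
  using assms by (auto simp: coset_basis_def LCOSETS_def translate_def)

lemma translate_base_in_cosets:
  "i \<in> I \<Longrightarrow> g \<in> carrier G \<Longrightarrow> translate g (i, S i) \<in> cosets"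
  by (auto simp: coset_basis_def LCOSETS_def translate_def)

lemma snd_cosets: "k \<in> cosets \<Longrightarrow> snd k \<subseteq> carrier G"
  by (erule cosetsE) (simp add: translate_def l_coset_subset_G)

lemma translate_translate [simp]:
  "\<lbrakk>g \<in> carrier G; h \<in> carrier G; k \<in> cosets\<rbrakk> \<Longrightarrow>
    translate g (translate h k) = translate (g \<otimes> h) k"
  by (simp add: translate_def lcos_m_assoc snd_cosets)

lemma translate_one [simp]: "k \<in> cosets \<Longrightarrow> translate \<one> k = k"
  by (simp add: translate_def lcos_mult_one snd_cosets)

lemma base_in_cosets [simp]: "i \<in> I \<Longrightarrow> (i, S i) \<in> cosets"
  using translate_base_in_cosets[of i \<one>] by (simp add: translate_def lcos_mult_one)

lemma translate_in_cosets [simp]: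
  assumes "g \<in> carrier G" "k \<in> cosets"
  shows "translate g k \<in> cosets"
proof -
  obtain i h where "i \<in> I" "h \<in> carrier G" "k = translate h (i, S i)"
    using assms(2) by (rule cosetsE)
  then show ?thesis using assms(1) translate_base_in_cosets[of i "g \<otimes> h"] by simp
qed

lemma translate_base_eq:
  assumes "i \<in> I" "s \<in> S i"
  shows "translate s (i, S i) = (i, S i)"
  using coset_join3[of s "S i"] assms S_carrier[OF assms] subgrp by (simp add: translate_def)

lemma translate_base_eqD:
  assumes i: "i \<in> I" and g: "g \<in> carrier G" and h: "h \<in> carrier G"
    and eq: "translate g (i, S i) = translate h (i, S i)"
  shows "inv g \<otimes> h \<in> S i"
proof -
  have "h \<otimes> \<one> \<in> g <# S i"
    using eq subgroup.one_closed[OF subgrp[OF i]] by (auto simp: translate_def l_coset_def)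
  then obtain s where s: "s \<in> S i" "h = g \<otimes> s" using h by (auto simp: l_coset_def)
  then show ?thesis using g S_carrier[OF i] by (simp add: m_assoc[symmetric])
qed

text \<open>One fixed coset, which exists because the family is not empty. It splits the
  augmentation over \<int>, and functions that do not depend on the coset are evaluated at
  it.\<close>

definition base_coset :: "'i \<times> 'a set" where
  "base_coset = (let i = (SOME i. i \<in> I) in (i, S i))"

lemma base_coset_in_cosets [simp]: "base_coset \<in> cosets"
  using nonempty some_in_eq[of I] by (simp add: base_coset_def Let_def)

abbreviation "P \<equiv> coset_module G I S"

lemma P_eq: "P = free_Abelian_group cosets"
  by (simp add: coset_module_def)

lemma comm_group_P: "comm_group P"
  by (simp add: P_eq abelian_free_Abelian_group)

lemma group_P [simp]: "group P"
  by (simp add: P_eq)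

lemma carrier_P: "x \<in> carrier P \<longleftrightarrow> Poly_Mapping.keys x \<subseteq> cosets"
  by (simp add: P_eq)

lemma frag_of_in_P [simp]: "frag_of k \<in> carrier P \<longleftrightarrow> k \<in> cosets"
  by (simp add: P_eq)

lemma mult_P [simp]: "x \<otimes>\<^bsub>P\<^esub> y = x + y"
  by (simp add: P_eq)

lemma diff_in_P [simp]: "x \<in> carrier P \<Longrightarrow> y \<in> carrier P \<Longrightarrow> x - y \<in> carrier P"
  using keys_diff[of x y] by (fastforce simp: carrier_P)

lemma cmul_in_P [simp]: "x \<in> carrier P \<Longrightarrow> frag_cmul m x \<in> carrier P"
  using keys_cmul[of m x] by (auto simp: carrier_P)

lemma coset_act_frag_of [simp]: "coset_act G g (frag_of k) = frag_of (translate g k)"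
  by (cases k) (simp add: coset_act_def translate_def)

lemma coset_act_hom: "g \<in> carrier G \<Longrightarrow> coset_act G g \<in> hom P P"
  unfolding P_eq coset_act_def
proof (rule frag_extend_hom)
  fix k assume "g \<in> carrier G" "k \<in> cosets"
  then have "translate g k \<in> cosets" by simp
  then show "Poly_Mapping.keys (case k of (i, C) \<Rightarrow> frag_of (i, g <# C)) \<subseteq> cosets"
    by (cases k) (simp add: translate_def)
qed

lemma hom_P_eq:
  assumes "group M" "f \<in> hom P M" "f' \<in> hom P M"
    and "\<And>k. k \<in> cosets \<Longrightarrow> f (frag_of k) = f' (frag_of k)" "x \<in> carrier P"
  shows "f x = f' x"
  using hom_free_Abelian_group_eq[OF assms(1), of f cosets f'] assms(2-) by (simp add: P_eq)

lemma linear_action_P: "linear_action G P (coset_act G)"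
proof -
  interpret P: comm_group P by (rule comm_group_P)
  note P_eq' = hom_P_eq[OF group_P]
  show ?thesis
  proof unfold_locales
    fix g h x y assume g: "g \<in> carrier G" and x: "x \<in> carrier P"
    show "coset_act G g x \<in> carrier P" using hom_in_carrier[OF coset_act_hom[OF g] x] .
    show "coset_act G g (x \<otimes>\<^bsub>P\<^esub> y) = coset_act G g x \<otimes>\<^bsub>P\<^esub> coset_act G g y" if "y \<in> carrier P"
      using hom_mult[OF coset_act_hom[OF g] x that] .
    show "coset_act G g (coset_act G h x) = coset_act G (g \<otimes> h) x" if h: "h \<in> carrier G"
    proof -
      have "(coset_act G g \<circ> coset_act G h) x = coset_act G (g \<otimes> h) x"
        by (rule P_eq'[OF Group.hom_compose[OF coset_act_hom[OF h] coset_act_hom[OF g]]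
              coset_act_hom])
          (use g h x in simp_all)
      then show ?thesis by simp
    qed
  next
    fix x assume x: "x \<in> carrier P"
    have "(\<lambda>x. x) \<in> hom P P" by (auto intro: homI)
    then show "coset_act G \<one> x = x"
      using P_eq'[OF coset_act_hom[OF one_closed], of "\<lambda>x. x" x] x by simp
  qed
qed

lemma ev_coset_act:
  assumes g: "g \<in> carrier G" and x: "x \<in> carrier P"
  shows "ev (coset_act G g x) = ev x"
proof -
  have ev: "ev \<in> hom P integer_group" by (simp add: P_eq ev_hom)
  have "(ev \<circ> coset_act G g) x = ev x"
    using hom_P_eq[OF group_integer_group Group.hom_compose[OF coset_act_hom[OF g] ev] ev] x
    by simp
  then show ?thesis by simp
qed

abbreviation "\<Delta> \<equiv> Delta G I S"

lemma ev_group_hom: "group_hom P integer_group ev"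
  using ev_hom[of cosets] by (simp add: group_hom_def group_hom_axioms_def P_eq)

lemma carrier_Delta: "x \<in> carrier \<Delta> \<longleftrightarrow> x \<in> carrier P \<and> ev x = 0"
  by (auto simp: Delta_def kernel_def)

lemma mult_Delta [simp]: "x \<otimes>\<^bsub>\<Delta>\<^esub> y = x + y"
  by (simp add: Delta_def)

lemma comm_group_Delta: "comm_group \<Delta>"
proof (rule group.group_comm_groupI)
  show "group \<Delta>"
    unfolding Delta_def
    by (rule group.subgroup_imp_group[OF group_P group_hom.subgroup_kernel[OF ev_group_hom]])
qed simp

lemma group_Delta [simp]: "group \<Delta>"
  using comm_group_Delta by (rule comm_group.axioms)

lemma linear_action_Delta: "linear_action G \<Delta> (coset_act G)"
proof -
  interpret \<Delta>: comm_group \<Delta> by (rule comm_group_Delta)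
  interpret P: linear_action G P "coset_act G" by (rule linear_action_P)
  show ?thesis
    by unfold_locales
      (use P.act_mult P.act_act in \<open>auto simp: carrier_Delta ev_coset_act\<close>)
qed

text \<open>The projection of the coset module onto \<Delta> along the multiples of
  \<open>base_coset\<close>. It is additive but in general not equivariant, which suffices for
  extending single elements of Hom(\<Delta>, A).\<close>

definition retract :: "('i \<times> 'a set \<Rightarrow>\<^sub>0 int) \<Rightarrow> ('i \<times> 'a set \<Rightarrow>\<^sub>0 int)" where
  "retract x = x - frag_cmul (ev x) (frag_of base_coset)"

lemma retract_in_Delta [simp]: "x \<in> carrier P \<Longrightarrow> retract x \<in> carrier \<Delta>"
  by (simp add: retract_def carrier_Delta del: One_nat_def)

lemma retract_hom: "retract \<in> hom P \<Delta>"
  by (rule homI) (simp, simp add: retract_def frag_cmul_distrib)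

lemma retract_Delta [simp]: "x \<in> carrier \<Delta> \<Longrightarrow> retract x = x"
  by (simp add: retract_def carrier_Delta)

lemma restrict_in_hom_Delta:
  assumes "f \<in> hom P M"
  shows "restrict f (carrier \<Delta>) \<in> carrier (hom_module \<Delta> M)"
proof -
  have "f \<in> hom \<Delta> M"
    using assms by (auto intro!: homI simp: carrier_Delta hom_in_carrier[OF assms] hom_mult[OF assms, simplified])
  then show ?thesis by (rule restrict_in_hom_module[OF group_Delta])
qed

lemma hom_const_on_cosets:
  assumes M: "comm_group M" and f: "f \<in> hom P M" and c: "c \<in> carrier M"
    and eq: "\<And>k. k \<in> cosets \<Longrightarrow> f (frag_of k) = c" and x: "x \<in> carrier P"
  shows "f x = c [^]\<^bsub>M\<^esub> ev x"
proof -
  interpret M: comm_group M by fact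
  have "(\<lambda>x. c [^]\<^bsub>M\<^esub> ev x) \<in> hom P M"
    by (rule homI) (use c in \<open>simp_all add: M.int_pow_mult\<close>)
  then show ?thesis
    using hom_P_eq[OF M.is_group f, where f' = "\<lambda>x. c [^]\<^bsub>M\<^esub> ev x"] eq x c by simp
qed

text \<open>\<Delta> contains the differences of cosets; conversely, a homomorphism with one value c
  at all cosets sends x to (ev x) c. This is the passage from equations on \<Delta> to functions on
  cosets.\<close>

lemma hom_const_on_cosets_trivial_on_Delta:
  assumes M: "comm_group M" and f: "f \<in> hom P M"
  shows "(\<forall>x\<in>carrier \<Delta>. f x = \<one>\<^bsub>M\<^esub>) \<longleftrightarrow> (\<forall>k\<in>cosets. f (frag_of k) = f (frag_of base_coset))"
proof -
  interpret f: group_hom P M f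
    using M f by (simp add: group_hom_def group_hom_axioms_def comm_group_def)
  show ?thesis
  proof (intro iffI ballI)
    fix k assume *: "\<forall>x\<in>carrier \<Delta>. f x = \<one>\<^bsub>M\<^esub>" and k: "k \<in> cosets"
    let ?x = "frag_of k - frag_of base_coset"
    have "?x \<in> carrier \<Delta>" using k by (simp add: carrier_Delta)
    moreover have "f (?x \<otimes>\<^bsub>P\<^esub> frag_of base_coset) = f ?x \<otimes>\<^bsub>M\<^esub> f (frag_of base_coset)"
      using k by (intro f.hom_mult) simp_all
    ultimately show "f (frag_of k) = f (frag_of base_coset)" using * by auto
  next
    fix x assume *: "\<forall>k\<in>cosets. f (frag_of k) = f (frag_of base_coset)" and x: "x \<in> carrier \<Delta>"
    have "f x = f (frag_of base_coset) [^]\<^bsub>M\<^esub> ev x"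
      by (rule hom_const_on_cosets[OF M f]) (use x in \<open>simp_all add: carrier_Delta\<close>, use * in blast)
    then show "f x = \<one>\<^bsub>M\<^esub>" using x by (simp add: carrier_Delta)
  qed
qed

end

section \<open>First cohomology\<close>

text \<open>The degrees below are literals; with this rule the simplifier would turn
  \<open>1\<close> into \<open>Suc 0\<close>, and facts stated with \<open>1\<close> would no longer
  match.\<close>

declare One_nat_def [simp del]

context linear_action
begin

interpretation Q: comm_group "hom_module (bar G n) M" for n
  by (rule comm_group_hom_module[OF group_bar M.comm_group_axioms])

text \<open>Cochains are placed inside the group of all additive maps on the bar module, so that
  cosets of coboundaries can be compared there.\<close>

lemma cochains_subgroup: "subgroup (carrier (cochains G M act n)) (hom_module (bar G n) M)"
proof -
  have sub: "f \<in> carrier (hom_module (bar G n) M)" if "f \<in> carrier (cochains G M act n)" for f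
    using that by (simp add: cochains_def equivariant_hom_def)
  have equiv: "f \<in> carrier (cochains G M act n)"
    if "f \<in> carrier (hom_module (bar G n) M)"
      and "\<And>g c. g \<in> carrier G \<Longrightarrow> c \<in> carrier (bar G n) \<Longrightarrow> f (bar_act G n g c) = act g (f c)" for f
    using that by (simp add: cochains_def equivariant_hom_def)
  show ?thesis
  proof (rule Q.subgroupI)
    show "carrier (cochains G M act n) \<subseteq> carrier (hom_module (bar G n) M)" using sub by blast
    have "\<one>\<^bsub>hom_module (bar G n) M\<^esub> \<in> carrier (cochains G M act n)"
      by (rule equiv[OF Q.one_closed]) (simp add: hom_module_one)
    then show "carrier (cochains G M act n) \<noteq> {}" by blast
  next
    fix f assume f: "f \<in> carrier (cochains G M act n)"
    show "inv\<^bsub>hom_module (bar G n) M\<^esub> f \<in> carrier (cochains G M act n)"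
      by (rule equiv[OF Q.inv_closed[OF sub[OF f]]])
        (simp add: hom_module_inv_apply[OF group_bar M.comm_group_axioms sub[OF f]] act_inv
          cochains_closed[OF f] cochainsD(3)[OF f])
    fix f' assume f': "f' \<in> carrier (cochains G M act n)"
    show "f \<otimes>\<^bsub>hom_module (bar G n) M\<^esub> f' \<in> carrier (cochains G M act n)"
      by (rule equiv[OF Q.m_closed[OF sub[OF f] sub[OF f']]])
        (simp add: hom_module_mult act_mult
          cochains_closed[OF f] cochainsD(3)[OF f] cochains_closed[OF f'] cochainsD(3)[OF f'])
  qed
qed

text \<open>A 0-cochain amounts to its value m at the empty symbol, so these are the principal
  crossed homomorphisms.\<close>

lemma coboundaries_1_iff:
  "f \<in> coboundaries G M act 1 \<longleftrightarrow> f \<in> carrier (cochains G M act 1) \<and>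
    (\<exists>m\<in>carrier M. \<forall>g\<in>carrier G. f (bar_symbol G [g]) = quot M (act g m) m)"
proof safe
  assume "f \<in> coboundaries G M act 1"
  then obtain \<theta> where \<theta>: "\<theta> \<in> carrier (cochains G M act 0)" and f: "f = coboundary G 0 \<theta>"
    by (auto simp: coboundaries_def One_nat_def)
  show "f \<in> carrier (cochains G M act 1)" using coboundary_closed[OF \<theta>] f by (simp add: One_nat_def)
  show "\<exists>m\<in>carrier M. \<forall>g\<in>carrier G. f (bar_symbol G [g]) = quot M (act g m) m"
    using coboundary_0[OF \<theta>] cochains_closed[OF \<theta>, of "bar_symbol G []"] f by auto
next
  fix m assume f: "f \<in> carrier (cochains G M act 1)" and m: "m \<in> carrier M"
    and eq: "\<forall>g\<in>carrier G. f (bar_symbol G [g]) = quot M (act g m) m"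
  obtain \<theta> where \<theta>: "\<theta> \<in> carrier (cochains G M act 0)"
    and \<theta>_sym: "\<And>gs. length gs = 0 \<Longrightarrow> set gs \<subseteq> carrier G \<Longrightarrow> \<theta> (bar_symbol G gs) = m"
    using cochain_of_symbols[of 0 "\<lambda>_. m"] m by metis
  have "f = coboundary G 0 \<theta>"
  proof (rule cochains_eqI[OF f])
    show "coboundary G 0 \<theta> \<in> carrier (cochains G M act 1)"
      using coboundary_closed[OF \<theta>] by (simp add: One_nat_def)
    fix gs assume "length gs = 1" "set gs \<subseteq> carrier G"
    then obtain g where "gs = [g]" "g \<in> carrier G" by (auto simp: length_Suc_conv One_nat_def)
    then show "f (bar_symbol G gs) = coboundary G 0 \<theta> (bar_symbol G gs)"
      using eq coboundary_0[OF \<theta>, of g] \<theta>_sym[of "[]"] by simp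
  qed
  then show "f \<in> coboundaries G M act 1" using \<theta> by (auto simp: coboundaries_def One_nat_def)
qed

lemma coboundaries_1_subgroup: "subgroup (coboundaries G M act 1) (hom_module (bar G 1) M)"
proof -
  interpret C: subgroup "carrier (cochains G M act 1)" "hom_module (bar G 1) M"
    by (rule cochains_subgroup)
  have sym: "bar_symbol G [g] \<in> carrier (bar G 1)" if "g \<in> carrier G" for g
    using that by simp
  show ?thesis
  proof (rule Q.subgroupI)
    show "coboundaries G M act 1 \<subseteq> carrier (hom_module (bar G 1) M)"
      using C.subset coboundaries_1_iff by blast
    have "\<one>\<^bsub>hom_module (bar G 1) M\<^esub> \<in> coboundaries G M act 1"
      unfolding coboundaries_1_iff using C.one_closed sym
      by (auto simp: hom_module_one intro!: bexI[of _ "\<one>\<^bsub>M\<^esub>"])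
    then show "coboundaries G M act 1 \<noteq> {}" by blast
  next
    fix f assume f_in: "f \<in> coboundaries G M act 1"
    then obtain m where f: "f \<in> carrier (cochains G M act 1)" and m: "m \<in> carrier M"
      "\<And>g. g \<in> carrier G \<Longrightarrow> f (bar_symbol G [g]) = quot M (act g m) m"
      by (auto simp: coboundaries_1_iff)
    have "(inv\<^bsub>hom_module (bar G 1) M\<^esub> f) (bar_symbol G [g]) = quot M (act g (inv\<^bsub>M\<^esub> m)) (inv\<^bsub>M\<^esub> m)"
      if "g \<in> carrier G" for g
      using that m hom_module_inv_apply[OF group_bar M.comm_group_axioms _ sym[OF that], of f]
        C.mem_carrier[OF f] by (simp add: action_simps M.m_ac)
    then show "inv\<^bsub>hom_module (bar G 1) M\<^esub> f \<in> coboundaries G M act 1"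
      unfolding coboundaries_1_iff using C.m_inv_closed[OF f] m by blast
    fix f' assume "f' \<in> coboundaries G M act 1"
    then obtain m' where f': "f' \<in> carrier (cochains G M act 1)" and m': "m' \<in> carrier M"
      "\<And>g. g \<in> carrier G \<Longrightarrow> f' (bar_symbol G [g]) = quot M (act g m') m'"
      by (auto simp: coboundaries_1_iff)
    have "(f \<otimes>\<^bsub>hom_module (bar G 1) M\<^esub> f') (bar_symbol G [g]) =
        quot M (act g (m \<otimes>\<^bsub>M\<^esub> m')) (m \<otimes>\<^bsub>M\<^esub> m')" if "g \<in> carrier G" for g
      using that m m' sym[OF that] by (simp add: hom_module_mult action_simps M.m_ac)
    then show "f \<otimes>\<^bsub>hom_module (bar G 1) M\<^esub> f' \<in> coboundaries G M act 1"
      unfolding coboundaries_1_iff using C.m_closed[OF f f'] m m' by blast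
  qed
qed

text \<open>A right coset depends on the group only through its multiplication, and the record
  updates that define cochains and cocycles keep that of \<open>hom_module\<close>.\<close>

lemma cohomology_class_conv:
  "cohomology_class G M act n f = coboundaries G M act n #>\<^bsub>hom_module (bar G n) M\<^esub> f"
proof -
  have "monoid.mult (cocycles G M act n) = monoid.mult (hom_module (bar G n) M)"
    unfolding cocycles_def cochains_def equivariant_hom_def by simp
  then show ?thesis unfolding cohomology_class_def r_coset_def by (rule arg_cong)
qed

text \<open>Cosets of a subgroup agree iff the quotient of the representatives lies in it, and
  \<open>coboundaries_1_iff\<close> supplies m.\<close>

lemma cohomology_class_1_eq_iff:
  assumes f: "f \<in> carrier (cochains G M act 1)" and f': "f' \<in> carrier (cochains G M act 1)"
  shows "cohomology_class G M act 1 f = cohomology_class G M act 1 f' \<longleftrightarrow>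
    (\<exists>m\<in>carrier M. \<forall>g\<in>carrier G.
       quot M (f (bar_symbol G [g])) (f' (bar_symbol G [g])) = quot M (act g m) m)"
proof -
  let ?Q = "hom_module (bar G 1) M" and ?B = "coboundaries G M act 1"
  interpret C: subgroup "carrier (cochains G M act 1)" ?Q by (rule cochains_subgroup)
  interpret B: subgroup ?B ?Q by (rule coboundaries_1_subgroup)
  note class_eq = cohomology_class_conv
  have Qf: "f \<in> carrier ?Q" "f' \<in> carrier ?Q" using C.mem_carrier[OF f] C.mem_carrier[OF f'] .
  have "?B #>\<^bsub>?Q\<^esub> f = ?B #>\<^bsub>?Q\<^esub> f' \<longleftrightarrow> quot ?Q f f' \<in> ?B"
  proof
    have Qff': "f \<otimes>\<^bsub>?Q\<^esub> inv\<^bsub>?Q\<^esub> f' \<in> carrier ?Q" using Qf by (intro Q.m_closed Q.inv_closed)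
    show "quot ?Q f f' \<in> ?B" if "?B #>\<^bsub>?Q\<^esub> f = ?B #>\<^bsub>?Q\<^esub> f'"
      unfolding quot_def
      by (rule Q.coset_join1[OF Q.coset_mult_inv2[OF that Qf B.subset] Qff' coboundaries_1_subgroup])
    show "?B #>\<^bsub>?Q\<^esub> f = ?B #>\<^bsub>?Q\<^esub> f'" if "quot ?Q f f' \<in> ?B"
      using Q.coset_mult_inv1[OF Q.coset_join2[OF Qff' coboundaries_1_subgroup
            that[unfolded quot_def]] Qf B.subset] .
  qed
  moreover have "quot ?Q f f' \<in> carrier (cochains G M act 1)"
    unfolding quot_def by (rule C.m_closed[OF f C.m_inv_closed[OF f']])
  moreover have "quot ?Q f f' (bar_symbol G [g]) =
      quot M (f (bar_symbol G [g])) (f' (bar_symbol G [g]))" if "g \<in> carrier G" for g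
    by (rule hom_module_quot_apply[OF group_bar M.comm_group_axioms Qf]) (use that in simp)
  ultimately show ?thesis unfolding class_eq coboundaries_1_iff by simp
qed

end

section \<open>Relative cocycles in terms of functions on cosets\<close>

locale relative_module = subgroup_family G I S + linear_action G A act
  for G (structure) and I :: "'i set" and S :: "'i \<Rightarrow> 'a set"
    and A :: "('m, 'c) monoid_scheme" and act :: "'a \<Rightarrow> 'm \<Rightarrow> 'm"
begin

abbreviation "HP \<equiv> Hom_coset G I S A"
abbreviation "HP_act \<equiv> Hom_coset_act G I S A act"
abbreviation "HD \<equiv> Hom_Delta G I S A"
abbreviation "HD_act \<equiv> Hom_Delta_act G I S A act"

sublocale HP: linear_action G HP HP_act
  by (rule hom_act_linear_action[OF linear_action_P linear_action_axioms])

sublocale HD: linear_action G HD HD_act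
  by (rule hom_act_linear_action[OF linear_action_Delta linear_action_axioms])

abbreviation "family_1 \<equiv> carrier (family_cochains G I S A act 1)"

definition val :: "(('a \<times> 'a list \<Rightarrow>\<^sub>0 int) \<Rightarrow> ('i \<times> 'a set \<Rightarrow>\<^sub>0 int) \<Rightarrow> 'm) \<Rightarrow> 'a \<Rightarrow> 'i \<times> 'a set \<Rightarrow> 'm"
  where "val \<eta> g k = \<eta> (bar_symbol G [g]) (frag_of k)"

text \<open>The coboundary at the symbol [g, h] and the coset k of a cochain with coordinates F. The
  translation by \<open>inv g\<close> comes from the diagonal action on Hom.\<close>

definition diff :: "('a \<Rightarrow> 'i \<times> 'a set \<Rightarrow> 'm) \<Rightarrow> 'a \<Rightarrow> 'a \<Rightarrow> 'i \<times> 'a set \<Rightarrow> 'm" where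
  "diff F g h k = quot A (act g (F h (translate (inv g) k)) \<otimes>\<^bsub>A\<^esub> F g k) (F (g \<otimes> h) k)"

text \<open>The equation \<open>ev_star\<close> \<zeta> = d \<eta> in coordinates. Since F and Z are
  plain functions, it also applies to data read off from an extension.\<close>

definition splits :: "('a \<Rightarrow> 'i \<times> 'a set \<Rightarrow> 'm) \<Rightarrow> ('a \<Rightarrow> 'a \<Rightarrow> 'm) \<Rightarrow> bool" where
  "splits F Z \<longleftrightarrow> (\<forall>g\<in>carrier G. \<forall>k\<in>cosets. F g k \<in> carrier A) \<and>
    (\<forall>g\<in>carrier G. \<forall>h\<in>carrier G. \<forall>k\<in>cosets. Z g h = diff F g h k)"

lemma HP_closed: "f \<in> carrier HP \<Longrightarrow> x \<in> carrier P \<Longrightarrow> f x \<in> carrier A"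
  by (rule hom_module_closed[OF group_P M.comm_group_axioms])

lemma HP_hom: "f \<in> carrier HP \<Longrightarrow> f \<in> hom P A"
  by (simp add: carrier_hom_module)

lemma HP_eqI:
  assumes "f \<in> carrier HP" "f' \<in> carrier HP"
    and "\<And>k. k \<in> cosets \<Longrightarrow> f (frag_of k) = f' (frag_of k)"
  shows "f = f'"
  using hom_module_eqI[OF group_P M.comm_group_axioms assms(1,2)]
    hom_P_eq[OF M.is_group HP_hom HP_hom] assms by blast

lemma family_1_iff: "\<eta> \<in> family_1 \<longleftrightarrow> \<eta> \<in> carrier (cochains G HP HP_act 1)"
  by (simp add: family_cochains_def)

lemma family_symbol: "\<eta> \<in> family_1 \<Longrightarrow> g \<in> carrier G \<Longrightarrow> \<eta> (bar_symbol G [g]) \<in> carrier HP"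
  by (rule HP.cochains_closed[of _ 1]) (auto simp: family_1_iff)

lemma val_closed:
  "\<eta> \<in> family_1 \<Longrightarrow> g \<in> carrier G \<Longrightarrow> k \<in> cosets \<Longrightarrow> val \<eta> g k \<in> carrier A"
  unfolding val_def by (rule HP_closed[OF family_symbol]) auto

lemma coboundary_family_symbol:
  assumes "\<eta> \<in> family_1" "g \<in> carrier G" "h \<in> carrier G" "x \<in> carrier P"
  shows "coboundary G 1 \<eta> (bar_symbol G [g, h]) x =
    quot A (act g (\<eta> (bar_symbol G [h]) (coset_act G (inv g) x)) \<otimes>\<^bsub>A\<^esub> \<eta> (bar_symbol G [g]) x)
      (\<eta> (bar_symbol G [g \<otimes> h]) x)"
proof -
  have "coboundary G 1 \<eta> (bar_symbol G [g, h]) =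
      quot HP (HP_act g (\<eta> (bar_symbol G [h])) \<otimes>\<^bsub>HP\<^esub> \<eta> (bar_symbol G [g])) (\<eta> (bar_symbol G [g \<otimes> h]))"
    using assms HP.coboundary_1 family_1_iff by blast
  moreover note sym = family_symbol[OF assms(1)]
  ultimately show ?thesis
    using assms(2-)
    by (simp add: hom_module_quot_apply[OF group_P M.comm_group_axioms]
        hom_module_mult_apply[OF group_P M.comm_group_axioms] hom_act_apply)
qed

lemma coboundary_family_val:
  assumes "\<eta> \<in> family_1" "g \<in> carrier G" "h \<in> carrier G" "k \<in> cosets"
  shows "coboundary G 1 \<eta> (bar_symbol G [g, h]) (frag_of k) = diff (val \<eta>) g h k"
  using assms by (simp add: coboundary_family_symbol val_def diff_def)

lemma coboundary_family_closed:
  "\<eta> \<in> family_1 \<Longrightarrow> coboundary G 1 \<eta> \<in> carrier (cochains G HP HP_act 2)"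
  using HP.coboundary_closed[of \<eta> 1] by (simp add: family_1_iff)

lemma coboundary_family_symbol_closed:
  assumes "\<eta> \<in> family_1" "g \<in> carrier G" "h \<in> carrier G"
  shows "coboundary G 1 \<eta> (bar_symbol G [g, h]) \<in> carrier HP"
  by (rule HP.cochains_closed[OF coboundary_family_closed]) (use assms in auto)

text \<open>Postcomposition with the map that sends a to the homomorphism x \<mapsto> (ev x) a,
  which is equivariant because translations preserve the augmentation.\<close>

lemma ev_star_closed:
  assumes "\<zeta> \<in> carrier (cochains G A act n)"
  shows "ev_star G I S A n \<zeta> \<in> carrier (cochains G HP HP_act n)"
proof -
  let ?u = "\<lambda>a. \<lambda>x\<in>carrier P. a [^]\<^bsub>A\<^esub> ev x"
  have u_in: "?u a \<in> carrier HP" if "a \<in> carrier A" for a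
  proof (rule restrict_in_hom_module[OF group_P])
    show "(\<lambda>x. a [^]\<^bsub>A\<^esub> ev x) \<in> hom P A"
      by (rule homI) (use that in \<open>simp_all add: M.int_pow_mult\<close>)
  qed
  have "(\<lambda>c\<in>carrier (bar G n). ?u (\<zeta> c)) \<in> carrier (cochains G HP HP_act n)"
  proof (rule cochains_postcompose[OF linear_action_axioms HP.linear_action_axioms _ _ assms])
    show "?u \<in> hom A HP"
    proof (rule homI)
      fix a b assume "a \<in> carrier A" "b \<in> carrier A"
      then show "?u (a \<otimes>\<^bsub>A\<^esub> b) = ?u a \<otimes>\<^bsub>HP\<^esub> ?u b"
        unfolding hom_module_mult by (intro restrict_ext) (simp add: M.int_pow_distrib)
    qed (rule u_in)
    fix g a assume g: "g \<in> carrier G" and a: "a \<in> carrier A"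
    have [simp]: "coset_act G (inv g) x \<in> carrier P" if "x \<in> carrier P" for x
      using hom_in_carrier[OF coset_act_hom[OF inv_closed[OF g]] that] .
    show "?u (act g a) = HP_act g (?u a)"
      using g a u_in
      by (intro hom_module_eqI[OF group_P M.comm_group_axioms])
        (simp_all add: hom_act_apply[OF u_in] act_int_pow ev_coset_act)
  qed
  then show ?thesis by (simp add: ev_star_def)
qed

text \<open>Both sides are 2-cochains with values in homomorphisms on a free group, so they are
  compared at symbols [g, h] and single cosets, where the augmentation is 1.\<close>

lemma ev_star_eq_iff:
  assumes \<eta>: "\<eta> \<in> family_1" and \<zeta>: "\<zeta> \<in> carrier (cochains G A act 2)"
  shows "ev_star G I S A 2 \<zeta> = coboundary G 1 \<eta> \<longleftrightarrow>
    splits (val \<eta>) (\<lambda>g h. \<zeta> (bar_symbol G [g, h]))" (is "?L \<longleftrightarrow> ?R")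
proof -
  have sym: "bar_symbol G [g, h] \<in> carrier (bar G 2)" if "g \<in> carrier G" "h \<in> carrier G" for g h
    using that by simp
  have \<zeta>_in: "\<zeta> (bar_symbol G [g, h]) \<in> carrier A" if "g \<in> carrier G" "h \<in> carrier G" for g h
    using cochains_closed[OF \<zeta> sym[OF that]] .
  have ev: "ev_star G I S A 2 \<zeta> (bar_symbol G [g, h]) (frag_of k) = \<zeta> (bar_symbol G [g, h])"
    if "g \<in> carrier G" "h \<in> carrier G" "k \<in> cosets" for g h k
    using that sym[OF that(1,2)] \<zeta>_in[OF that(1,2)] by (simp add: ev_star_def)
  show ?thesis
  proof
    assume L: ?L
    show ?R unfolding splits_def
      using ev[unfolded L] coboundary_family_val[OF \<eta>] val_closed[OF \<eta>] by auto
  next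
    assume R: ?R
    show ?L
    proof (rule HP.cochains_eqI[OF ev_star_closed[OF \<zeta>] coboundary_family_closed[OF \<eta>]])
      fix gs assume gs: "length gs = 2" "set gs \<subseteq> carrier G"
      then obtain g h where gh: "gs = [g, h]" "g \<in> carrier G" "h \<in> carrier G"
        by (auto simp: length_Suc_conv numeral_2_eq_2 One_nat_def)
      show "ev_star G I S A 2 \<zeta> (bar_symbol G gs) = coboundary G 1 \<eta> (bar_symbol G gs)"
        unfolding gh(1)
      proof (rule HP_eqI)
        show "ev_star G I S A 2 \<zeta> (bar_symbol G [g, h]) \<in> carrier HP"
          using HP.cochains_closed[OF ev_star_closed[OF \<zeta>] sym] gh by blast
        show "coboundary G 1 \<eta> (bar_symbol G [g, h]) \<in> carrier HP"
          using coboundary_family_symbol_closed[OF \<eta>] gh by blast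
        show "ev_star G I S A 2 \<zeta> (bar_symbol G [g, h]) (frag_of k) =
            coboundary G 1 \<eta> (bar_symbol G [g, h]) (frag_of k)" if "k \<in> cosets" for k
          using that gh R ev coboundary_family_val[OF \<eta>] by (simp add: splits_def)
      qed
    qed
  qed
qed

text \<open>Freeness enters twice: over the cosets, for a homomorphism with the values F g for each
  g, and over the symbols [g], to assemble these into a cochain.\<close>

lemma family_of_val:
  assumes F: "\<And>g k. g \<in> carrier G \<Longrightarrow> k \<in> cosets \<Longrightarrow> F g k \<in> carrier A"
  obtains \<eta> where "\<eta> \<in> family_1" "\<And>g k. g \<in> carrier G \<Longrightarrow> k \<in> cosets \<Longrightarrow> val \<eta> g k = F g k"
proof -
  have "\<exists>f\<in>carrier HP. \<forall>k\<in>cosets. f (frag_of k) = F g k" if g: "g \<in> carrier G" for g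
  proof -
    have "F g ` cosets \<subseteq> carrier A" using F[OF g] by blast
    then obtain f where "f \<in> hom P A" "\<And>k. k \<in> cosets \<Longrightarrow> f (frag_of k) = F g k"
      unfolding P_eq using M.free_Abelian_group_universal by metis
    then show ?thesis
      using restrict_in_hom_module[OF group_P] by (intro bexI[of _ "restrict f (carrier P)"]) auto
  qed
  then obtain \<phi> where \<phi>: "\<And>g. g \<in> carrier G \<Longrightarrow> \<phi> g \<in> carrier HP"
    "\<And>g k. g \<in> carrier G \<Longrightarrow> k \<in> cosets \<Longrightarrow> \<phi> g (frag_of k) = F g k"
    by metis
  have "\<phi> (hd gs) \<in> carrier HP" if "length gs = 1" "set gs \<subseteq> carrier G" for gs
    using that by (intro \<phi>(1)) (cases gs; auto)
  then obtain \<eta> where "\<eta> \<in> carrier (cochains G HP HP_act 1)"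
    "\<And>gs. length gs = 1 \<Longrightarrow> set gs \<subseteq> carrier G \<Longrightarrow> \<eta> (bar_symbol G gs) = \<phi> (hd gs)"
    using HP.cochain_of_symbols[of 1 "\<lambda>gs. \<phi> (hd gs)"] by metis
  then show thesis by (intro that[of \<eta>]) (auto simp: family_1_iff val_def \<phi>)
qed

lemma cochain_2_of_symbols:
  assumes "\<And>g h. g \<in> carrier G \<Longrightarrow> h \<in> carrier G \<Longrightarrow> Z g h \<in> carrier A"
  obtains \<zeta> where "\<zeta> \<in> carrier (cochains G A act 2)"
    "\<And>g h. g \<in> carrier G \<Longrightarrow> h \<in> carrier G \<Longrightarrow> \<zeta> (bar_symbol G [g, h]) = Z g h"
proof -
  have "Z (gs ! 0) (gs ! 1) \<in> carrier A" if "length gs = 2" "set gs \<subseteq> carrier G" for gs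
    by (rule assms) (use that in \<open>auto simp: subset_iff\<close>)
  then obtain \<zeta> where "\<zeta> \<in> carrier (cochains G A act 2)"
    "\<And>gs. length gs = 2 \<Longrightarrow> set gs \<subseteq> carrier G \<Longrightarrow> \<zeta> (bar_symbol G gs) = Z (gs ! 0) (gs ! 1)"
    using cochain_of_symbols[of 2 "\<lambda>gs. Z (gs ! 0) (gs ! 1)"] by metis
  then show thesis by (intro that[of \<zeta>]) auto
qed

lemma in_star_closed:
  assumes "\<eta> \<in> family_1"
  shows "in_star G I S 1 \<eta> \<in> carrier (cochains G HD HD_act 1)"
  unfolding in_star_def
proof (rule cochains_postcompose[OF HP.linear_action_axioms HD.linear_action_axioms,
      where u = "\<lambda>f. restrict f (carrier \<Delta>)" and f = \<eta>])
  let ?u = "\<lambda>f. restrict f (carrier \<Delta>)"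
  interpret P: linear_action G P "coset_act G" by (rule linear_action_P)
  interpret \<Delta>: linear_action G \<Delta> "coset_act G" by (rule linear_action_Delta)
  have u_in: "?u f \<in> carrier HD" if "f \<in> carrier HP" for f
    using restrict_in_hom_Delta[OF HP_hom[OF that]] .
  show "?u \<in> hom HP HD"
  proof (rule homI)
    fix f f' assume "f \<in> carrier HP" "f' \<in> carrier HP"
    then show "?u (f \<otimes>\<^bsub>HP\<^esub> f') = ?u f \<otimes>\<^bsub>HD\<^esub> ?u f'"
      unfolding hom_module_mult by (auto simp: carrier_Delta)
  qed (rule u_in)
  show "?u (HP_act g f) = HD_act g (?u f)" if g: "g \<in> carrier G" and f: "f \<in> carrier HP" for g f
    by (rule hom_module_eqI[OF group_Delta M.comm_group_axioms u_in])
      (use g f u_in in \<open>auto simp: hom_act_apply carrier_Delta ev_coset_act\<close>)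
  show "\<eta> \<in> carrier (cochains G HP HP_act 1)" using assms by (simp add: family_1_iff)
qed

lemma in_star_symbol:
  "g \<in> carrier G \<Longrightarrow> x \<in> carrier \<Delta> \<Longrightarrow>
    in_star G I S 1 \<eta> (bar_symbol G [g]) x = \<eta> (bar_symbol G [g]) x"
  using bar_symbol_closed[of "[g]" 1] by (simp add: in_star_def)

lemma in_star_surj:
  assumes \<xi>: "\<xi> \<in> carrier (cochains G HD HD_act 1)"
  obtains \<eta> where "\<eta> \<in> family_1" "in_star G I S 1 \<eta> = \<xi>"
proof -
  \<comment> \<open>Extension of a homomorphism from \<Delta> to the coset module. Applied at each
    symbol it lifts \<xi>, since values at symbols may be prescribed freely.\<close>
  let ?ext = "\<lambda>f. restrict (f \<circ> retract) (carrier P)"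
  have ext_in: "?ext f \<in> carrier HP" if "f \<in> carrier HD" for f
  proof -
    have "f \<in> hom \<Delta> A" using that by (simp add: carrier_hom_module)
    from restrict_in_hom_module[OF group_P Group.hom_compose[OF retract_hom this]]
    show ?thesis .
  qed
  have "?ext (\<xi> (bar_symbol G gs)) \<in> carrier HP" if "length gs = 1" "set gs \<subseteq> carrier G" for gs
    using that by (intro ext_in HD.cochains_closed[OF \<xi>]) simp
  then obtain \<eta> where \<eta>: "\<eta> \<in> carrier (cochains G HP HP_act 1)"
    "\<And>gs. length gs = 1 \<Longrightarrow> set gs \<subseteq> carrier G \<Longrightarrow>
      \<eta> (bar_symbol G gs) = ?ext (\<xi> (bar_symbol G gs))"
    using HP.cochain_of_symbols[of 1 "\<lambda>gs. ?ext (\<xi> (bar_symbol G gs))"] by metis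
  have fam: "\<eta> \<in> family_1" using \<eta>(1) by (simp add: family_1_iff)
  have "in_star G I S 1 \<eta> = \<xi>"
  proof (rule HD.cochains_eqI[OF in_star_closed[OF fam] \<xi>])
    fix gs assume gs: "length gs = 1" "set gs \<subseteq> carrier G"
    then obtain g where g: "gs = [g]" "g \<in> carrier G" by (auto simp: length_Suc_conv One_nat_def)
    have sym: "bar_symbol G [g] \<in> carrier (bar G 1)" using g by simp
    show "in_star G I S 1 \<eta> (bar_symbol G gs) = \<xi> (bar_symbol G gs)"
      unfolding g(1)
    proof (rule hom_module_eqI[OF group_Delta M.comm_group_axioms])
      show "in_star G I S 1 \<eta> (bar_symbol G [g]) \<in> carrier HD" "\<xi> (bar_symbol G [g]) \<in> carrier HD"
        using HD.cochains_closed[OF in_star_closed[OF fam] sym] HD.cochains_closed[OF \<xi> sym] .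
      show "in_star G I S 1 \<eta> (bar_symbol G [g]) x = \<xi> (bar_symbol G [g]) x"
        if x: "x \<in> carrier \<Delta>" for x
        using \<eta>(2)[OF gs] x g(2) unfolding g(1) in_star_symbol[OF g(2) x] by (simp add: carrier_Delta)
    qed
  qed
  with fam show thesis by (rule that)
qed

text \<open>At [g, h], the crossed homomorphism identity for the restriction says that the
  coboundary of \<eta> vanishes on \<Delta>, that is, takes one value at all cosets.\<close>

lemma in_star_cocycle_iff:
  assumes \<eta>: "\<eta> \<in> family_1"
  shows "in_star G I S 1 \<eta> \<in> carrier (rel_cocycles G I S A act 2) \<longleftrightarrow>
    (\<forall>g\<in>carrier G. \<forall>h\<in>carrier G. \<forall>k\<in>cosets.
      diff (val \<eta>) g h k = diff (val \<eta>) g h base_coset)"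
proof -
  let ?\<xi> = "in_star G I S 1 \<eta>"
  interpret \<Delta>: linear_action G \<Delta> "coset_act G" by (rule linear_action_Delta)
  have "(?\<xi> (bar_symbol G [g \<otimes> h]) =
      HD_act g (?\<xi> (bar_symbol G [h])) \<otimes>\<^bsub>HD\<^esub> ?\<xi> (bar_symbol G [g])) \<longleftrightarrow>
      (\<forall>k\<in>cosets. diff (val \<eta>) g h k = diff (val \<eta>) g h base_coset)"
    if g: "g \<in> carrier G" and h: "h \<in> carrier G" for g h
  proof -
    have sym: "?\<xi> (bar_symbol G [g]) \<in> carrier HD" if "g \<in> carrier G" for g
      by (rule HD.cochains_closed[OF in_star_closed[OF \<eta>]]) (use that in simp)
    let ?D = "coboundary G 1 \<eta> (bar_symbol G [g, h])"
    have in_P: "x \<in> carrier P" if "x \<in> carrier \<Delta>" for x using that by (simp add: carrier_Delta)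
    have "?\<xi> (bar_symbol G [g \<otimes> h]) =
        HD_act g (?\<xi> (bar_symbol G [h])) \<otimes>\<^bsub>HD\<^esub> ?\<xi> (bar_symbol G [g]) \<longleftrightarrow>
      (\<forall>x\<in>carrier \<Delta>. ?\<xi> (bar_symbol G [g \<otimes> h]) x =
        (HD_act g (?\<xi> (bar_symbol G [h])) \<otimes>\<^bsub>HD\<^esub> ?\<xi> (bar_symbol G [g])) x)"
      using hom_module_eqI[OF group_Delta M.comm_group_axioms sym[OF m_closed[OF g h]]
          HD.M.m_closed[OF HD.act_closed[OF g sym[OF h]] sym[OF g]]] by metis
    also have "\<dots> \<longleftrightarrow> (\<forall>x\<in>carrier \<Delta>. ?D x = \<one>\<^bsub>A\<^esub>)"
    proof (rule ball_cong[OF refl])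
      fix x assume x: "x \<in> carrier \<Delta>"
      have cl: "\<eta> (bar_symbol G [u]) y \<in> carrier A" if "u \<in> carrier G" "y \<in> carrier \<Delta>" for u y
        using HP_closed[OF family_symbol[OF \<eta> that(1)] in_P[OF that(2)]] .
      have gx: "coset_act G (inv g) x \<in> carrier \<Delta>" using g x by simp
      have "(HD_act g (?\<xi> (bar_symbol G [h])) \<otimes>\<^bsub>HD\<^esub> ?\<xi> (bar_symbol G [g])) x =
          act g (\<eta> (bar_symbol G [h]) (coset_act G (inv g) x)) \<otimes>\<^bsub>A\<^esub> \<eta> (bar_symbol G [g]) x"
        by (simp only: hom_module_mult_apply[OF group_Delta M.comm_group_axioms x]
            hom_act_apply[OF sym[OF h] x] in_star_symbol[OF h gx] in_star_symbol[OF g x])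
      then show "(?\<xi> (bar_symbol G [g \<otimes> h]) x =
          (HD_act g (?\<xi> (bar_symbol G [h])) \<otimes>\<^bsub>HD\<^esub> ?\<xi> (bar_symbol G [g])) x) \<longleftrightarrow> ?D x = \<one>\<^bsub>A\<^esub>"
        unfolding coboundary_family_symbol[OF \<eta> g h in_P[OF x]]
          in_star_symbol[OF m_closed[OF g h] x]
        using cl[OF m_closed[OF g h] x] cl[OF g x] cl[OF h gx] g by (auto simp: M.quot_eq_iff)
    qed
    also have "\<dots> \<longleftrightarrow> (\<forall>k\<in>cosets. ?D (frag_of k) = ?D (frag_of base_coset))"
      by (rule hom_const_on_cosets_trivial_on_Delta[OF M.comm_group_axioms
          HP_hom[OF coboundary_family_symbol_closed[OF \<eta> g h]]])
    finally show ?thesis using coboundary_family_val[OF \<eta> g h] by simp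
  qed
  then show ?thesis
    using HD.cocycles_1_iff[of ?\<xi>] in_star_closed[OF \<eta>] by (simp add: rel_cocycles_def One_nat_def)
qed


text \<open>Equality of cohomology classes in coordinates: T is a 0-cochain on the cosets, and F -
  F' - dT has to vanish on \<Delta> only, so it may take any value c g that is the same at all
  cosets.\<close>

definition cohomologous :: "('a \<Rightarrow> 'i \<times> 'a set \<Rightarrow> 'm) \<Rightarrow> ('a \<Rightarrow> 'i \<times> 'a set \<Rightarrow> 'm) \<Rightarrow> bool" where
  "cohomologous F F' \<longleftrightarrow> (\<exists>T c. (\<forall>k\<in>cosets. T k \<in> carrier A) \<and> (\<forall>g\<in>carrier G. c g \<in> carrier A) \<and>
    (\<forall>g\<in>carrier G. \<forall>k\<in>cosets. quot A (F g k) (F' g k) =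
      c g \<otimes>\<^bsub>A\<^esub> quot A (act g (T (translate (inv g) k))) (T k)))"

lemma HD_extends_to_HP:
  assumes "m \<in> carrier HD"
  obtains \<theta> where "\<theta> \<in> carrier HP" "restrict \<theta> (carrier \<Delta>) = m"
proof -
  have "m \<in> hom \<Delta> A" "m \<in> extensional (carrier \<Delta>)"
    using assms by (simp_all add: carrier_hom_module)
  then have "restrict (m \<circ> retract) (carrier P) \<in> carrier HP"
    "restrict (restrict (m \<circ> retract) (carrier P)) (carrier \<Delta>) = m"
    using restrict_in_hom_module[OF group_P Group.hom_compose[OF retract_hom]]
    by (auto simp: carrier_Delta extensional_def fun_eq_iff retract_def)
  then show thesis by (rule that)
qed

text \<open>An element m of Hom(\<Delta>, A) witnessing equality of the classes extends to \<theta>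
  on the whole coset module. The defect \<open>?D \<theta> g\<close> of the coboundary equation
  vanishes on \<Delta>, hence is constant on cosets, and its value is c g.\<close>

lemma rel_cohomology_class_eq_iff:
  assumes \<eta>: "\<eta> \<in> family_1" and \<eta>': "\<eta>' \<in> family_1"
  shows "rel_cohomology_class G I S A act 2 (in_star G I S 1 \<eta>) =
      rel_cohomology_class G I S A act 2 (in_star G I S 1 \<eta>') \<longleftrightarrow>
    cohomologous (val \<eta>) (val \<eta>')"
proof -
  interpret PP: linear_action G P "coset_act G" by (rule linear_action_P)
  interpret \<Delta>: linear_action G \<Delta> "coset_act G" by (rule linear_action_Delta)
  note hD = group_Delta M.comm_group_axioms and hP = group_P M.comm_group_axioms
  let ?\<xi> = "in_star G I S 1 \<eta>" and ?\<xi>' = "in_star G I S 1 \<eta>'"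
  let ?D = "\<lambda>\<theta> g. quot HP (quot HP (\<eta> (bar_symbol G [g])) (\<eta>' (bar_symbol G [g])))
    (quot HP (HP_act g \<theta>) \<theta>)"
  let ?sol = "\<lambda>m. \<forall>g\<in>carrier G. quot HD (?\<xi> (bar_symbol G [g])) (?\<xi>' (bar_symbol G [g])) =
    quot HD (HD_act g m) m"
  have sym: "in_star G I S 1 e (bar_symbol G [g]) \<in> carrier HD"
    if "e \<in> family_1" "g \<in> carrier G" for e g
    by (rule HD.cochains_closed[OF in_star_closed[OF that(1)]]) (use that in simp)
  have D_in: "?D \<theta> g \<in> carrier HP" if "\<theta> \<in> carrier HP" "g \<in> carrier G" for \<theta> g
    using that family_symbol[OF \<eta>] family_symbol[OF \<eta>'] by simp
  have D_apply: "?D \<theta> g x = quot A (quot A (\<eta> (bar_symbol G [g]) x) (\<eta>' (bar_symbol G [g]) x))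
      (quot A (act g (\<theta> (coset_act G (inv g) x))) (\<theta> x))"
    if "\<theta> \<in> carrier HP" "g \<in> carrier G" "x \<in> carrier P" for \<theta> g x
    using that family_symbol[OF \<eta>] family_symbol[OF \<eta>']
    by (simp add: hom_module_quot_apply[OF hP] hom_act_apply)
  have in_P: "x \<in> carrier P" if "x \<in> carrier \<Delta>" for x using that by (simp add: carrier_Delta)
  have sol_iff: "?sol (restrict \<theta> (carrier \<Delta>)) \<longleftrightarrow>
      (\<forall>g\<in>carrier G. \<forall>k\<in>cosets. ?D \<theta> g (frag_of k) = ?D \<theta> g (frag_of base_coset))"
    if \<theta>: "\<theta> \<in> carrier HP" for \<theta>
  proof (rule ball_cong[OF refl])
    fix g assume g: "g \<in> carrier G"
    let ?m = "restrict \<theta> (carrier \<Delta>)"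
    have m: "?m \<in> carrier HD" using restrict_in_hom_Delta[OF HP_hom[OF \<theta>]] .
    have "quot HD (?\<xi> (bar_symbol G [g])) (?\<xi>' (bar_symbol G [g])) = quot HD (HD_act g ?m) ?m \<longleftrightarrow>
      (\<forall>x\<in>carrier \<Delta>. quot HD (?\<xi> (bar_symbol G [g])) (?\<xi>' (bar_symbol G [g])) x =
        quot HD (HD_act g ?m) ?m x)"
      using hom_module_eqI[OF hD HD.M.quot_closed[OF sym[OF \<eta> g] sym[OF \<eta>' g]]
          HD.M.quot_closed[OF HD.act_closed[OF g m] m]] by metis
    also have "\<dots> \<longleftrightarrow> (\<forall>x\<in>carrier \<Delta>. ?D \<theta> g x = \<one>\<^bsub>A\<^esub>)"
    proof (rule ball_cong[OF refl])
      fix x assume x: "x \<in> carrier \<Delta>"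
      have gx: "coset_act G (inv g) x \<in> carrier \<Delta>" using g x by simp
      have cl: "\<eta> (bar_symbol G [g]) x \<in> carrier A" "\<eta>' (bar_symbol G [g]) x \<in> carrier A"
        "\<theta> x \<in> carrier A" "\<theta> (coset_act G (inv g) x) \<in> carrier A"
        using HP_closed in_P[OF x] in_P[OF gx] family_symbol[OF \<eta> g] family_symbol[OF \<eta>' g] \<theta>
        by blast+
      have 1: "quot HD (HD_act g ?m) ?m x = quot A (act g (\<theta> (coset_act G (inv g) x))) (\<theta> x)"
        using hom_module_quot_apply[OF hD HD.act_closed[OF g m] m x] x gx
        by (simp add: hom_act_apply[OF m x])
      have 2: "quot HD (?\<xi> (bar_symbol G [g])) (?\<xi>' (bar_symbol G [g])) x =
          quot A (\<eta> (bar_symbol G [g]) x) (\<eta>' (bar_symbol G [g]) x)"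
        using hom_module_quot_apply[OF hD sym[OF \<eta> g] sym[OF \<eta>' g] x]
        by (simp add: in_star_symbol[OF g x])
      show "(quot HD (?\<xi> (bar_symbol G [g])) (?\<xi>' (bar_symbol G [g])) x =
          quot HD (HD_act g ?m) ?m x) \<longleftrightarrow> ?D \<theta> g x = \<one>\<^bsub>A\<^esub>"
        unfolding 1 2 D_apply[OF \<theta> g in_P[OF x]] using cl g by (simp add: M.quot_eq_iff[of "quot A _ _"])
    qed
    also have "\<dots> \<longleftrightarrow> (\<forall>k\<in>cosets. ?D \<theta> g (frag_of k) = ?D \<theta> g (frag_of base_coset))"
      by (rule hom_const_on_cosets_trivial_on_Delta[OF M.comm_group_axioms HP_hom[OF D_in[OF \<theta> g]]])
    finally show "quot HD (?\<xi> (bar_symbol G [g])) (?\<xi>' (bar_symbol G [g])) = quot HD (HD_act g ?m) ?m \<longleftrightarrow>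
      (\<forall>k\<in>cosets. ?D \<theta> g (frag_of k) = ?D \<theta> g (frag_of base_coset))" .
  qed
  \<comment> \<open>Solving for c turns the equation of \<open>cohomologous\<close> into the
    statement that the defect at k is c.\<close>
  have val_D: "quot A (val \<eta> g k) (val \<eta>' g k) = c \<otimes>\<^bsub>A\<^esub>
      quot A (act g (\<theta> (frag_of (translate (inv g) k)))) (\<theta> (frag_of k)) \<longleftrightarrow>
      ?D \<theta> g (frag_of k) = c"
    if "\<theta> \<in> carrier HP" "g \<in> carrier G" "k \<in> cosets" "c \<in> carrier A" for \<theta> g k c
  proof -
    have *: "frag_of k \<in> carrier P" "frag_of (translate (inv g) k) \<in> carrier P" using that by simp_all
    have "\<theta> (frag_of k) \<in> carrier A" "\<theta> (frag_of (translate (inv g) k)) \<in> carrier A"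
      using HP_closed[OF that(1)] * by blast+
    then show ?thesis
      using that val_closed[OF \<eta>, of g k] val_closed[OF \<eta>', of g k]
      by (simp add: D_apply val_def[symmetric] M.quot_eq_iff[of "quot A _ _" "quot A _ _"])
  qed
  have "rel_cohomology_class G I S A act 2 ?\<xi> = rel_cohomology_class G I S A act 2 ?\<xi>' \<longleftrightarrow>
      (\<exists>m\<in>carrier HD. ?sol m)"
    using HD.cohomology_class_1_eq_iff[OF in_star_closed[OF \<eta>] in_star_closed[OF \<eta>']]
    by (simp add: rel_cohomology_class_def One_nat_def)
  also have "\<dots> \<longleftrightarrow> (\<exists>\<theta>\<in>carrier HP. ?sol (restrict \<theta> (carrier \<Delta>)))"
  proof
    assume "\<exists>m\<in>carrier HD. ?sol m"
    then obtain m where m: "m \<in> carrier HD" "?sol m" by blast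
    obtain \<theta> where "\<theta> \<in> carrier HP" "restrict \<theta> (carrier \<Delta>) = m"
      using m(1) by (rule HD_extends_to_HP)
    then show "\<exists>\<theta>\<in>carrier HP. ?sol (restrict \<theta> (carrier \<Delta>))" using m(2) by blast
  next
    assume "\<exists>\<theta>\<in>carrier HP. ?sol (restrict \<theta> (carrier \<Delta>))"
    then show "\<exists>m\<in>carrier HD. ?sol m" using restrict_in_hom_Delta[OF HP_hom] by blast
  qed
  also have "\<dots> \<longleftrightarrow> cohomologous (val \<eta>) (val \<eta>')"
  proof
    assume "\<exists>\<theta>\<in>carrier HP. ?sol (restrict \<theta> (carrier \<Delta>))"
    then obtain \<theta> where \<theta>: "\<theta> \<in> carrier HP"
      and const: "\<And>g k. g \<in> carrier G \<Longrightarrow> k \<in> cosets \<Longrightarrow> ?D \<theta> g (frag_of k) = ?D \<theta> g (frag_of base_coset)"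
      using sol_iff by blast
    have c: "?D \<theta> g (frag_of base_coset) \<in> carrier A" if "g \<in> carrier G" for g
      by (rule HP_closed[OF D_in[OF \<theta> that]]) simp
    show "cohomologous (val \<eta>) (val \<eta>')"
      unfolding cohomologous_def
    proof (intro exI conjI ballI)
      show "\<theta> (frag_of k) \<in> carrier A" if "k \<in> cosets" for k
        using HP_closed[OF \<theta>] that by simp
      show "?D \<theta> g (frag_of base_coset) \<in> carrier A" if "g \<in> carrier G" for g by (rule c[OF that])
      show "quot A (val \<eta> g k) (val \<eta>' g k) = ?D \<theta> g (frag_of base_coset) \<otimes>\<^bsub>A\<^esub>
          quot A (act g (\<theta> (frag_of (translate (inv g) k)))) (\<theta> (frag_of k))"
        if "g \<in> carrier G" "k \<in> cosets" for g k
        using val_D[OF \<theta> that c[OF that(1)]] const[OF that] by blast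
    qed
  next
    assume "cohomologous (val \<eta>) (val \<eta>')"
    then obtain T c where T: "\<And>k. k \<in> cosets \<Longrightarrow> T k \<in> carrier A"
      and c: "\<And>g. g \<in> carrier G \<Longrightarrow> c g \<in> carrier A"
      and eq: "\<And>g k. g \<in> carrier G \<Longrightarrow> k \<in> cosets \<Longrightarrow> quot A (val \<eta> g k) (val \<eta>' g k) =
        c g \<otimes>\<^bsub>A\<^esub> quot A (act g (T (translate (inv g) k))) (T k)"
      unfolding cohomologous_def by blast
    have "T ` cosets \<subseteq> carrier A" using T by blast
    then obtain f where f: "f \<in> hom P A" "\<And>k. k \<in> cosets \<Longrightarrow> f (frag_of k) = T k"
      unfolding P_eq using M.free_Abelian_group_universal by metis
    \<comment> \<open>In the converse direction T is extended additively from the cosets; the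
      restriction of the result to \<Delta> is the required witness.\<close>
    let ?\<theta> = "restrict f (carrier P)"
    have \<theta>: "?\<theta> \<in> carrier HP" using restrict_in_hom_module[OF group_P f(1)] .
    have \<theta>_T: "?\<theta> (frag_of k) = T k" if "k \<in> cosets" for k using f that by simp
    have "?D ?\<theta> g (frag_of k) = c g" if g: "g \<in> carrier G" and k: "k \<in> cosets" for g k
      using val_D[OF \<theta> g k c[OF g]] eq[OF g k] \<theta>_T[OF k] \<theta>_T[OF translate_in_cosets[OF inv_closed[OF g] k]]
      by simp
    then have "?sol (restrict ?\<theta> (carrier \<Delta>))"
      unfolding sol_iff[OF \<theta>] by (metis base_coset_in_cosets)
    then show "\<exists>\<theta>\<in>carrier HP. ?sol (restrict \<theta> (carrier \<Delta>))" using \<theta> by blast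
  qed
  finally show ?thesis .
qed

section \<open>From functions on cosets back to cochains\<close>

lemma splits_cong:
  assumes "splits F Z"
    and "\<And>g k. g \<in> carrier G \<Longrightarrow> k \<in> cosets \<Longrightarrow> F' g k = F g k"
    and "\<And>g h. g \<in> carrier G \<Longrightarrow> h \<in> carrier G \<Longrightarrow> Z' g h = Z g h"
  shows "splits F' Z'"
  using assms unfolding splits_def by (auto simp: diff_def)

text \<open>Used for surjectivity: functions F and Z read off from an extension come from actual
  cochains.\<close>

lemma relative_cocycle_of_splits:
  assumes "splits F Z"
  obtains \<eta> \<zeta> where "\<eta> \<in> family_1" "\<zeta> \<in> carrier (cochains G A act 2)"
    and "in_star G I S 1 \<eta> \<in> carrier (rel_cocycles G I S A act 2)"
    and "ev_star G I S A 2 \<zeta> = coboundary G 1 \<eta>"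
    and "\<And>g k. g \<in> carrier G \<Longrightarrow> k \<in> cosets \<Longrightarrow> val \<eta> g k = F g k"
    and "\<And>g h. g \<in> carrier G \<Longrightarrow> h \<in> carrier G \<Longrightarrow> \<zeta> (bar_symbol G [g, h]) = Z g h"
proof -
  have F: "F g k \<in> carrier A" if "g \<in> carrier G" "k \<in> cosets" for g k
    using assms that by (simp add: splits_def)
  have Z: "Z g h = diff F g h k" if "g \<in> carrier G" "h \<in> carrier G" "k \<in> cosets" for g h k
    using assms that unfolding splits_def by blast
  have "Z g h \<in> carrier A" if "g \<in> carrier G" "h \<in> carrier G" for g h
    unfolding Z[OF that base_coset_in_cosets] diff_def using that F by simp
  then obtain \<zeta> where \<zeta>: "\<zeta> \<in> carrier (cochains G A act 2)"
    "\<And>g h. g \<in> carrier G \<Longrightarrow> h \<in> carrier G \<Longrightarrow> \<zeta> (bar_symbol G [g, h]) = Z g h"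
    using cochain_2_of_symbols by metis
  obtain \<eta> where \<eta>: "\<eta> \<in> family_1" "\<And>g k. g \<in> carrier G \<Longrightarrow> k \<in> cosets \<Longrightarrow> val \<eta> g k = F g k"
    using family_of_val[of F] F by metis
  have splits: "splits (val \<eta>) (\<lambda>g h. \<zeta> (bar_symbol G [g, h]))"
    using assms \<eta>(2) \<zeta>(2) by (rule splits_cong)
  then have "in_star G I S 1 \<eta> \<in> carrier (rel_cocycles G I S A act 2)"
    unfolding in_star_cocycle_iff[OF \<eta>(1)] splits_def by (metis base_coset_in_cosets)
  moreover have "ev_star G I S A 2 \<zeta> = coboundary G 1 \<eta>"
    using splits by (simp add: ev_star_eq_iff[OF \<eta>(1) \<zeta>(1)])
  ultimately show thesis using \<eta> \<zeta> by (intro that)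
qed

text \<open>The augmentation is 1 at each coset, so \<zeta> at [g, h] has to be the value of d
  \<eta> at any of them, and the cocycle condition makes these values agree.\<close>

lemma ev_star_unique:
  assumes \<eta>: "\<eta> \<in> family_1" and coc: "in_star G I S 1 \<eta> \<in> carrier (rel_cocycles G I S A act 2)"
  shows "\<exists>!\<zeta>. \<zeta> \<in> carrier (cochains G A act 2) \<and> ev_star G I S A 2 \<zeta> = coboundary G 1 \<eta>"
proof (rule ex_ex1I)
  define Z where "Z = (\<lambda>g h. diff (val \<eta>) g h base_coset)"
  have sp: "splits (val \<eta>) Z"
    unfolding splits_def
  proof (intro conjI ballI)
    show "val \<eta> g k \<in> carrier A" if "g \<in> carrier G" "k \<in> cosets" for g k
      by (rule val_closed[OF \<eta> that])
    show "Z g h = diff (val \<eta>) g h k"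
      if "g \<in> carrier G" "h \<in> carrier G" "k \<in> cosets" for g h k
      using coc[unfolded in_star_cocycle_iff[OF \<eta>], THEN bspec, THEN bspec, THEN bspec, OF that]
      unfolding Z_def by (rule sym)
  qed
  have "Z g h \<in> carrier A" if "g \<in> carrier G" "h \<in> carrier G" for g h
    unfolding Z_def diff_def using that val_closed[OF \<eta>] by simp
  then obtain \<zeta> where \<zeta>: "\<zeta> \<in> carrier (cochains G A act 2)"
    "\<And>g h. g \<in> carrier G \<Longrightarrow> h \<in> carrier G \<Longrightarrow> \<zeta> (bar_symbol G [g, h]) = Z g h"
    using cochain_2_of_symbols by metis
  have "splits (val \<eta>) (\<lambda>g h. \<zeta> (bar_symbol G [g, h]))"
    by (rule splits_cong[OF sp refl \<zeta>(2)])
  then show "\<exists>\<zeta>. \<zeta> \<in> carrier (cochains G A act 2) \<and> ev_star G I S A 2 \<zeta> = coboundary G 1 \<eta>"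
    using \<zeta>(1) unfolding ev_star_eq_iff[OF \<eta> \<zeta>(1), symmetric] by blast
next
  have Z: "\<zeta> (bar_symbol G [g, h]) = diff (val \<eta>) g h base_coset"
    if "\<zeta> \<in> carrier (cochains G A act 2) \<and> ev_star G I S A 2 \<zeta> = coboundary G 1 \<eta>"
      "g \<in> carrier G" "h \<in> carrier G" for \<zeta> g h
  proof -
    have "splits (val \<eta>) (\<lambda>g h. \<zeta> (bar_symbol G [g, h]))"
      using that(1) ev_star_eq_iff[OF \<eta>, of \<zeta>] by simp
    then show ?thesis using that(2,3) base_coset_in_cosets unfolding splits_def by blast
  qed
  fix \<zeta> \<zeta>' assume a: "\<zeta> \<in> carrier (cochains G A act 2) \<and> ev_star G I S A 2 \<zeta> = coboundary G 1 \<eta>"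
    "\<zeta>' \<in> carrier (cochains G A act 2) \<and> ev_star G I S A 2 \<zeta>' = coboundary G 1 \<eta>"
  show "\<zeta> = \<zeta>'"
  proof (rule cochains_eqI[OF conjunct1[OF a(1)] conjunct1[OF a(2)]])
    fix gs assume "length gs = 2" "set gs \<subseteq> carrier G"
    then obtain g h where "gs = [g, h]" "g \<in> carrier G" "h \<in> carrier G"
      by (auto simp: length_Suc_conv numeral_2_eq_2)
    then show "\<zeta> (bar_symbol G gs) = \<zeta>' (bar_symbol G gs)"
      using Z[OF a(1)] Z[OF a(2)] by simp
  qed
qed

end

section \<open>Extensions from factor sets\<close>

text \<open>A 2-cocycle that need not be normalised: \<zeta> comes from an arbitrary lift of \<xi>,
  so Z 1 1 may be nonzero.\<close>

locale factor_set = linear_action G A act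
  for G (structure) and A :: "('m, 'c) monoid_scheme" and act :: "'a \<Rightarrow> 'm \<Rightarrow> 'm" +
  fixes Z :: "'a \<Rightarrow> 'a \<Rightarrow> 'm"
  assumes Z_closed [simp]: "g \<in> carrier G \<Longrightarrow> h \<in> carrier G \<Longrightarrow> Z g h \<in> carrier A"
    and Z_cocycle: "\<lbrakk>g \<in> carrier G; h \<in> carrier G; l \<in> carrier G\<rbrakk> \<Longrightarrow>
      act g (Z h l) \<otimes>\<^bsub>A\<^esub> Z g (h \<otimes> l) = Z g h \<otimes>\<^bsub>A\<^esub> Z (g \<otimes> h) l"
begin

definition ext_group :: "('m \<times> 'a) monoid" where
  "ext_group = \<lparr>carrier = carrier A \<times> carrier G,
     monoid.mult = (\<lambda>(a, g) (b, h). (a \<otimes>\<^bsub>A\<^esub> act g b \<otimes>\<^bsub>A\<^esub> Z g h, g \<otimes> h)),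
     one = (inv\<^bsub>A\<^esub> Z \<one> \<one>, \<one>)\<rparr>"

definition ext_incl :: "'m \<Rightarrow> 'm \<times> 'a" where
  "ext_incl a = (a \<otimes>\<^bsub>A\<^esub> inv\<^bsub>A\<^esub> Z \<one> \<one>, \<one>)"

lemma carrier_ext_group [simp]: "carrier ext_group = carrier A \<times> carrier G"
  by (simp add: ext_group_def)

lemma mult_ext_group [simp]:
  "(a, g) \<otimes>\<^bsub>ext_group\<^esub> (b, h) = (a \<otimes>\<^bsub>A\<^esub> act g b \<otimes>\<^bsub>A\<^esub> Z g h, g \<otimes> h)"
  by (simp add: ext_group_def)

lemma one_ext_group: "\<one>\<^bsub>ext_group\<^esub> = (inv\<^bsub>A\<^esub> Z \<one> \<one>, \<one>)"
  by (simp add: ext_group_def)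

text \<open>The cocycle identity at (1, 1, g) after cancellation; the identity at (g, 1, 1) gives
  the counterpart on the right.\<close>

lemma Z_one_left: "g \<in> carrier G \<Longrightarrow> Z \<one> g = Z \<one> \<one>"
  using Z_cocycle[of \<one> \<one> g] by simp

lemma Z_one_right: "g \<in> carrier G \<Longrightarrow> Z g \<one> = act g (Z \<one> \<one>)"
  using Z_cocycle[of g \<one> \<one>] by simp

lemma group_ext_group: "group ext_group"
proof (rule groupI)
  fix x y z assume "x \<in> carrier ext_group" "y \<in> carrier ext_group" "z \<in> carrier ext_group"
  then obtain a g b h c l where x: "x = (a, g)" "a \<in> carrier A" "g \<in> carrier G"
    and y: "y = (b, h)" "b \<in> carrier A" "h \<in> carrier G"
    and z: "z = (c, l)" "c \<in> carrier A" "l \<in> carrier G" by auto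
  show "x \<otimes>\<^bsub>ext_group\<^esub> y \<in> carrier ext_group" using x y by simp
  let ?b = "a \<otimes>\<^bsub>A\<^esub> act g b \<otimes>\<^bsub>A\<^esub> act (g \<otimes> h) c"
  have "a \<otimes>\<^bsub>A\<^esub> act g b \<otimes>\<^bsub>A\<^esub> Z g h \<otimes>\<^bsub>A\<^esub> act (g \<otimes> h) c \<otimes>\<^bsub>A\<^esub> Z (g \<otimes> h) l =
      ?b \<otimes>\<^bsub>A\<^esub> (Z g h \<otimes>\<^bsub>A\<^esub> Z (g \<otimes> h) l)"
    using x y z by (simp add: M.m_ac)
  also have "\<dots> = ?b \<otimes>\<^bsub>A\<^esub> (act g (Z h l) \<otimes>\<^bsub>A\<^esub> Z g (h \<otimes> l))"
    using Z_cocycle x y z by simp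
  also have "\<dots> = a \<otimes>\<^bsub>A\<^esub> act g (b \<otimes>\<^bsub>A\<^esub> act h c \<otimes>\<^bsub>A\<^esub> Z h l) \<otimes>\<^bsub>A\<^esub> Z g (h \<otimes> l)"
    using x y z by (simp add: act_mult act_act M.m_ac)
  finally show "x \<otimes>\<^bsub>ext_group\<^esub> y \<otimes>\<^bsub>ext_group\<^esub> z = x \<otimes>\<^bsub>ext_group\<^esub> (y \<otimes>\<^bsub>ext_group\<^esub> z)"
    using x y z by (simp add: m_assoc)
next
  show "\<one>\<^bsub>ext_group\<^esub> \<in> carrier ext_group" by (simp add: one_ext_group)
next
  fix x assume "x \<in> carrier ext_group"
  then obtain a g where x: "x = (a, g)" "a \<in> carrier A" "g \<in> carrier G" by auto
  show "\<one>\<^bsub>ext_group\<^esub> \<otimes>\<^bsub>ext_group\<^esub> x = x"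
    using x Z_one_left[of g] by (simp add: one_ext_group M.m_ac)
  \<comment> \<open>The solution b of b + (\<open>inv g\<close>) a + Z (\<open>inv g\<close>) g = -
    Z 1 1, the first component of the left inverse law.\<close>
  let ?b = "inv\<^bsub>A\<^esub> (Z \<one> \<one> \<otimes>\<^bsub>A\<^esub> act (inv g) a \<otimes>\<^bsub>A\<^esub> Z (inv g) g)"
  have "(?b, inv g) \<otimes>\<^bsub>ext_group\<^esub> x = \<one>\<^bsub>ext_group\<^esub>"
    using x by (simp add: one_ext_group M.quot_simps M.m_ac)
  then show "\<exists>y\<in>carrier ext_group. y \<otimes>\<^bsub>ext_group\<^esub> x = \<one>\<^bsub>ext_group\<^esub>"
    using x by (intro bexI[of _ "(?b, inv g)"]) auto
qed

sublocale E: group ext_group by (rule group_ext_group)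

lemma ext_incl_closed: "a \<in> carrier A \<Longrightarrow> ext_incl a \<in> carrier ext_group"
  by (simp add: ext_incl_def)

lemma ext_incl_hom: "ext_incl \<in> hom A ext_group"
  by (rule homI) (simp_all add: ext_incl_def M.quot_simps M.m_ac)

lemma ext_incl_mult:
  "b \<in> carrier A \<Longrightarrow> a \<in> carrier A \<Longrightarrow> g \<in> carrier G \<Longrightarrow>
    ext_incl b \<otimes>\<^bsub>ext_group\<^esub> (a, g) = (b \<otimes>\<^bsub>A\<^esub> a, g)"
  using Z_one_left[of g] by (simp add: ext_incl_def M.quot_simps M.m_ac)

lemma mult_ext_incl:
  "b \<in> carrier A \<Longrightarrow> a \<in> carrier A \<Longrightarrow> g \<in> carrier G \<Longrightarrow>
    (a, g) \<otimes>\<^bsub>ext_group\<^esub> ext_incl b = (a \<otimes>\<^bsub>A\<^esub> act g b, g)"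
  using Z_one_right[of g] by (simp add: ext_incl_def action_simps M.m_ac)

text \<open>The term b - g b is the principal crossed homomorphism that conjugation by an element of
  A adds to a section. It relates the conjugating elements of an equivalence to the values of T at
  the cosets \<open>S i\<close>.\<close>

lemma ext_incl_conj:
  assumes "b \<in> carrier A" "a \<in> carrier A" "g \<in> carrier G"
  shows "ext_incl b \<otimes>\<^bsub>ext_group\<^esub> (a, g) \<otimes>\<^bsub>ext_group\<^esub> inv\<^bsub>ext_group\<^esub> ext_incl b =
    (quot A (b \<otimes>\<^bsub>A\<^esub> a) (act g b), g)"
proof -
  have "(quot A (b \<otimes>\<^bsub>A\<^esub> a) (act g b), g) \<otimes>\<^bsub>ext_group\<^esub> ext_incl b = ext_incl b \<otimes>\<^bsub>ext_group\<^esub> (a, g)"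
    using assms by (simp add: ext_incl_mult mult_ext_incl M.quot_simps)
  then show ?thesis
    using assms ext_incl_closed[OF assms(1)]
    by (metis E.inv_solve_right E.m_closed M.m_closed M.quot_closed SigmaI act_closed carrier_ext_group)
qed

lemma group_extension_ext_group: "group_extension G A act ext_group ext_incl snd"
  unfolding group_extension_def
proof (intro conjI ballI)
  show "group ext_group" by (rule group_ext_group)
  show "ext_incl \<in> mon A ext_group"
    using ext_incl_hom by (auto simp: mon_def ext_incl_def intro!: inj_onI)
  show "snd \<in> epi ext_group G"
    using M.one_closed by (auto simp: epi_def intro!: homI)
  show "ext_incl ` carrier A = kernel ext_group G snd"
  proof (intro equalityI subsetI)
    fix x assume "x \<in> kernel ext_group G snd"
    then obtain a where a: "a \<in> carrier A" "x = (a, \<one>)" by (auto simp: kernel_def)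
    \<comment> \<open>The inclusion subtracts Z 1 1, so the preimage adds it back.\<close>
    then have "x = ext_incl (a \<otimes>\<^bsub>A\<^esub> Z \<one> \<one>)" by (simp add: ext_incl_def M.m_assoc)
    then show "x \<in> ext_incl ` carrier A" using a(1) by simp
  next
    fix x assume "x \<in> ext_incl ` carrier A"
    then obtain a where "a \<in> carrier A" "x = ext_incl a" by (rule imageE)
    then show "x \<in> kernel ext_group G snd" by (simp add: kernel_def ext_incl_def)
  qed
  fix e b assume e: "e \<in> carrier ext_group" and b: "b \<in> carrier A"
  then obtain a g where ag: "e = (a, g)" "a \<in> carrier A" "g \<in> carrier G" by auto
  have "e \<otimes>\<^bsub>ext_group\<^esub> ext_incl b = ext_incl (act (snd e) b) \<otimes>\<^bsub>ext_group\<^esub> e"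
    using b ag by (simp add: ext_incl_mult mult_ext_incl M.m_comm)
  moreover have "ext_incl (act (snd e) b) \<in> carrier ext_group"
    using b ag by (intro ext_incl_closed) simp
  ultimately show "e \<otimes>\<^bsub>ext_group\<^esub> ext_incl b \<otimes>\<^bsub>ext_group\<^esub> inv\<^bsub>ext_group\<^esub> e = ext_incl (act (snd e) b)"
    using E.inv_solve_right'[OF _ E.m_closed[OF e ext_incl_closed[OF b]] e] by blast
qed

end

text \<open>The condition relating Z and Z' says that they differ by the coboundary of c, written
  without inverses; it is what multiplicativity of f amounts to.\<close>

lemma factor_set_iso:
  assumes "factor_set G A act Z" "factor_set G A act Z'"
    and c: "\<And>g. g \<in> carrier G \<Longrightarrow> c g \<in> carrier A"
    and Z: "\<And>g h. g \<in> carrier G \<Longrightarrow> h \<in> carrier G \<Longrightarrow>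
      Z g h \<otimes>\<^bsub>A\<^esub> c (g \<otimes>\<^bsub>G\<^esub> h) = Z' g h \<otimes>\<^bsub>A\<^esub> (c g \<otimes>\<^bsub>A\<^esub> act g (c h))"
  defines "f \<equiv> \<lambda>(a, g). (a \<otimes>\<^bsub>A\<^esub> c g, g)"
  shows "f \<in> iso (factor_set.ext_group G A act Z) (factor_set.ext_group G A act Z')"
    and "a \<in> carrier A \<Longrightarrow> f (factor_set.ext_incl G A Z a) = factor_set.ext_incl G A Z' a"
proof -
  interpret Z: factor_set G A act Z by fact
  interpret Z': factor_set G A act Z' by fact
  have "f \<in> hom Z.ext_group Z'.ext_group"
  proof (rule homI)
    fix x y assume "x \<in> carrier Z.ext_group" "y \<in> carrier Z.ext_group"
    then obtain a g b h where x: "x = (a, g)" "a \<in> carrier A" "g \<in> carrier G"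
      and y: "y = (b, h)" "b \<in> carrier A" "h \<in> carrier G" by auto
    have "a \<otimes>\<^bsub>A\<^esub> act g b \<otimes>\<^bsub>A\<^esub> Z g h \<otimes>\<^bsub>A\<^esub> c (g \<otimes>\<^bsub>G\<^esub> h) =
        a \<otimes>\<^bsub>A\<^esub> act g b \<otimes>\<^bsub>A\<^esub> (Z g h \<otimes>\<^bsub>A\<^esub> c (g \<otimes>\<^bsub>G\<^esub> h))"
      using x y c by (simp add: Z.M.m_ac)
    also have "\<dots> = a \<otimes>\<^bsub>A\<^esub> c g \<otimes>\<^bsub>A\<^esub> act g (b \<otimes>\<^bsub>A\<^esub> c h) \<otimes>\<^bsub>A\<^esub> Z' g h"
      using x y c by (simp add: Z Z.act_mult Z.M.m_ac)
    finally show "f (x \<otimes>\<^bsub>Z.ext_group\<^esub> y) = f x \<otimes>\<^bsub>Z'.ext_group\<^esub> f y"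
      using x y c by (simp add: f_def)
  qed (use c in \<open>auto simp: f_def\<close>)
  moreover have "bij_betw f (carrier Z.ext_group) (carrier Z'.ext_group)"
    by (rule bij_betw_byWitness[where f' = "\<lambda>(a, g). (quot A a (c g), g)"])
      (use c in \<open>auto simp: f_def Z.M.quot_simps Z.M.m_ac\<close>)
  ultimately show "f \<in> iso Z.ext_group Z'.ext_group" by (simp add: iso_def)
  assume a: "a \<in> carrier A"
  \<comment> \<open>The condition at (1, 1) forces c 1 = Z 1 1 - Z' 1 1, which is exactly the
    discrepancy between the two inclusions.\<close>
  have "Z \<one>\<^bsub>G\<^esub> \<one>\<^bsub>G\<^esub> = Z' \<one>\<^bsub>G\<^esub> \<one>\<^bsub>G\<^esub> \<otimes>\<^bsub>A\<^esub> c \<one>\<^bsub>G\<^esub>"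
    using Z[of "\<one>\<^bsub>G\<^esub>" "\<one>\<^bsub>G\<^esub>"] c by (simp add: Z.M.m_assoc[symmetric])
  then show "f (Z.ext_incl a) = Z'.ext_incl a"
    using a c by (simp add: f_def Z.ext_incl_def Z'.ext_incl_def Z.M.quot_simps Z.M.m_ac)
qed

section \<open>The relative extension attached to functions on cosets\<close>

context relative_module
begin

lemma splits_closed:
  assumes "splits F Z"
  shows "g \<in> carrier G \<Longrightarrow> k \<in> cosets \<Longrightarrow> F g k \<in> carrier A"
  using assms unfolding splits_def by blast

lemma splits_diff:
  assumes "splits F Z"
  shows "g \<in> carrier G \<Longrightarrow> h \<in> carrier G \<Longrightarrow> k \<in> cosets \<Longrightarrow> Z g h = diff F g h k"
  using assms unfolding splits_def by blast

text \<open>The identity d d F = 0 written out. Z is a coboundary only among cochains with values in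
  functions on the cosets, not necessarily among those with values in A.\<close>

lemma splits_factor_set:
  assumes "splits F Z"
  shows "factor_set G A act Z"
proof unfold_locales
  note F = splits_closed[OF assms] and Z = splits_diff[OF assms]
  fix g h l assume g: "g \<in> carrier G" and h: "h \<in> carrier G"
  show "Z g h \<in> carrier A"
    unfolding Z[OF g h base_coset_in_cosets] using g h F by (simp add: diff_def)
  assume l: "l \<in> carrier G"
  let ?k = base_coset
  \<comment> \<open>Z h l does not depend on the coset; at this translate its terms, once acted on
    by g, cancel against those taken at \<open>?k\<close>.\<close>
  have "Z h l = diff F h l (translate (inv g) ?k)" using g h l by (intro Z) auto
  moreover have "Z g (h \<otimes> l) = diff F g (h \<otimes> l) ?k" "Z g h = diff F g h ?k"
    "Z (g \<otimes> h) l = diff F (g \<otimes> h) l ?k" using g h l by (auto intro!: Z)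
  ultimately show "act g (Z h l) \<otimes>\<^bsub>A\<^esub> Z g (h \<otimes> l) = Z g h \<otimes>\<^bsub>A\<^esub> Z (g \<otimes> h) l"
    using g h l F by (simp add: diff_def action_simps m_assoc inv_mult_group M.m_ac)
qed

text \<open>\<open>cocycle_rel_ext\<close> for arbitrary functions F and Z. The coset is spelled
  \<open>\<one> <# S i\<close> as there, so that the two agree by mere unfolding.\<close>

definition split_ext ::
    "('a \<Rightarrow> 'i \<times> 'a set \<Rightarrow> 'm) \<Rightarrow> ('a \<Rightarrow> 'a \<Rightarrow> 'm) \<Rightarrow> ('m \<times> 'a, 'm, 'a, 'i) rel_ext" where
  "split_ext F Z = \<lparr>total = factor_set.ext_group G A act Z, incl = factor_set.ext_incl G A Z,
     proj = snd, sect = (\<lambda>i s. (inv\<^bsub>A\<^esub> F s (i, \<one> <# S i), s))\<rparr>"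

lemma one_lcoset [simp]: "i \<in> I \<Longrightarrow> \<one> <# S i = S i"
  by (simp add: lcos_mult_one)

text \<open>Elements of \<open>S i\<close> fix the coset \<open>S i\<close>, so the translation in
  \<open>diff\<close> disappears: at this coset F is an ordinary cochain on \<open>S i\<close> whose
  coboundary is Z.\<close>

lemma splits_base:
  assumes "splits F Z" "i \<in> I" "s \<in> S i" "t \<in> S i"
  shows "Z s t = quot A (act s (F t (i, S i)) \<otimes>\<^bsub>A\<^esub> F s (i, S i)) (F (s \<otimes> t) (i, S i))"
  using splits_diff[OF assms(1), of s t "(i, S i)"] S_carrier[OF assms(2)] assms(3,4)
    translate_base_eq[OF assms(2) subgroup.m_inv_closed[OF subgrp[OF assms(2)] assms(3)]] assms(2)
  by (simp add: diff_def)

lemma split_ext_rel_extension: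
  assumes "splits F Z"
  shows "split_ext F Z \<in> rel_extensions G I S A act"
proof -
  interpret Z: factor_set G A act Z by (rule splits_factor_set[OF assms])
  have 1: "sect (split_ext F Z) i \<in> hom (G\<lparr>carrier := S i\<rparr>) Z.ext_group" if i: "i \<in> I" for i
  proof (rule homI)
    fix s t assume "s \<in> carrier (G\<lparr>carrier := S i\<rparr>)" "t \<in> carrier (G\<lparr>carrier := S i\<rparr>)"
    then have st: "s \<in> S i" "t \<in> S i" by simp_all
    then have "s \<in> carrier G" "t \<in> carrier G" using S_carrier[OF i] by blast+
    \<comment> \<open>In the first component this is - F (st) = - F s - s F t + Z s t at the coset
      \<open>S i\<close>.\<close>
    then show "sect (split_ext F Z) i (s \<otimes>\<^bsub>G\<lparr>carrier := S i\<rparr>\<^esub> t) =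
        sect (split_ext F Z) i s \<otimes>\<^bsub>Z.ext_group\<^esub> sect (split_ext F Z) i t"
      using i splits_closed[OF assms] splits_base[OF assms i st]
      by (simp add: split_ext_def action_simps M.m_ac)
  qed (use i S_carrier[OF i] splits_closed[OF assms] in \<open>auto simp: split_ext_def\<close>)
  have 2: "total (split_ext F Z) = Z.ext_group" "incl (split_ext F Z) = Z.ext_incl"
    "proj (split_ext F Z) = snd" "sect (split_ext F Z) i s = (inv\<^bsub>A\<^esub> F s (i, \<one> <# S i), s)" for i s
    by (simp_all add: split_ext_def)
  show ?thesis
    unfolding rel_extensions_def
  proof (intro CollectI conjI ballI)
    show "group_extension G A act (total (split_ext F Z)) (incl (split_ext F Z)) (proj (split_ext F Z))"
      unfolding 2 by (rule Z.group_extension_ext_group)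
    show "sect (split_ext F Z) i \<in> hom (G\<lparr>carrier := S i\<rparr>) (total (split_ext F Z))" if "i \<in> I" for i
      unfolding 2(1) by (rule 1[OF that])
    show "proj (split_ext F Z) (sect (split_ext F Z) i s) = s" for i s
      by (simp add: 2(3,4))
  qed
qed

end

section \<open>Equivalence of relative extensions\<close>

lemma rel_extensionsD:
  assumes "X \<in> rel_extensions G I S A act"
  shows "group (total X)" "incl X \<in> hom A (total X)" "inj_on (incl X) (carrier A)"
    "proj X \<in> hom (total X) G" "proj X ` carrier (total X) = carrier G"
    "incl X ` carrier A = kernel (total X) G (proj X)"
    and "\<And>e a. e \<in> carrier (total X) \<Longrightarrow> a \<in> carrier A \<Longrightarrow>
      e \<otimes>\<^bsub>total X\<^esub> incl X a \<otimes>\<^bsub>total X\<^esub> inv\<^bsub>total X\<^esub> e = incl X (act (proj X e) a)"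
    and "\<And>i. i \<in> I \<Longrightarrow> sect X i \<in> hom (G\<lparr>carrier := S i\<rparr>) (total X)"
    and "\<And>i s. i \<in> I \<Longrightarrow> s \<in> S i \<Longrightarrow> proj X (sect X i s) = s"
    and "\<And>a. a \<in> carrier A \<Longrightarrow> incl X a \<in> carrier (total X)"
    and "\<And>i s. i \<in> I \<Longrightarrow> s \<in> S i \<Longrightarrow> sect X i s \<in> carrier (total X)"
proof -
  have ext: "group_extension G A act (total X) (incl X) (proj X)"
    and sect: "\<And>i. i \<in> I \<Longrightarrow> sect X i \<in> hom (G\<lparr>carrier := S i\<rparr>) (total X)"
      "\<And>i s. i \<in> I \<Longrightarrow> s \<in> S i \<Longrightarrow> proj X (sect X i s) = s"
    using assms unfolding rel_extensions_def by blast+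
  show hom: "incl X \<in> hom A (total X)" and "group (total X)" "inj_on (incl X) (carrier A)"
    "proj X \<in> hom (total X) G" "proj X ` carrier (total X) = carrier G"
    "incl X ` carrier A = kernel (total X) G (proj X)"
    using ext unfolding group_extension_def mon_def epi_def by blast+
  show "e \<otimes>\<^bsub>total X\<^esub> incl X a \<otimes>\<^bsub>total X\<^esub> inv\<^bsub>total X\<^esub> e = incl X (act (proj X e) a)"
    if "e \<in> carrier (total X)" "a \<in> carrier A" for e a
    using ext that unfolding group_extension_def by blast
  show "incl X a \<in> carrier (total X)" if "a \<in> carrier A" for a
    using hom_in_carrier[OF hom that] .
  show "sect X i s \<in> carrier (total X)" if "i \<in> I" "s \<in> S i" for i s
    using hom_in_carrier[OF sect(1)[OF that(1)], of s] that(2) by simp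
  show "sect X i \<in> hom (G\<lparr>carrier := S i\<rparr>) (total X)" if "i \<in> I" for i using sect(1)[OF that] .
  show "proj X (sect X i s) = s" if "i \<in> I" "s \<in> S i" for i s using sect(2)[OF that] .
qed

lemma rel_ext_equivalentI:
  assumes "f \<in> iso (total X) (total Y)"
    and "\<And>a. a \<in> carrier A \<Longrightarrow> f (incl X a) = incl Y a"
    and "\<And>e. e \<in> carrier (total X) \<Longrightarrow> proj Y (f e) = proj X e"
    and "\<And>i. i \<in> I \<Longrightarrow> b i \<in> carrier A"
    and "\<And>i s. i \<in> I \<Longrightarrow> s \<in> S i \<Longrightarrow> sect Y i s =
      incl Y (b i) \<otimes>\<^bsub>total Y\<^esub> f (sect X i s) \<otimes>\<^bsub>total Y\<^esub> inv\<^bsub>total Y\<^esub> (incl Y (b i))"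
  shows "rel_ext_equivalent I S A X Y"
  unfolding rel_ext_equivalent_def using assms by blast

lemma rel_ext_equivalentE:
  assumes "rel_ext_equivalent I S A X Y"
  obtains f b where "f \<in> iso (total X) (total Y)"
    and "\<And>a. a \<in> carrier A \<Longrightarrow> f (incl X a) = incl Y a"
    and "\<And>e. e \<in> carrier (total X) \<Longrightarrow> proj Y (f e) = proj X e"
    and "\<And>i. i \<in> I \<Longrightarrow> b i \<in> carrier A"
    and "\<And>i s. i \<in> I \<Longrightarrow> s \<in> S i \<Longrightarrow> sect Y i s =
      incl Y (b i) \<otimes>\<^bsub>total Y\<^esub> f (sect X i s) \<otimes>\<^bsub>total Y\<^esub> inv\<^bsub>total Y\<^esub> (incl Y (b i))"
proof -
  obtain f where f: "f \<in> iso (total X) (total Y)"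
    "\<And>a. a \<in> carrier A \<Longrightarrow> f (incl X a) = incl Y a"
    "\<And>e. e \<in> carrier (total X) \<Longrightarrow> proj Y (f e) = proj X e"
    and "\<forall>i\<in>I. \<exists>b. b \<in> carrier A \<and> (\<forall>s\<in>S i. sect Y i s =
      incl Y b \<otimes>\<^bsub>total Y\<^esub> f (sect X i s) \<otimes>\<^bsub>total Y\<^esub> inv\<^bsub>total Y\<^esub> (incl Y b))"
    using assms unfolding rel_ext_equivalent_def by blast
  from bchoice[OF this(4)] obtain b where "\<forall>i\<in>I. b i \<in> carrier A \<and> (\<forall>s\<in>S i. sect Y i s =
      incl Y (b i) \<otimes>\<^bsub>total Y\<^esub> f (sect X i s) \<otimes>\<^bsub>total Y\<^esub> inv\<^bsub>total Y\<^esub> (incl Y (b i)))"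
    by blast
  then show thesis using f by (intro that[of f b]) blast+
qed

text \<open>The total groups of X and Y may have different types, so this is not symmetry of one
  relation. Together with transitivity it allows classes to be compared across types.\<close>

lemma rel_ext_equivalent_sym:
  assumes A: "group A" and X: "X \<in> rel_extensions G I S A act"
    and Y: "Y \<in> rel_extensions G I S A act" and "rel_ext_equivalent I S A X Y"
  shows "rel_ext_equivalent I S A Y X"
proof -
  note X' = rel_extensionsD[OF X] and Y' = rel_extensionsD[OF Y]
  interpret A: group A by fact
  interpret X: group "total X" by (rule X'(1))
  interpret Y: group "total Y" by (rule Y'(1))
  from assms(4) obtain f b where f: "f \<in> iso (total X) (total Y)"
    and incl: "\<And>a. a \<in> carrier A \<Longrightarrow> f (incl X a) = incl Y a"
    and proj: "\<And>e. e \<in> carrier (total X) \<Longrightarrow> proj Y (f e) = proj X e"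
    and b: "\<And>i. i \<in> I \<Longrightarrow> b i \<in> carrier A"
    and sect: "\<And>i s. i \<in> I \<Longrightarrow> s \<in> S i \<Longrightarrow> sect Y i s =
      incl Y (b i) \<otimes>\<^bsub>total Y\<^esub> f (sect X i s) \<otimes>\<^bsub>total Y\<^esub> inv\<^bsub>total Y\<^esub> (incl Y (b i))"
    by (rule rel_ext_equivalentE) blast
  let ?g = "inv_into (carrier (total X)) f"
  have g: "?g \<in> iso (total Y) (total X)" using X.iso_set_sym[OF f] .
  have bij: "bij_betw f (carrier (total X)) (carrier (total Y))" using f by (simp add: iso_def)
  have gf: "?g (f x) = x" if "x \<in> carrier (total X)" for x
    using bij that by (simp add: bij_betw_def)
  have fg: "f (?g y) = y" "?g y \<in> carrier (total X)" if "y \<in> carrier (total Y)" for y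
    using bij that by (auto simp: bij_betw_def f_inv_into_f inv_into_into)
  interpret g: group_hom "total Y" "total X" ?g
    using g by unfold_locales (simp add: iso_def)
  interpret \<iota>: group_hom A "total X" "incl X" by unfold_locales (rule X')
  have f_closed: "f x \<in> carrier (total Y)" if "x \<in> carrier (total X)" for x
    using bij that by (auto simp: bij_betw_def)
  have g_incl: "?g (incl Y a) = incl X a" if "a \<in> carrier A" for a
    using gf X'(10)[OF that] incl[OF that] by metis
  show ?thesis
  proof (rule rel_ext_equivalentI[where b = "\<lambda>i. inv\<^bsub>A\<^esub> b i", OF g g_incl])
    show "proj X (?g e) = proj Y e" if "e \<in> carrier (total Y)" for e
      using proj[OF fg(2)[OF that]] fg(1)[OF that] by simp
    fix i s assume i: "i \<in> I"
    show "inv\<^bsub>A\<^esub> b i \<in> carrier A" using b[OF i] by simp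
    assume s: "s \<in> S i"
    have bX: "incl X (b i) \<in> carrier (total X)" and bY: "incl Y (b i) \<in> carrier (total Y)"
      and sX: "sect X i s \<in> carrier (total X)"
      using X'(10) Y'(10) X'(11) b i s by blast+
    have "?g (sect Y i s) = incl X (b i) \<otimes>\<^bsub>total X\<^esub> sect X i s \<otimes>\<^bsub>total X\<^esub> inv\<^bsub>total X\<^esub> incl X (b i)"
      using sect[OF i s] bY f_closed[OF sX] gf[OF sX] g_incl[OF b[OF i]] by simp
    then show "sect X i s = incl X (inv\<^bsub>A\<^esub> b i) \<otimes>\<^bsub>total X\<^esub> ?g (sect Y i s) \<otimes>\<^bsub>total X\<^esub>
        inv\<^bsub>total X\<^esub> incl X (inv\<^bsub>A\<^esub> b i)"
      using bX sX b[OF i] by (simp add: X.m_assoc X.inv_solve_left)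
  qed
qed

lemma rel_ext_equivalent_trans:
  assumes A: "group A" and X: "X \<in> rel_extensions G I S A act"
    and Y: "Y \<in> rel_extensions G I S A act" and W: "W \<in> rel_extensions G I S A act"
    and "rel_ext_equivalent I S A X Y" "rel_ext_equivalent I S A Y W"
  shows "rel_ext_equivalent I S A X W"
proof -
  note X' = rel_extensionsD[OF X] and Y' = rel_extensionsD[OF Y] and W' = rel_extensionsD[OF W]
  interpret A: group A by fact
  interpret Y: group "total Y" by (rule Y'(1))
  interpret W: group "total W" by (rule W'(1))
  from assms(5) obtain f b where f: "f \<in> iso (total X) (total Y)"
    and incl: "\<And>a. a \<in> carrier A \<Longrightarrow> f (incl X a) = incl Y a"
    and proj: "\<And>e. e \<in> carrier (total X) \<Longrightarrow> proj Y (f e) = proj X e"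
    and b: "\<And>i. i \<in> I \<Longrightarrow> b i \<in> carrier A"
    and sect: "\<And>i s. i \<in> I \<Longrightarrow> s \<in> S i \<Longrightarrow> sect Y i s =
      incl Y (b i) \<otimes>\<^bsub>total Y\<^esub> f (sect X i s) \<otimes>\<^bsub>total Y\<^esub> inv\<^bsub>total Y\<^esub> (incl Y (b i))"
    by (rule rel_ext_equivalentE) blast
  from assms(6) obtain f' b' where f': "f' \<in> iso (total Y) (total W)"
    and incl': "\<And>a. a \<in> carrier A \<Longrightarrow> f' (incl Y a) = incl W a"
    and proj': "\<And>e. e \<in> carrier (total Y) \<Longrightarrow> proj W (f' e) = proj Y e"
    and b': "\<And>i. i \<in> I \<Longrightarrow> b' i \<in> carrier A"
    and sect': "\<And>i s. i \<in> I \<Longrightarrow> s \<in> S i \<Longrightarrow> sect W i s =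
      incl W (b' i) \<otimes>\<^bsub>total W\<^esub> f' (sect Y i s) \<otimes>\<^bsub>total W\<^esub> inv\<^bsub>total W\<^esub> (incl W (b' i))"
    by (rule rel_ext_equivalentE) blast
  interpret f': group_hom "total Y" "total W" f'
    using f' by unfold_locales (simp add: iso_def)
  interpret \<iota>: group_hom A "total W" "incl W" by unfold_locales (rule W')
  have f_closed: "f x \<in> carrier (total Y)" if "x \<in> carrier (total X)" for x
    using f that by (auto simp: iso_def bij_betw_def)
  show ?thesis
  \<comment> \<open>Since f' carries the inclusion of Y to that of W, conjugation by b becomes the
    inner one and b' the outer one.\<close>
  proof (rule rel_ext_equivalentI[where b = "\<lambda>i. b' i \<otimes>\<^bsub>A\<^esub> b i" and f = "f' \<circ> f"])
    show "f' \<circ> f \<in> iso (total X) (total W)" using f f' by (rule iso_set_trans)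
    show "(f' \<circ> f) (incl X a) = incl W a" if "a \<in> carrier A" for a
      using that incl incl' by simp
    show "proj W ((f' \<circ> f) e) = proj X e" if "e \<in> carrier (total X)" for e
      using that f_closed proj proj' by simp
    fix i s assume i: "i \<in> I"
    show "b' i \<otimes>\<^bsub>A\<^esub> b i \<in> carrier A" using b[OF i] b'[OF i] by simp
    assume s: "s \<in> S i"
    have bY: "incl Y (b i) \<in> carrier (total Y)" and bW: "incl W (b i) \<in> carrier (total W)"
      and b'W: "incl W (b' i) \<in> carrier (total W)" and sX: "f (sect X i s) \<in> carrier (total Y)"
      using Y'(10) W'(10) X'(11) b b' i s f_closed by blast+
    have "f' (sect Y i s) =
        incl W (b i) \<otimes>\<^bsub>total W\<^esub> f' (f (sect X i s)) \<otimes>\<^bsub>total W\<^esub> inv\<^bsub>total W\<^esub> incl W (b i)"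
      using sect[OF i s] bY sX incl'[OF b[OF i]] by simp
    then show "sect W i s = incl W (b' i \<otimes>\<^bsub>A\<^esub> b i) \<otimes>\<^bsub>total W\<^esub> (f' \<circ> f) (sect X i s) \<otimes>\<^bsub>total W\<^esub>
        inv\<^bsub>total W\<^esub> incl W (b' i \<otimes>\<^bsub>A\<^esub> b i)"
      using sect'[OF i s] bW b'W sX b[OF i] b'[OF i]
      by (simp add: W.m_assoc W.inv_mult_group)
  qed
qed

text \<open>Extensions built from cochains live on pairs, whereas the classes consist of extensions
  with total group in another type. An injection on the carrier suffices to copy the group together
  with inclusion, projection and sections.\<close>

lemma rel_extension_transport:
  fixes j :: "'e \<Rightarrow> 'f" and A :: "('a, 'c) monoid_scheme"
  assumes A: "group A" and X: "X \<in> rel_extensions G I S A act" and j: "inj_on j (carrier (total X))"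
  obtains Y :: "('f, 'a, 'g, 'i) rel_ext"
  where "Y \<in> rel_extensions G I S A act" "rel_ext_equivalent I S A X Y"
proof -
  note X' = rel_extensionsD[OF X]
  interpret A: group A by fact
  interpret X: group "total X" by (rule X'(1))
  let ?C = "carrier (total X)"
  let ?k = "inv_into ?C j"
  define E where "E = \<lparr>carrier = j ` ?C,
    monoid.mult = (\<lambda>x y. j (?k x \<otimes>\<^bsub>total X\<^esub> ?k y)), one = j \<one>\<^bsub>total X\<^esub>\<rparr>"
  define Y :: "('f, 'a, 'g, 'i) rel_ext" where
    "Y = \<lparr>total = E, incl = j \<circ> incl X, proj = proj X \<circ> ?k, sect = (\<lambda>i. j \<circ> sect X i)\<rparr>"
  have Y_simps: "total Y = E" "incl Y = j \<circ> incl X" "proj Y = proj X \<circ> ?k" "sect Y i = j \<circ> sect X i" for i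
    by (simp_all add: Y_def)
  have kj: "?k (j x) = x" if "x \<in> ?C" for x using j that by (rule inv_into_f_f)
  have carrier_E: "carrier E = j ` ?C" by (simp add: E_def)
  have "j \<in> hom (total X) E" by (rule homI) (simp_all add: E_def kj)
  then have iso: "j \<in> iso (total X) E"
    using j by (simp add: iso_def bij_betw_def carrier_E)
  \<comment> \<open>The image of a group under an isomorphism comes with its unit reset to the image
    of the unit, which is no change here.\<close>
  have "E\<lparr>one := j \<one>\<^bsub>total X\<^esub>\<rparr> = E" by (simp add: E_def)
  then interpret E: group E using X.iso_imp_img_group[OF iso] by simp
  interpret j: group_hom "total X" E j using iso by unfold_locales (simp add: iso_def)
  have "?k \<in> iso E (total X)" using X.iso_set_sym[OF iso] .
  then have k: "?k \<in> hom E (total X)" "bij_betw ?k (carrier E) ?C" by (simp_all add: iso_def)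
  have "Y \<in> rel_extensions G I S A act"
    unfolding rel_extensions_def group_extension_def
  proof (intro CollectI conjI ballI)
    show "group (total Y)" by (simp add: Y_simps E.is_group)
    have "inj_on (j \<circ> incl X) (carrier A)"
      using X'(3) inj_on_subset[OF j hom_carrier[OF X'(2)]] by (rule comp_inj_on)
    then show "incl Y \<in> mon A (total Y)"
      using Group.hom_compose[OF X'(2) j.homh] by (simp add: Y_simps mon_def)
    have "(proj X \<circ> ?k) ` carrier E = carrier G"
      unfolding image_comp[symmetric] bij_betw_imp_surj_on[OF k(2)] by (rule X'(5))
    then show "proj Y \<in> epi (total Y) G"
      using Group.hom_compose[OF k(1) X'(4)] by (simp add: Y_simps epi_def)
    show "incl Y ` carrier A = kernel (total Y) G (proj Y)"
      unfolding Y_simps image_comp[symmetric] X'(6)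
    proof (intro equalityI subsetI)
      fix y assume "y \<in> j ` kernel (total X) G (proj X)"
      then obtain x where "x \<in> ?C" "proj X x = \<one>\<^bsub>G\<^esub>" "y = j x" by (auto simp: kernel_def)
      then show "y \<in> kernel E G (proj X \<circ> ?k)" using kj by (simp add: kernel_def carrier_E)
    next
      fix y assume "y \<in> kernel E G (proj X \<circ> ?k)"
      then obtain x where x: "x \<in> ?C" "y = j x" "proj X (?k y) = \<one>\<^bsub>G\<^esub>"
        by (auto simp: kernel_def carrier_E)
      then have "x \<in> kernel (total X) G (proj X)" using kj[OF x(1)] by (simp add: kernel_def)
      then show "y \<in> j ` kernel (total X) G (proj X)" using x(2) by blast
    qed
    fix e' a assume "e' \<in> carrier (total Y)" and a: "a \<in> carrier A"
    then obtain e where e: "e \<in> ?C" "e' = j e" by (auto simp: Y_simps carrier_E)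
    have "j (e \<otimes>\<^bsub>total X\<^esub> incl X a \<otimes>\<^bsub>total X\<^esub> inv\<^bsub>total X\<^esub> e) = e' \<otimes>\<^bsub>E\<^esub> j (incl X a) \<otimes>\<^bsub>E\<^esub> inv\<^bsub>E\<^esub> e'"
      using e X'(10)[OF a] by simp
    then show "e' \<otimes>\<^bsub>total Y\<^esub> incl Y a \<otimes>\<^bsub>total Y\<^esub> inv\<^bsub>total Y\<^esub> e' = incl Y (act (proj Y e') a)"
      using X'(7)[OF e(1) a] e kj by (simp add: Y_simps)
  next
    fix i assume i: "i \<in> I"
    show "sect Y i \<in> hom (G\<lparr>carrier := S i\<rparr>) (total Y)"
      using Group.hom_compose[OF X'(8)[OF i] j.homh] by (simp add: Y_simps)
    show "proj Y (sect Y i s) = s" if "s \<in> S i" for s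
      using X'(9)[OF i that] kj[OF X'(11)[OF i that]] by (simp add: Y_simps)
  qed
  moreover have "rel_ext_equivalent I S A X Y"
  proof (rule rel_ext_equivalentI[where f = j and b = "\<lambda>_. \<one>\<^bsub>A\<^esub>"])
    have one: "incl Y \<one>\<^bsub>A\<^esub> = \<one>\<^bsub>E\<^esub>"
      using hom_one[OF X'(2) A X.is_group] by (simp add: Y_simps)
    show "sect Y i s = incl Y \<one>\<^bsub>A\<^esub> \<otimes>\<^bsub>total Y\<^esub> j (sect X i s) \<otimes>\<^bsub>total Y\<^esub> inv\<^bsub>total Y\<^esub> incl Y \<one>\<^bsub>A\<^esub>"
      if "i \<in> I" "s \<in> S i" for i s
      unfolding one using X'(11)[OF that] by (simp add: Y_simps)
  qed (simp_all add: Y_simps iso kj)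
  ultimately show thesis by (rule that)
qed

section \<open>Cohomologous functions and equivalent extensions\<close>

context relative_module
begin

lemma split_ext_sel [simp]:
  "total (split_ext F Z) = factor_set.ext_group G A act Z"
  "incl (split_ext F Z) = factor_set.ext_incl G A Z"
  "proj (split_ext F Z) = snd"
  "i \<in> I \<Longrightarrow> sect (split_ext F Z) i s = (inv\<^bsub>A\<^esub> F s (i, S i), s)"
  by (simp_all add: split_ext_def)

lemma split_ext_equivalent_of_cohomologous:
  assumes "splits F Z" "splits F' Z'" "cohomologous F F'"
  shows "rel_ext_equivalent I S A (split_ext F Z) (split_ext F' Z')"
proof -
  note F = splits_closed[OF assms(1)] and F' = splits_closed[OF assms(2)]
  interpret Z: factor_set G A act Z by (rule splits_factor_set[OF assms(1)])
  interpret Z': factor_set G A act Z' by (rule splits_factor_set[OF assms(2)])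
  from assms(3) obtain T c where T: "\<And>k. k \<in> cosets \<Longrightarrow> T k \<in> carrier A"
    and c: "\<And>g. g \<in> carrier G \<Longrightarrow> c g \<in> carrier A"
    and eq: "\<And>g k. g \<in> carrier G \<Longrightarrow> k \<in> cosets \<Longrightarrow>
      quot A (F g k) (F' g k) = c g \<otimes>\<^bsub>A\<^esub> quot A (act g (T (translate (inv g) k))) (T k)"
    unfolding cohomologous_def by blast
  have F_eq: "F g k = quot A (F' g k \<otimes>\<^bsub>A\<^esub> c g \<otimes>\<^bsub>A\<^esub> act g (T (translate (inv g) k))) (T k)"
    if "g \<in> carrier G" "k \<in> cosets" for g k
    using eq[OF that] that F F' T c by (simp add: M.quot_simps M.m_ac)
  \<comment> \<open>Evaluated at a single coset. The T terms form the coboundary of a coboundary and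
    cancel, which leaves Z - Z' = dc.\<close>
  have Z_c: "Z g h \<otimes>\<^bsub>A\<^esub> c (g \<otimes> h) = Z' g h \<otimes>\<^bsub>A\<^esub> (c g \<otimes>\<^bsub>A\<^esub> act g (c h))"
    if g: "g \<in> carrier G" and h: "h \<in> carrier G" for g h
  proof -
    let ?k = base_coset
    note F_eq[OF g base_coset_in_cosets] F_eq[OF m_closed[OF g h] base_coset_in_cosets]
      F_eq[OF h translate_in_cosets[OF inv_closed[OF g] base_coset_in_cosets]]
    then show ?thesis
      unfolding splits_diff[OF assms(1) g h base_coset_in_cosets]
        splits_diff[OF assms(2) g h base_coset_in_cosets] diff_def
      using g h F' T c by (simp add: action_simps inv_mult_group M.m_ac)
  qed
  let ?f = "\<lambda>(a, g). (a \<otimes>\<^bsub>A\<^esub> c g, g)"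
  have iso: "?f \<in> iso Z.ext_group Z'.ext_group"
    by (rule factor_set_iso(1)[OF Z.factor_set_axioms Z'.factor_set_axioms]) (fact c, fact Z_c)
  have iso_incl: "?f (Z.ext_incl a) = Z'.ext_incl a" if "a \<in> carrier A" for a
    by (rule factor_set_iso(2)[OF Z.factor_set_axioms Z'.factor_set_axioms _ _ that])
      (fact c, fact Z_c)
  show ?thesis
  proof (rule rel_ext_equivalentI[where f = ?f and b = "\<lambda>i. inv\<^bsub>A\<^esub> T (i, S i)"])
    show "?f \<in> iso (total (split_ext F Z)) (total (split_ext F' Z'))"
      using iso by simp
    show "?f (incl (split_ext F Z) a) = incl (split_ext F' Z') a" if "a \<in> carrier A" for a
      using iso_incl[OF that] by simp
    show "proj (split_ext F' Z') (?f e) = proj (split_ext F Z) e" for e by (simp add: case_prod_beta)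
    fix i s assume i: "i \<in> I"
    show "inv\<^bsub>A\<^esub> T (i, S i) \<in> carrier A" using T i by simp
    assume s: "s \<in> S i"
    have sG: "s \<in> carrier G" using S_carrier[OF i s] .
    have "translate (inv s) (i, S i) = (i, S i)"
      using translate_base_eq[OF i subgroup.m_inv_closed[OF subgrp[OF i] s]] .
    then have Fs: "F s (i, S i) = quot A (F' s (i, S i) \<otimes>\<^bsub>A\<^esub> c s \<otimes>\<^bsub>A\<^esub> act s (T (i, S i))) (T (i, S i))"
      using F_eq[OF sG base_in_cosets[OF i]] by simp
    have cl: "T (i, S i) \<in> carrier A" "F' s (i, S i) \<in> carrier A" "c s \<in> carrier A"
      using T F' c sG i by simp_all
    \<comment> \<open>Solved for - F' s, the equation gives - T + (- F s + c s) - s (- T), the first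
      component of a conjugation by - T.\<close>
    have "(inv\<^bsub>A\<^esub> F' s (i, S i), s) = (quot A (inv\<^bsub>A\<^esub> T (i, S i) \<otimes>\<^bsub>A\<^esub> (inv\<^bsub>A\<^esub> F s (i, S i) \<otimes>\<^bsub>A\<^esub> c s))
        (act s (inv\<^bsub>A\<^esub> T (i, S i))), s)"
      unfolding Fs using cl sG by (simp add: action_simps M.m_ac)
    also have "\<dots> = Z'.ext_incl (inv\<^bsub>A\<^esub> T (i, S i)) \<otimes>\<^bsub>Z'.ext_group\<^esub>
        (inv\<^bsub>A\<^esub> F s (i, S i) \<otimes>\<^bsub>A\<^esub> c s, s) \<otimes>\<^bsub>Z'.ext_group\<^esub>
        inv\<^bsub>Z'.ext_group\<^esub> Z'.ext_incl (inv\<^bsub>A\<^esub> T (i, S i))"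
      using cl sG F[OF sG base_in_cosets[OF i]] by (intro Z'.ext_incl_conj[symmetric]) simp_all
    finally show "sect (split_ext F' Z') i s = incl (split_ext F' Z') (inv\<^bsub>A\<^esub> T (i, S i))
        \<otimes>\<^bsub>total (split_ext F' Z')\<^esub> ?f (sect (split_ext F Z) i s)
        \<otimes>\<^bsub>total (split_ext F' Z')\<^esub> inv\<^bsub>total (split_ext F' Z')\<^esub> incl (split_ext F' Z') (inv\<^bsub>A\<^esub> T (i, S i))"
      using i by simp
  qed
qed

text \<open>
  A form of Shapiro's lemma: the functions from the cosets to \<open>A\<close> form the product of the modules
  coinduced from the \<open>S\<^sub>i\<close>.
\<close>

lemma coinduced_cocycle_trivial:
  assumes D: "\<And>g k. g \<in> carrier G \<Longrightarrow> k \<in> cosets \<Longrightarrow> D g k \<in> carrier A"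
    and coc: "\<And>g h k. \<lbrakk>g \<in> carrier G; h \<in> carrier G; k \<in> cosets\<rbrakk> \<Longrightarrow>
      D (g \<otimes> h) k = act g (D h (translate (inv g) k)) \<otimes>\<^bsub>A\<^esub> D g k"
    and b: "\<And>i. i \<in> I \<Longrightarrow> b i \<in> carrier A"
    and base: "\<And>i s. i \<in> I \<Longrightarrow> s \<in> S i \<Longrightarrow> D s (i, S i) = quot A (b i) (act s (b i))"
  obtains T where "\<And>k. k \<in> cosets \<Longrightarrow> T k \<in> carrier A"
    and "\<And>g k. g \<in> carrier G \<Longrightarrow> k \<in> cosets \<Longrightarrow>
      D g k = quot A (act g (T (translate (inv g) k))) (T k)"
proof -
  have ex: "\<exists>r\<in>carrier G. k = translate r (fst k, S (fst k))" if "k \<in> cosets" for k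
    using that by (rule cosetsE) (auto simp: translate_def)
  then obtain r where r: "\<And>k. k \<in> cosets \<Longrightarrow> r k \<in> carrier G"
    "\<And>k. k \<in> cosets \<Longrightarrow> k = translate (r k) (fst k, S (fst k))" by metis
  have fst_in: "fst k \<in> I" if "k \<in> cosets" for k
    using that by (auto simp: coset_basis_def)
  \<comment> \<open>The wanted equation with g = \<open>r k\<close>, together with the value - b at
    the coset \<open>S i\<close>, leaves no other choice for T at k.\<close>
  define T where "T k = inv\<^bsub>A\<^esub> (act (r k) (b (fst k)) \<otimes>\<^bsub>A\<^esub> D (r k) k)" for k
  \<comment> \<open>Independence of the representative: another one differs by some s in
    \<open>S i\<close>, and the cocycle rule with the assumption on D s shows that both give the
    same element.\<close>
  have T_any: "T k = inv\<^bsub>A\<^esub> (act h (b i) \<otimes>\<^bsub>A\<^esub> D h k)"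
    if h: "h \<in> carrier G" and i: "i \<in> I" and k: "k = translate h (i, S i)" for h i k
  proof -
    have k_in: "k \<in> cosets" using translate_base_in_cosets[OF i h] k by simp
    have fst_k: "fst k = i" using k by (simp add: translate_def)
    note rk = r(1)[OF k_in]
    have r_k: "translate (r k) (i, S i) = k" using r(2)[OF k_in] fst_k by simp
    define s where "s = inv (r k) \<otimes> h"
    have s: "s \<in> S i" unfolding s_def using translate_base_eqD[OF i rk h] r_k k by simp
    have h_eq: "h = r k \<otimes> s" using rk h by (simp add: s_def m_assoc[symmetric])
    have sG: "s \<in> carrier G" using S_carrier[OF i s] .
    have "translate (inv (r k)) k = (i, S i)"
      using translate_translate[OF inv_closed[OF rk] rk base_in_cosets[OF i]] r_k rk i by simp
    then have "D h k = act (r k) (quot A (b i) (act s (b i))) \<otimes>\<^bsub>A\<^esub> D (r k) k"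
      unfolding h_eq using coc[OF rk sG k_in] base[OF i s] by simp
    then have "act h (b i) \<otimes>\<^bsub>A\<^esub> D h k = act (r k) (b i) \<otimes>\<^bsub>A\<^esub> D (r k) k"
      using rk sG b[OF i] D[OF rk k_in] by (simp add: h_eq action_simps M.m_ac)
    then show ?thesis by (simp add: T_def fst_k)
  qed
  show thesis
  proof (rule that)
    show "T k \<in> carrier A" if "k \<in> cosets" for k
      using r(1)[OF that] D[OF _ that] b[OF fst_in[OF that]] by (simp add: T_def)
    show "D g k = quot A (act g (T (translate (inv g) k))) (T k)"
      if g: "g \<in> carrier G" and k: "k \<in> cosets" for g k
    proof -
      define i h where "i = fst k" and "h = r k"
      have i: "i \<in> I" and h: "h \<in> carrier G" and k_eq: "k = translate h (i, S i)"
        using fst_in[OF k] r[OF k] by (simp_all add: i_def h_def)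
      have gh: "inv g \<otimes> h \<in> carrier G" using g h by simp
      have gk: "translate (inv g) k \<in> cosets" using g k by simp
      \<comment> \<open>As h represents k, this product represents the translated coset, so one
        formula gives both values of T and the b terms cancel.\<close>
      have "translate (inv g) k = translate (inv g \<otimes> h) (i, S i)"
        using g h i by (simp add: k_eq)
      note T_gk = T_any[OF gh i this] and T_k = T_any[OF h i k_eq]
      have g_gh: "g \<otimes> (inv g \<otimes> h) = h" using g h by (simp add: m_assoc[symmetric])
      have D_h: "D h k = act g (D (inv g \<otimes> h) (translate (inv g) k)) \<otimes>\<^bsub>A\<^esub> D g k"
        using coc[OF g gh k] g_gh by simp
      show ?thesis
        unfolding T_gk T_k D_h using g h gh k gk D b[OF i] by (simp add: action_simps g_gh M.m_ac)
    qed
  qed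
qed

lemma cohomologous_of_split_ext_equivalent:
  assumes "splits F Z" "splits F' Z'"
    and "rel_ext_equivalent I S A (split_ext F Z) (split_ext F' Z')"
  shows "cohomologous F F'"
proof -
  note F = splits_closed[OF assms(1)] and F' = splits_closed[OF assms(2)]
  interpret Z: factor_set G A act Z by (rule splits_factor_set[OF assms(1)])
  interpret Z': factor_set G A act Z' by (rule splits_factor_set[OF assms(2)])
  obtain f b where f: "f \<in> iso Z.ext_group Z'.ext_group"
    and f_incl: "\<And>a. a \<in> carrier A \<Longrightarrow> f (Z.ext_incl a) = Z'.ext_incl a"
    and f_snd: "\<And>e. e \<in> carrier Z.ext_group \<Longrightarrow> snd (f e) = snd e"
    and b: "\<And>i. i \<in> I \<Longrightarrow> b i \<in> carrier A"
    and sect: "\<And>i s. i \<in> I \<Longrightarrow> s \<in> S i \<Longrightarrow> sect (split_ext F' Z') i s =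
      Z'.ext_incl (b i) \<otimes>\<^bsub>Z'.ext_group\<^esub> f (sect (split_ext F Z) i s) \<otimes>\<^bsub>Z'.ext_group\<^esub>
        inv\<^bsub>Z'.ext_group\<^esub> (Z'.ext_incl (b i))"
    by (rule rel_ext_equivalentE[OF assms(3), unfolded split_ext_sel(1-3)]) blast
  have f_hom: "f \<in> hom Z.ext_group Z'.ext_group" using f by (simp add: iso_def)
  \<comment> \<open>An equivalence is the identity on A and on G, so it is determined by the first
    components of the images of the pairs (0, g).\<close>
  define c where "c g = fst (f (\<one>\<^bsub>A\<^esub>, g))" for g
  have f_one: "f (\<one>\<^bsub>A\<^esub>, g) = (c g, g)" and c: "c g \<in> carrier A" if "g \<in> carrier G" for g
  proof -
    have "(\<one>\<^bsub>A\<^esub>, g) \<in> carrier Z.ext_group" using that by simp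
    from hom_in_carrier[OF f_hom this] f_snd[OF this] show "f (\<one>\<^bsub>A\<^esub>, g) = (c g, g)" "c g \<in> carrier A"
      by (auto simp: c_def prod_eq_iff)
  qed
  have f_eq: "f (a, g) = (a \<otimes>\<^bsub>A\<^esub> c g, g)" if a: "a \<in> carrier A" and g: "g \<in> carrier G" for a g
  proof -
    have "(a, g) = Z.ext_incl a \<otimes>\<^bsub>Z.ext_group\<^esub> (\<one>\<^bsub>A\<^esub>, g)"
      using a g by (simp add: Z.ext_incl_mult)
    then have "f (a, g) = Z'.ext_incl a \<otimes>\<^bsub>Z'.ext_group\<^esub> (c g, g)"
      using hom_mult[OF f_hom Z.ext_incl_closed[OF a], of "(\<one>\<^bsub>A\<^esub>, g)"] a g f_incl f_one by simp
    then show ?thesis using a g c by (simp add: Z'.ext_incl_mult)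
  qed
  have Z_c: "Z g h \<otimes>\<^bsub>A\<^esub> c (g \<otimes> h) = c g \<otimes>\<^bsub>A\<^esub> act g (c h) \<otimes>\<^bsub>A\<^esub> Z' g h"
    if g: "g \<in> carrier G" and h: "h \<in> carrier G" for g h
    using hom_mult[OF f_hom, of "(\<one>\<^bsub>A\<^esub>, g)" "(\<one>\<^bsub>A\<^esub>, h)"] g h c by (simp add: f_eq)
  \<comment> \<open>The part of F - F' that T has to account for. It is a cocycle because Z - Z' =
    dc, and the conjugations of the sections give its values at the cosets
    \<open>S i\<close>.\<close>
  define D where "D g k = quot A (F g k) (F' g k \<otimes>\<^bsub>A\<^esub> c g)" for g k
  have D_coc: "D (g \<otimes> h) k = act g (D h (translate (inv g) k)) \<otimes>\<^bsub>A\<^esub> D g k"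
    if g: "g \<in> carrier G" and h: "h \<in> carrier G" and k: "k \<in> cosets" for g h k
  proof -
    let ?k' = "translate (inv g) k"
    have k': "?k' \<in> cosets" using g k by simp
    have cl: "F (g \<otimes> h) k \<in> carrier A" "F' (g \<otimes> h) k \<in> carrier A" "F g k \<in> carrier A"
      "F' g k \<in> carrier A" "F h ?k' \<in> carrier A" "F' h ?k' \<in> carrier A"
      "c g \<in> carrier A" "c h \<in> carrier A" "c (g \<otimes> h) \<in> carrier A"
      using g h k k' F F' c by simp_all
    have "act g (F h ?k') \<otimes>\<^bsub>A\<^esub> F g k \<otimes>\<^bsub>A\<^esub> c (g \<otimes> h) \<otimes>\<^bsub>A\<^esub> F' (g \<otimes> h) k =
        c g \<otimes>\<^bsub>A\<^esub> act g (c h) \<otimes>\<^bsub>A\<^esub> (act g (F' h ?k') \<otimes>\<^bsub>A\<^esub> F' g k) \<otimes>\<^bsub>A\<^esub> F (g \<otimes> h) k"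
      using Z_c[OF g h] cl g
      unfolding splits_diff[OF assms(1) g h k] splits_diff[OF assms(2) g h k] diff_def
      by (simp add: M.quot_simps M.m_ac)
    then show ?thesis using cl g by (simp add: D_def action_simps M.m_ac)
  qed
  have D_in: "D g k \<in> carrier A" if "g \<in> carrier G" "k \<in> cosets" for g k
    using that F F' c by (simp add: D_def)
  have D_base: "D s (i, S i) = quot A (b i) (act s (b i))" if i: "i \<in> I" and s: "s \<in> S i" for i s
  proof -
    have sG: "s \<in> carrier G" using S_carrier[OF i s] .
    have cl: "F s (i, S i) \<in> carrier A" "F' s (i, S i) \<in> carrier A" "c s \<in> carrier A" "b i \<in> carrier A"
      using sG i F F' c b by simp_all
    have "inv\<^bsub>A\<^esub> F' s (i, S i) = quot A (b i \<otimes>\<^bsub>A\<^esub> (inv\<^bsub>A\<^esub> F s (i, S i) \<otimes>\<^bsub>A\<^esub> c s)) (act s (b i))"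
      using sect[OF i s] i cl sG Z'.ext_incl_conj[of "b i" "inv\<^bsub>A\<^esub> F s (i, S i) \<otimes>\<^bsub>A\<^esub> c s" s]
      by (simp add: f_eq)
    then show ?thesis using cl sG by (simp add: D_def M.quot_simps M.m_ac)
  qed
  obtain T where T: "\<And>k. k \<in> cosets \<Longrightarrow> T k \<in> carrier A"
    and D_T: "\<And>g k. g \<in> carrier G \<Longrightarrow> k \<in> cosets \<Longrightarrow>
      D g k = quot A (act g (T (translate (inv g) k))) (T k)"
  proof (rule coinduced_cocycle_trivial[of D b])
    show "D g k \<in> carrier A" if "g \<in> carrier G" "k \<in> cosets" for g k by (rule D_in[OF that])
    show "D (g \<otimes> h) k = act g (D h (translate (inv g) k)) \<otimes>\<^bsub>A\<^esub> D g k"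
      if "g \<in> carrier G" "h \<in> carrier G" "k \<in> cosets" for g h k by (rule D_coc[OF that])
    show "b i \<in> carrier A" if "i \<in> I" for i by (rule b[OF that])
    show "D s (i, S i) = quot A (b i) (act s (b i))" if "i \<in> I" "s \<in> S i" for i s
      by (rule D_base[OF that])
  qed (rule that)
  have "quot A (F g k) (F' g k) = c g \<otimes>\<^bsub>A\<^esub> quot A (act g (T (translate (inv g) k))) (T k)"
    if "g \<in> carrier G" "k \<in> cosets" for g k
    unfolding D_T[OF that, symmetric] D_def using that F F' c by (simp add: M.quot_simps M.m_ac)
  then show ?thesis unfolding cohomologous_def using T c by blast
qed


text \<open>
  The total group \<open>E\<close> acts on the union of the sets \<open>E/q\<^sub>i(S\<^sub>i)\<close>, which lies over the union of
  the \<open>G/S\<^sub>i\<close> with fibres that are torsors of \<open>A\<close>. The chosen \<open>l k\<close> represent a section of this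
  map, and \<open>F g k\<close> measures by how much the section fails to be compatible with the action of
  the lift \<open>\<sigma> g\<close> of \<open>g\<close>.
\<close>

lemma rel_extension_splits:
  assumes Y: "Y \<in> rel_extensions G I S A act"
  obtains F Z where "splits F Z" "rel_ext_equivalent I S A (split_ext F Z) Y"
proof -
  note Y' = rel_extensionsD[OF Y]
  define E \<iota> p q where "E = total Y" and "\<iota> = incl Y" and "p = proj Y" and "q = sect Y"
  note Y'' = Y'[folded E_def \<iota>_def p_def q_def]
  interpret E: group E by (rule Y''(1))
  interpret \<iota>: group_hom A E \<iota> by unfold_locales (rule Y''(2))
  interpret p: group_hom E G p by unfold_locales (rule Y''(4))
  have q_in: "q i s \<in> carrier E" and p_q: "p (q i s) = s" if "i \<in> I" "s \<in> S i" for i s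
    using that by (simp_all add: Y''(9,11))
  have q_mult: "q i (s \<otimes> t) = q i s \<otimes>\<^bsub>E\<^esub> q i t" if "i \<in> I" "s \<in> S i" "t \<in> S i" for i s t
    using hom_mult[OF Y''(8)[OF that(1)], of s t] that by simp
  have p_\<iota> [simp]: "p (\<iota> a) = \<one>" if "a \<in> carrier A" for a
    using Y''(6) that by (auto simp: kernel_def)
  have kernel: "\<exists>a\<in>carrier A. x = \<iota> a" if "x \<in> carrier E" "p x = \<one>" for x
  proof -
    have "x \<in> kernel E G p" using that by (simp add: kernel_def)
    then show ?thesis unfolding Y''(6)[symmetric] by blast
  qed
  have \<iota>_inj: "a = b" if "\<iota> a = \<iota> b" "a \<in> carrier A" "b \<in> carrier A" for a b
    using Y''(3) that by (auto dest: inj_onD)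
  have conj: "e \<otimes>\<^bsub>E\<^esub> \<iota> a = \<iota> (act (p e) a) \<otimes>\<^bsub>E\<^esub> e" if e: "e \<in> carrier E" and a: "a \<in> carrier A" for e a
  proof -
    have 1: "\<iota> (act (p e) a) \<in> carrier E" using e a by simp
    have 2: "e \<otimes>\<^bsub>E\<^esub> \<iota> a \<in> carrier E" using e a by simp
    show ?thesis using Y''(7)[OF e a] E.inv_solve_right'[OF 1 2 e] by blast
  qed
  have diff_in_A: "\<exists>a\<in>carrier A. x = \<iota> a \<otimes>\<^bsub>E\<^esub> y"
    if x: "x \<in> carrier E" and y: "y \<in> carrier E" and eq: "p x = p y" for x y
  proof -
    have "p (x \<otimes>\<^bsub>E\<^esub> inv\<^bsub>E\<^esub> y) = \<one>" using x y eq by simp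
    then obtain a where a: "a \<in> carrier A" "x \<otimes>\<^bsub>E\<^esub> inv\<^bsub>E\<^esub> y = \<iota> a"
      using kernel[of "x \<otimes>\<^bsub>E\<^esub> inv\<^bsub>E\<^esub> y"] x y by auto
    then have "x = \<iota> a \<otimes>\<^bsub>E\<^esub> y"
      using E.inv_solve_right'[OF \<iota>.hom_closed[OF a(1)] x y] by blast
    then show ?thesis using a(1) by blast
  qed
  \<comment> \<open>A set-theoretic lift of G, which need not send the unit to the unit.\<close>
  have "\<forall>g\<in>carrier G. \<exists>e. e \<in> carrier E \<and> p e = g"
    unfolding Y''(5)[symmetric] by blast
  from bchoice[OF this] obtain \<sigma> where \<sigma>: "\<And>g. g \<in> carrier G \<Longrightarrow> \<sigma> g \<in> carrier E"
    and p_\<sigma> [simp]: "\<And>g. g \<in> carrier G \<Longrightarrow> p (\<sigma> g) = g" by blast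
  \<comment> \<open>Lifts of coset representatives. Taking the unit at the cosets \<open>S i\<close>
    themselves lets F s there be read off from \<sigma> s and \<open>q i s\<close> alone, so that
    the sections will match without conjugation.\<close>
  have "\<forall>k\<in>cosets. \<exists>e. e \<in> carrier E \<and> translate (p e) (fst k, S (fst k)) = k \<and>
    (k = (fst k, S (fst k)) \<longrightarrow> e = \<one>\<^bsub>E\<^esub>)"
  proof
    fix k assume k: "k \<in> cosets"
    show "\<exists>e. e \<in> carrier E \<and> translate (p e) (fst k, S (fst k)) = k \<and>
      (k = (fst k, S (fst k)) \<longrightarrow> e = \<one>\<^bsub>E\<^esub>)"
    proof (cases "k = (fst k, S (fst k))")
      case True
      then show ?thesis using translate_one[OF k] by (intro exI[of _ "\<one>\<^bsub>E\<^esub>"]) simp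
    next
      case False
      obtain i g where "i \<in> I" and g: "g \<in> carrier G" "k = translate g (i, S i)"
        using k by (rule cosetsE)
      then have "fst k = i" by (simp add: translate_def)
      then show ?thesis using False g \<sigma>[OF g(1)] by (intro exI[of _ "\<sigma> g"]) simp
    qed
  qed
  from bchoice[OF this] obtain l where l: "\<And>k. k \<in> cosets \<Longrightarrow> l k \<in> carrier E"
    and l_k: "\<And>k. k \<in> cosets \<Longrightarrow> translate (p (l k)) (fst k, S (fst k)) = k"
    and l_base: "\<And>k. k \<in> cosets \<Longrightarrow> k = (fst k, S (fst k)) \<Longrightarrow> l k = \<one>\<^bsub>E\<^esub>" by blast
  have fst_in: "fst k \<in> I" if "k \<in> cosets" for k
    using that by (auto simp: coset_basis_def)
  have fst_translate: "fst (translate g k) = fst k" for g k by (simp add: translate_def)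
  \<comment> \<open>The second component of y is the element of \<open>S (fst k)\<close> that makes
    the projections to G agree; the first is the remaining element of A and becomes F g k.\<close>
  have "\<forall>x\<in>carrier G \<times> cosets. \<exists>y. fst y \<in> carrier A \<and> snd y \<in> S (fst (snd x)) \<and>
    \<sigma> (fst x) \<otimes>\<^bsub>E\<^esub> l (translate (inv (fst x)) (snd x)) \<otimes>\<^bsub>E\<^esub> q (fst (snd x)) (snd y) =
      \<iota> (fst y) \<otimes>\<^bsub>E\<^esub> l (snd x)"
  proof
    fix x assume "x \<in> carrier G \<times> cosets"
    then obtain g k where x: "x = (g, k)" and g: "g \<in> carrier G" and k: "k \<in> cosets" by auto
    define i k' where "i = fst k" and "k' = translate (inv g) k"
    have k': "k' \<in> cosets" and i: "i \<in> I" using g k fst_in by (simp_all add: k'_def i_def)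
    have lk: "p (l k) \<in> carrier G" "p (l k') \<in> carrier G" using l k k' by simp_all
    have "translate (g \<otimes> p (l k')) (i, S i) = translate g k'"
      using l_k[OF k'] translate_translate[OF g lk(2) base_in_cosets[OF i]]
      by (simp add: k'_def fst_translate i_def)
    also have "\<dots> = translate (p (l k)) (i, S i)"
      using g k l_k[OF k] by (simp add: k'_def i_def)
    finally have s: "inv (g \<otimes> p (l k')) \<otimes> p (l k) \<in> S i" (is "?s \<in> _")
      using translate_base_eqD[OF i m_closed[OF g lk(2)] lk(1)] by blast
    have "p (\<sigma> g \<otimes>\<^bsub>E\<^esub> l k' \<otimes>\<^bsub>E\<^esub> q i ?s) = p (l k)"
      using g lk l[OF k'] \<sigma>[OF g] q_in[OF i s] p_q[OF i s] by (simp add: m_assoc[symmetric] r_inv)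
    then obtain a where "a \<in> carrier A" "\<sigma> g \<otimes>\<^bsub>E\<^esub> l k' \<otimes>\<^bsub>E\<^esub> q i ?s = \<iota> a \<otimes>\<^bsub>E\<^esub> l k"
      using diff_in_A[of "\<sigma> g \<otimes>\<^bsub>E\<^esub> l k' \<otimes>\<^bsub>E\<^esub> q i ?s" "l k"] g l[OF k'] l[OF k] \<sigma>[OF g] q_in[OF i s]
      by auto
    then show "\<exists>y. fst y \<in> carrier A \<and> snd y \<in> S (fst (snd x)) \<and>
      \<sigma> (fst x) \<otimes>\<^bsub>E\<^esub> l (translate (inv (fst x)) (snd x)) \<otimes>\<^bsub>E\<^esub> q (fst (snd x)) (snd y) =
        \<iota> (fst y) \<otimes>\<^bsub>E\<^esub> l (snd x)"
      using s by (intro exI[of _ "(a, ?s)"]) (simp add: x i_def[symmetric] k'_def[symmetric])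
  qed
  from bchoice[OF this] obtain y where y: "\<And>g k. g \<in> carrier G \<Longrightarrow> k \<in> cosets \<Longrightarrow>
      fst (y (g, k)) \<in> carrier A \<and> snd (y (g, k)) \<in> S (fst k) \<and>
      \<sigma> g \<otimes>\<^bsub>E\<^esub> l (translate (inv g) k) \<otimes>\<^bsub>E\<^esub> q (fst k) (snd (y (g, k))) = \<iota> (fst (y (g, k))) \<otimes>\<^bsub>E\<^esub> l k"
    by auto
  define F t where "F g k = fst (y (g, k))" and "t g k = snd (y (g, k))" for g k
  have F: "F g k \<in> carrier A" and t: "t g k \<in> S (fst k)"
    and F_eq: "\<sigma> g \<otimes>\<^bsub>E\<^esub> l (translate (inv g) k) \<otimes>\<^bsub>E\<^esub> q (fst k) (t g k) = \<iota> (F g k) \<otimes>\<^bsub>E\<^esub> l k"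
    if "g \<in> carrier G" "k \<in> cosets" for g k
    using y[OF that] by (simp_all add: F_def t_def)
  have "\<forall>x\<in>carrier G \<times> carrier G. \<exists>a. a \<in> carrier A \<and>
      \<sigma> (fst x) \<otimes>\<^bsub>E\<^esub> \<sigma> (snd x) = \<iota> a \<otimes>\<^bsub>E\<^esub> \<sigma> (fst x \<otimes> snd x)"
  proof
    fix x assume x: "x \<in> carrier G \<times> carrier G"
    have "\<exists>a\<in>carrier A. \<sigma> (fst x) \<otimes>\<^bsub>E\<^esub> \<sigma> (snd x) = \<iota> a \<otimes>\<^bsub>E\<^esub> \<sigma> (fst x \<otimes> snd x)"
      by (rule diff_in_A) (use x \<sigma> in auto)
    then show "\<exists>a. a \<in> carrier A \<and> \<sigma> (fst x) \<otimes>\<^bsub>E\<^esub> \<sigma> (snd x) = \<iota> a \<otimes>\<^bsub>E\<^esub> \<sigma> (fst x \<otimes> snd x)" by blast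
  qed
  from bchoice[OF this] obtain z where z: "\<And>g h. g \<in> carrier G \<Longrightarrow> h \<in> carrier G \<Longrightarrow>
      z (g, h) \<in> carrier A \<and> \<sigma> g \<otimes>\<^bsub>E\<^esub> \<sigma> h = \<iota> (z (g, h)) \<otimes>\<^bsub>E\<^esub> \<sigma> (g \<otimes> h)" by auto
  define Z where "Z g h = z (g, h)" for g h
  have Z: "Z g h \<in> carrier A" and Z_eq: "\<sigma> g \<otimes>\<^bsub>E\<^esub> \<sigma> h = \<iota> (Z g h) \<otimes>\<^bsub>E\<^esub> \<sigma> (g \<otimes> h)"
    if "g \<in> carrier G" "h \<in> carrier G" for g h
    using z[OF that] by (simp_all add: Z_def)
  have splits: "splits F Z"
    unfolding splits_def
  proof (intro conjI ballI)
    show "F g k \<in> carrier A" if "g \<in> carrier G" "k \<in> cosets" for g k by (rule F[OF that])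
    fix g h k assume g: "g \<in> carrier G" and h: "h \<in> carrier G" and k: "k \<in> cosets"
    define i k' k'' where "i = fst k" and "k' = translate (inv g) k" and "k'' = translate (inv (g \<otimes> h)) k"
    have k': "k' \<in> cosets" and k'': "k'' \<in> cosets" and i: "i \<in> I"
      using g h k fst_in by (simp_all add: k'_def k''_def i_def)
    have k''_eq: "translate (inv h) k' = k''" and fst_k': "fst k' = i"
      using g h k by (simp_all add: k'_def k''_def i_def inv_mult_group fst_translate)
    have gh: "g \<otimes> h \<in> carrier G" using g h by simp
    define s1 s2 s3 where "s1 = t g k" and "s2 = t h k'" and "s3 = t (g \<otimes> h) k"
    have s: "s1 \<in> S i" "s2 \<in> S i" "s3 \<in> S i"
      using t[OF g k] t[OF h k'] t[OF gh k] fst_k' by (simp_all add: s1_def s2_def s3_def i_def)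
    note sG = S_carrier[OF i s(1)] S_carrier[OF i s(2)] S_carrier[OF i s(3)]
    note qE = q_in[OF i s(1)] q_in[OF i s(2)] q_in[OF i s(3)]
    have lE: "l k \<in> carrier E" "l k' \<in> carrier E" "l k'' \<in> carrier E" using l k k' k'' by blast+
    have \<sigma>E: "\<sigma> g \<in> carrier E" "\<sigma> h \<in> carrier E" "\<sigma> (g \<otimes> h) \<in> carrier E" using \<sigma> g h gh by blast+
    have FA: "F g k \<in> carrier A" "F h k' \<in> carrier A" "F (g \<otimes> h) k \<in> carrier A" and ZA: "Z g h \<in> carrier A"
      using F Z g h gh k k' by blast+
    have eq1: "\<sigma> g \<otimes>\<^bsub>E\<^esub> l k' \<otimes>\<^bsub>E\<^esub> q i s1 = \<iota> (F g k) \<otimes>\<^bsub>E\<^esub> l k"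
      using F_eq[OF g k] by (simp add: k'_def i_def s1_def)
    have eq2: "\<sigma> h \<otimes>\<^bsub>E\<^esub> l k'' \<otimes>\<^bsub>E\<^esub> q i s2 = \<iota> (F h k') \<otimes>\<^bsub>E\<^esub> l k'"
      using F_eq[OF h k'] by (simp add: k''_eq fst_k' s2_def)
    have eq3: "\<sigma> (g \<otimes> h) \<otimes>\<^bsub>E\<^esub> l k'' \<otimes>\<^bsub>E\<^esub> q i s3 = \<iota> (F (g \<otimes> h) k) \<otimes>\<^bsub>E\<^esub> l k"
      using F_eq[OF gh k] by (simp add: k''_def i_def s3_def)
    \<comment> \<open>One product is computed in two ways: from the inside through F h and F g, and
      after regrouping through Z g h.\<close>
    have "\<sigma> g \<otimes>\<^bsub>E\<^esub> (\<sigma> h \<otimes>\<^bsub>E\<^esub> l k'' \<otimes>\<^bsub>E\<^esub> q i s2) \<otimes>\<^bsub>E\<^esub> q i s1 =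
        (\<sigma> g \<otimes>\<^bsub>E\<^esub> \<iota> (F h k')) \<otimes>\<^bsub>E\<^esub> l k' \<otimes>\<^bsub>E\<^esub> q i s1"
      unfolding eq2 using \<sigma>E lE qE FA by (simp add: E.m_assoc)
    also have "\<dots> = \<iota> (act g (F h k')) \<otimes>\<^bsub>E\<^esub> (\<sigma> g \<otimes>\<^bsub>E\<^esub> l k' \<otimes>\<^bsub>E\<^esub> q i s1)"
      unfolding conj[OF \<sigma>E(1) FA(2)] using \<sigma>E lE qE FA g by (simp add: E.m_assoc)
    also have "\<dots> = \<iota> (act g (F h k') \<otimes>\<^bsub>A\<^esub> F g k) \<otimes>\<^bsub>E\<^esub> l k"
      unfolding eq1 using lE FA g by (simp add: E.m_assoc)
    finally have 1: "\<sigma> g \<otimes>\<^bsub>E\<^esub> (\<sigma> h \<otimes>\<^bsub>E\<^esub> l k'' \<otimes>\<^bsub>E\<^esub> q i s2) \<otimes>\<^bsub>E\<^esub> q i s1 =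
        \<iota> (act g (F h k') \<otimes>\<^bsub>A\<^esub> F g k) \<otimes>\<^bsub>E\<^esub> l k" .
    have "\<sigma> g \<otimes>\<^bsub>E\<^esub> (\<sigma> h \<otimes>\<^bsub>E\<^esub> l k'' \<otimes>\<^bsub>E\<^esub> q i s2) \<otimes>\<^bsub>E\<^esub> q i s1 =
        (\<sigma> g \<otimes>\<^bsub>E\<^esub> \<sigma> h) \<otimes>\<^bsub>E\<^esub> l k'' \<otimes>\<^bsub>E\<^esub> (q i s2 \<otimes>\<^bsub>E\<^esub> q i s1)"
      using \<sigma>E lE qE by (simp add: E.m_assoc)
    also have "\<dots> = \<iota> (Z g h) \<otimes>\<^bsub>E\<^esub> (\<sigma> (g \<otimes> h) \<otimes>\<^bsub>E\<^esub> l k'' \<otimes>\<^bsub>E\<^esub> q i (s2 \<otimes> s1))"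
      unfolding Z_eq[OF g h] q_mult[OF i s(2,1), symmetric]
      using \<sigma>E lE ZA q_in[OF i subgroup.m_closed[OF subgrp[OF i] s(2,1)]] by (simp add: E.m_assoc)
    finally have 2: "\<iota> (Z g h) \<otimes>\<^bsub>E\<^esub> (\<sigma> (g \<otimes> h) \<otimes>\<^bsub>E\<^esub> l k'' \<otimes>\<^bsub>E\<^esub> q i (s2 \<otimes> s1)) =
        \<iota> (act g (F h k') \<otimes>\<^bsub>A\<^esub> F g k) \<otimes>\<^bsub>E\<^esub> l k" using 1 by simp
    have s21: "s2 \<otimes> s1 \<in> S i" using subgroup.m_closed[OF subgrp[OF i] s(2,1)] .
    \<comment> \<open>The elements s1, s2, s3 come from separate choices. Projecting to G shows s2
      s1 = s3, so that F (gh) can be inserted.\<close>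
    have "p (\<iota> (Z g h) \<otimes>\<^bsub>E\<^esub> (\<sigma> (g \<otimes> h) \<otimes>\<^bsub>E\<^esub> l k'' \<otimes>\<^bsub>E\<^esub> q i (s2 \<otimes> s1))) = p (l k)"
      unfolding 2 using lE FA g by simp
    moreover have "p (\<sigma> (g \<otimes> h) \<otimes>\<^bsub>E\<^esub> l k'' \<otimes>\<^bsub>E\<^esub> q i s3) = p (l k)"
      unfolding eq3 using lE FA g by simp
    ultimately have "g \<otimes> h \<otimes> p (l k'') \<otimes> (s2 \<otimes> s1) = g \<otimes> h \<otimes> p (l k'') \<otimes> s3"
      using ZA \<sigma>E lE sG q_in[OF i s21] qE p_q[OF i s21] p_q[OF i s(3)] gh p_\<sigma>[OF gh] by simp
    then have "s2 \<otimes> s1 = s3" using g h lE sG by (simp add: m_assoc)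
    then have "\<iota> (Z g h \<otimes>\<^bsub>A\<^esub> F (g \<otimes> h) k) \<otimes>\<^bsub>E\<^esub> l k = \<iota> (act g (F h k') \<otimes>\<^bsub>A\<^esub> F g k) \<otimes>\<^bsub>E\<^esub> l k"
      using 2 lE FA ZA unfolding eq3[symmetric] by (simp add: eq3 E.m_assoc)
    then have "Z g h \<otimes>\<^bsub>A\<^esub> F (g \<otimes> h) k = act g (F h k') \<otimes>\<^bsub>A\<^esub> F g k"
      using lE FA ZA g by (intro \<iota>_inj) simp_all
    then show "Z g h = diff F g h k"
      unfolding diff_def using FA ZA g by (simp add: k'_def[symmetric] M.eq_quot_iff)
  qed
  interpret Z: factor_set G A act Z by (rule splits_factor_set[OF splits])
  \<comment> \<open>The usual description of E through the factor set Z of the lift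
    \<sigma>.\<close>
  let ?f = "\<lambda>(a, g). \<iota> a \<otimes>\<^bsub>E\<^esub> \<sigma> g"
  have f_in: "\<iota> a \<otimes>\<^bsub>E\<^esub> \<sigma> g \<in> carrier E" if "a \<in> carrier A" "g \<in> carrier G" for a g
    using that \<sigma> by simp
  have p_f: "p (\<iota> a \<otimes>\<^bsub>E\<^esub> \<sigma> g) = g" if "a \<in> carrier A" "g \<in> carrier G" for a g
    using that \<sigma> by simp
  have "?f \<in> hom Z.ext_group E"
  proof (rule homI)
    fix x y assume "x \<in> carrier Z.ext_group" "y \<in> carrier Z.ext_group"
    then obtain a g b h where x: "x = (a, g)" "a \<in> carrier A" "g \<in> carrier G"
      and y: "y = (b, h)" "b \<in> carrier A" "h \<in> carrier G" by auto
    note \<sigma>E = \<sigma>[OF x(3)] \<sigma>[OF y(3)] \<sigma>[OF m_closed[OF x(3) y(3)]]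
    have "?f x \<otimes>\<^bsub>E\<^esub> ?f y = \<iota> a \<otimes>\<^bsub>E\<^esub> (\<sigma> g \<otimes>\<^bsub>E\<^esub> \<iota> b) \<otimes>\<^bsub>E\<^esub> \<sigma> h"
      using x y \<sigma>E by (simp add: E.m_assoc)
    also have "\<dots> = \<iota> a \<otimes>\<^bsub>E\<^esub> \<iota> (act g b) \<otimes>\<^bsub>E\<^esub> (\<sigma> g \<otimes>\<^bsub>E\<^esub> \<sigma> h)"
      unfolding conj[OF \<sigma>E(1) y(2)] using x y \<sigma>E by (simp add: E.m_assoc)
    also have "\<dots> = ?f (x \<otimes>\<^bsub>Z.ext_group\<^esub> y)"
      unfolding Z_eq[OF x(3) y(3)] using x y \<sigma>E by (simp add: E.m_assoc)
    finally show "?f (x \<otimes>\<^bsub>Z.ext_group\<^esub> y) = ?f x \<otimes>\<^bsub>E\<^esub> ?f y" by simp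
  qed (use f_in in auto)
  moreover have "bij_betw ?f (carrier Z.ext_group) (carrier E)"
    unfolding bij_betw_def
  proof
    show "inj_on ?f (carrier Z.ext_group)"
    proof (rule inj_onI)
      fix x y assume "x \<in> carrier Z.ext_group" "y \<in> carrier Z.ext_group" and eq: "?f x = ?f y"
      then obtain a g b h where x: "x = (a, g)" "a \<in> carrier A" "g \<in> carrier G"
        and y: "y = (b, h)" "b \<in> carrier A" "h \<in> carrier G" by auto
      have gh: "g = h" using eq p_f[OF x(2,3)] p_f[OF y(2,3)] by (simp add: x y)
      then have "\<iota> a = \<iota> b" using eq x y \<sigma>[OF y(3)] by simp
      then have "a = b" using x(2) y(2) by (rule \<iota>_inj)
      then show "x = y" using gh x y by simp
    qed
    show "?f ` carrier Z.ext_group = carrier E"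
    proof (intro equalityI subsetI)
      fix e assume e: "e \<in> carrier E"
      obtain a where "a \<in> carrier A" "e = \<iota> a \<otimes>\<^bsub>E\<^esub> \<sigma> (p e)"
        using diff_in_A[OF e \<sigma>[OF p.hom_closed[OF e]]] e by auto
      then show "e \<in> ?f ` carrier Z.ext_group"
        using e by (intro image_eqI[of _ _ "(a, p e)"]) simp_all
    qed (use f_in in auto)
  qed
  ultimately have iso: "?f \<in> iso Z.ext_group E" by (simp add: iso_def)
  \<comment> \<open>Cancellation in \<sigma> 1 \<sigma> 1; this element makes up for the Z 1 1
    subtracted by the inclusion.\<close>
  have \<sigma>_one: "\<sigma> \<one> = \<iota> (Z \<one> \<one>)"
    using Z_eq[of \<one> \<one>] \<sigma>[of \<one>] Z[of \<one> \<one>] by simp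
  have "rel_ext_equivalent I S A (split_ext F Z) Y"
  proof (rule rel_ext_equivalentI[where f = ?f and b = "\<lambda>_. \<one>\<^bsub>A\<^esub>"])
    show "?f \<in> iso (total (split_ext F Z)) (total Y)" using iso by (simp add: E_def)
    show "?f (incl (split_ext F Z) a) = incl Y a" if a: "a \<in> carrier A" for a
    proof -
      have "\<iota> (a \<otimes>\<^bsub>A\<^esub> inv\<^bsub>A\<^esub> Z \<one> \<one>) \<otimes>\<^bsub>E\<^esub> \<iota> (Z \<one> \<one>) = \<iota> (a \<otimes>\<^bsub>A\<^esub> inv\<^bsub>A\<^esub> Z \<one> \<one> \<otimes>\<^bsub>A\<^esub> Z \<one> \<one>)"
        using a Z[of \<one> \<one>] by (intro \<iota>.hom_mult[symmetric]) simp_all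
      also have "\<dots> = \<iota> a" using a Z[of \<one> \<one>] by (simp add: M.m_assoc)
      finally show ?thesis by (simp add: Z.ext_incl_def \<sigma>_one \<iota>_def)
    qed
    show "proj Y (?f e) = proj (split_ext F Z) e" if "e \<in> carrier (total (split_ext F Z))" for e
      using that p_f unfolding p_def[symmetric] by auto
    fix i s assume i: "i \<in> I" and s: "s \<in> S i"
    let ?k = "(i, S i)"
    have k: "?k \<in> cosets" and sG: "s \<in> carrier G" using i S_carrier[OF i s] by simp_all
    have lk: "l ?k = \<one>\<^bsub>E\<^esub>" using l_base[OF k] by simp
    have "translate (inv s) ?k = ?k"
      using translate_base_eq[OF i subgroup.m_inv_closed[OF subgrp[OF i] s]] .
    \<comment> \<open>With l equal to 1 at this coset, projection to G gives t =
      \<open>inv s\<close>; hence \<open>q i s\<close> is \<iota> (- F s) \<sigma> s, the image of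
      the section (- F s, s).\<close>
    then have eq: "\<sigma> s \<otimes>\<^bsub>E\<^esub> q i (t s ?k) = \<iota> (F s ?k)"
      using F_eq[OF sG k] lk \<sigma>[OF sG] F[OF sG k] by simp
    have tS: "t s ?k \<in> S i" using t[OF sG k] by simp
    have "p (\<sigma> s \<otimes>\<^bsub>E\<^esub> q i (t s ?k)) = \<one>" unfolding eq using F[OF sG k] by simp
    then have "s \<otimes> t s ?k = \<one>"
      using \<sigma>[OF sG] q_in[OF i tS] p_q[OF i tS] sG by simp
    then have ts: "t s ?k \<otimes> s = \<one>"
      using inv_comm[OF _ sG S_carrier[OF i tS]] by blast
    have "q i \<one> \<otimes>\<^bsub>E\<^esub> q i s = q i s"
      using q_mult[OF i subgroup.one_closed[OF subgrp[OF i]] s] sG by simp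
    then have "q i \<one> = \<one>\<^bsub>E\<^esub>"
      using q_in[OF i subgroup.one_closed[OF subgrp[OF i]]] q_in[OF i s] by simp
    then have "q i (t s ?k) \<otimes>\<^bsub>E\<^esub> q i s = \<one>\<^bsub>E\<^esub>"
      using q_mult[OF i tS s] ts by simp
    then have "\<iota> (F s ?k) \<otimes>\<^bsub>E\<^esub> q i s = \<sigma> s"
      unfolding eq[symmetric] using \<sigma>[OF sG] q_in[OF i tS] q_in[OF i s] by (simp add: E.m_assoc)
    then have "q i s = \<iota> (inv\<^bsub>A\<^esub> F s ?k) \<otimes>\<^bsub>E\<^esub> \<sigma> s"
      using F[OF sG k] q_in[OF i s] \<sigma>[OF sG] by (auto simp: E.inv_solve_left)
    moreover have "\<iota> (inv\<^bsub>A\<^esub> F s ?k) \<otimes>\<^bsub>E\<^esub> \<sigma> s \<in> carrier E"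
      by (rule f_in[OF M.inv_closed[OF F[OF sG k]] sG])
    ultimately show "sect Y i s = incl Y \<one>\<^bsub>A\<^esub> \<otimes>\<^bsub>total Y\<^esub> ?f (sect (split_ext F Z) i s)
        \<otimes>\<^bsub>total Y\<^esub> inv\<^bsub>total Y\<^esub> incl Y \<one>\<^bsub>A\<^esub>"
      unfolding E_def[symmetric] \<iota>_def[symmetric] q_def[symmetric] using i by simp
  qed simp
  with splits show thesis by (rule that)
qed

end

section \<open>The natural bijection\<close>

text \<open>R will consist of all choices: equality of the fibres of K and L expresses
  well-definedness and injectivity of the correspondence together, and independence of the choices
  is built in.\<close>

lemma bij_betw_of_common_source:
  assumes "\<And>x y. x \<in> R \<Longrightarrow> y \<in> R \<Longrightarrow> K x = K y \<longleftrightarrow> L x = L y"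
  obtains \<Phi> where "bij_betw \<Phi> (K ` R) (L ` R)" "\<And>x. x \<in> R \<Longrightarrow> \<Phi> (K x) = L x"
proof -
  define \<Phi> where "\<Phi> c = L (inv_into R K c)" for c
  have eq: "\<Phi> (K x) = L x" if "x \<in> R" for x
  proof -
    have "inv_into R K (K x) \<in> R" "K (inv_into R K (K x)) = K x"
      using that by (simp_all add: inv_into_into f_inv_into_f)
    then show ?thesis using assms[OF _ that] by (simp add: \<Phi>_def)
  qed
  have "inj_on \<Phi> (K ` R)"
    using assms by (auto simp: inj_on_def eq)
  moreover have "\<Phi> ` K ` R = L ` R"
    using eq by (simp add: image_image)
  ultimately show thesis using eq by (intro that[of \<Phi>]) (auto simp: bij_betw_def)
qed

context relative_module
begin

lemma cocycle_rel_ext_eq_split_ext: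
  assumes "splits (val \<eta>) (\<lambda>g h. \<zeta> (bar_symbol G [g, h]))"
  shows "cocycle_rel_ext G S A act \<zeta> \<eta> = split_ext (val \<eta>) (\<lambda>g h. \<zeta> (bar_symbol G [g, h]))"
proof -
  interpret factor_set G A act "\<lambda>g h. \<zeta> (bar_symbol G [g, h])"
    by (rule splits_factor_set[OF assms])
  show ?thesis
    unfolding cocycle_rel_ext_def split_ext_def twisted_product_def ext_group_def val_def
      ext_incl_def[abs_def] by (rule refl)
qed

text \<open>X need not belong to its own class, which lives over another type, so equal classes
  yield an equivalence only if they have a member; the injection j provides one.\<close>

lemma rel_ext_class_eq_iff:
  fixes X :: "('f, 'm, 'a, 'i) rel_ext" and j :: "'f \<Rightarrow> 'e"
  assumes X: "X \<in> rel_extensions G I S A act" and Y: "Y \<in> rel_extensions G I S A act"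
    and j: "inj_on j (carrier (total X))"
  shows "(rel_ext_class G I S A act X :: ('e, 'm, 'a, 'i) rel_ext set) = rel_ext_class G I S A act Y
    \<longleftrightarrow> rel_ext_equivalent I S A X Y"
proof
  note sym = rel_ext_equivalent_sym[OF M.is_group] and trans = rel_ext_equivalent_trans[OF M.is_group]
  assume eq: "(rel_ext_class G I S A act X :: ('e, 'm, 'a, 'i) rel_ext set) = rel_ext_class G I S A act Y"
  obtain W :: "('e, 'm, 'a, 'i) rel_ext" where W: "W \<in> rel_extensions G I S A act"
    and XW: "rel_ext_equivalent I S A X W"
    using rel_extension_transport[OF M.is_group X j] .
  have "W \<in> rel_ext_class G I S A act X" using W XW by (simp add: rel_ext_class_def)
  then have "rel_ext_equivalent I S A Y W" unfolding eq by (simp add: rel_ext_class_def)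
  then show "rel_ext_equivalent I S A X Y" using trans[OF X W Y XW sym[OF Y W]] by simp
next
  note sym = rel_ext_equivalent_sym[OF M.is_group] and trans = rel_ext_equivalent_trans[OF M.is_group]
  assume XY: "rel_ext_equivalent I S A X Y"
  have "rel_ext_equivalent I S A X W \<longleftrightarrow> rel_ext_equivalent I S A Y W"
    if W: "W \<in> rel_extensions G I S A act" for W :: "('e, 'm, 'a, 'i) rel_ext"
    using trans[OF X Y W XY] trans[OF Y X W sym[OF X Y XY]] by blast
  then show "(rel_ext_class G I S A act X :: ('e, 'm, 'a, 'i) rel_ext set) = rel_ext_class G I S A act Y"
    unfolding rel_ext_class_def by blast
qed

lemma rel_ext_classes_eq:
  "(rel_ext_classes G I S A act :: ('e, 'm, 'a, 'i) rel_ext set set) =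
    rel_ext_class G I S A act ` (rel_extensions G I S A act :: ('e, 'm, 'a, 'i) rel_ext set)"
  unfolding rel_ext_classes_def rel_ext_class_def quotient_def by blast

lemma carrier_rel_cohomology_2:
  "carrier (rel_cohomology G I S A act 2) =
    rel_cohomology_class G I S A act 2 ` carrier (rel_cocycles G I S A act 2)"
  unfolding rel_cohomology_def cohomology_def rel_cohomology_class_def cohomology_class_def
    rel_cocycles_def FactGroup_def RCOSETS_def by auto

lemma relative_extension_bijection:
  fixes j :: "'m \<times> 'a \<Rightarrow> 'e"
  assumes j: "inj_on j (carrier A \<times> carrier G)"
  shows "\<exists>\<Phi>. bij_betw \<Phi> (carrier (rel_cohomology G I S A act 2))
       (rel_ext_classes G I S A act :: ('e, 'm, 'a, 'i) rel_ext set set) \<and>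
    (\<forall>\<xi>\<in>carrier (rel_cocycles G I S A act 2).
     \<forall>\<eta>\<in>carrier (family_cochains G I S A act 1).
     \<forall>\<zeta>\<in>carrier (cochains G A act 2).
       in_star G I S 1 \<eta> = \<xi> \<and> ev_star G I S A 2 \<zeta> = coboundary G 1 \<eta> \<longrightarrow>
       cocycle_rel_ext G S A act \<zeta> \<eta> \<in> rel_extensions G I S A act \<and>
       \<Phi> (rel_cohomology_class G I S A act 2 \<xi>) =
         rel_ext_class G I S A act (cocycle_rel_ext G S A act \<zeta> \<eta>))"
proof -
  \<comment> \<open>All admissible choices, with \<xi> recovered as \<open>in_star\<close> of
    \<eta>. K and L below are the maps onto cohomology classes and onto classes of
    extensions.\<close>
  define R where "R = {(\<eta>, \<zeta>). \<eta> \<in> family_1 \<and> \<zeta> \<in> carrier (cochains G A act 2) \<and>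
    in_star G I S 1 \<eta> \<in> carrier (rel_cocycles G I S A act 2) \<and>
    ev_star G I S A 2 \<zeta> = coboundary G 1 \<eta>}"
  define K where "K = (\<lambda>(\<eta>, \<zeta> :: ('a \<times> 'a list \<Rightarrow>\<^sub>0 int) \<Rightarrow> 'm).
    rel_cohomology_class G I S A act 2 (in_star G I S 1 \<eta>))"
  define X where "X = (\<lambda>(\<eta>, \<zeta>). cocycle_rel_ext G S A act \<zeta> \<eta>)"
  define L where "L = (\<lambda>t. rel_ext_class G I S A act (X t) :: ('e, 'm, 'a, 'i) rel_ext set)"
  define F where "F = (\<lambda>(\<eta>, \<zeta> :: ('a \<times> 'a list \<Rightarrow>\<^sub>0 int) \<Rightarrow> 'm). val \<eta>)"
  define Z where "Z = (\<lambda>(\<eta> :: ('a \<times> 'a list \<Rightarrow>\<^sub>0 int) \<Rightarrow> ('i \<times> 'a set \<Rightarrow>\<^sub>0 int) \<Rightarrow> 'm, \<zeta>) g h.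
    \<zeta> (bar_symbol G [g, h]) :: 'm)"
  have splits: "splits (F t) (Z t)" and X_eq: "X t = split_ext (F t) (Z t)" if "t \<in> R" for t
  proof -
    obtain \<eta> \<zeta> where t: "t = (\<eta>, \<zeta>)" by (cases t)
    then have "splits (val \<eta>) (\<lambda>g h. \<zeta> (bar_symbol G [g, h]))"
      using that ev_star_eq_iff[of \<eta> \<zeta>] by (simp add: R_def)
    then show "splits (F t) (Z t)" "X t = split_ext (F t) (Z t)"
      using cocycle_rel_ext_eq_split_ext[of \<eta> \<zeta>] by (simp_all add: t F_def Z_def X_def)
  qed
  have X_ext: "X t \<in> rel_extensions G I S A act" if "t \<in> R" for t
    unfolding X_eq[OF that] by (rule split_ext_rel_extension[OF splits[OF that]])
  have inj: "inj_on j (carrier (total (X t)))" if "t \<in> R" for t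
  proof -
    interpret factor_set G A act "Z t" by (rule splits_factor_set[OF splits[OF that]])
    show ?thesis unfolding X_eq[OF that] using j by simp
  qed
  have K_eq: "K t = K u \<longleftrightarrow> cohomologous (F t) (F u)" if "t \<in> R" "u \<in> R" for t u
    using that rel_cohomology_class_eq_iff by (auto simp: R_def K_def F_def)
  have L_eq: "L t = L u \<longleftrightarrow> rel_ext_equivalent I S A (X t) (X u)" if "t \<in> R" "u \<in> R" for t u
    unfolding L_def by (rule rel_ext_class_eq_iff[OF X_ext[OF that(1)] X_ext[OF that(2)] inj[OF that(1)]])
  have "K t = K u \<longleftrightarrow> L t = L u" if "t \<in> R" "u \<in> R" for t u
    unfolding K_eq[OF that] L_eq[OF that] X_eq[OF that(1)] X_eq[OF that(2)]
    using split_ext_equivalent_of_cohomologous cohomologous_of_split_ext_equivalent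
      splits[OF that(1)] splits[OF that(2)] by blast
  then obtain \<Phi> where \<Phi>: "bij_betw \<Phi> (K ` R) (L ` R)" "\<And>t. t \<in> R \<Longrightarrow> \<Phi> (K t) = L t"
    using bij_betw_of_common_source[of R K L] by metis
  have "K ` R = carrier (rel_cohomology G I S A act 2)"
    unfolding carrier_rel_cohomology_2
  proof (intro equalityI subsetI)
    fix c assume "c \<in> rel_cohomology_class G I S A act 2 ` carrier (rel_cocycles G I S A act 2)"
    then obtain \<xi> where \<xi>: "\<xi> \<in> carrier (rel_cocycles G I S A act 2)"
      "c = rel_cohomology_class G I S A act 2 \<xi>" by (rule imageE)
    have "\<xi> \<in> carrier (cochains G HD HD_act 1)"
      using \<xi>(1) HD.cocycles_1_iff[of \<xi>] by (simp add: rel_cocycles_def One_nat_def)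
    then obtain \<eta> where \<eta>: "\<eta> \<in> family_1" "in_star G I S 1 \<eta> = \<xi>" by (rule in_star_surj)
    obtain \<zeta> where "\<zeta> \<in> carrier (cochains G A act 2)" "ev_star G I S A 2 \<zeta> = coboundary G 1 \<eta>"
      using ev_star_unique[OF \<eta>(1)] \<xi>(1) \<eta>(2) by blast
    then have "(\<eta>, \<zeta>) \<in> R" "K (\<eta>, \<zeta>) = c" using \<eta> \<xi> by (simp_all add: R_def K_def)
    then show "c \<in> K ` R" by blast
  qed (auto simp: K_def R_def)
  moreover have "L ` R = rel_ext_classes G I S A act"
    unfolding rel_ext_classes_eq
  proof (intro equalityI subsetI)
    fix C assume "C \<in> L ` R"
    then obtain t where t: "t \<in> R" "C = L t" by (rule imageE)
    \<comment> \<open>\<open>X t\<close> is an extension on pairs; a copy of it over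
      \<open>'e\<close> is needed to represent C.\<close>
    obtain Y :: "('e, 'm, 'a, 'i) rel_ext" where Y: "Y \<in> rel_extensions G I S A act"
      and XY: "rel_ext_equivalent I S A (X t) Y"
      using rel_extension_transport[OF M.is_group X_ext[OF t(1)] inj[OF t(1)]] .
    have "C = rel_ext_class G I S A act Y"
      unfolding t(2) L_def using rel_ext_class_eq_iff[OF X_ext[OF t(1)] Y inj[OF t(1)]] XY by simp
    then show "C \<in> rel_ext_class G I S A act `
        (rel_extensions G I S A act :: ('e, 'm, 'a, 'i) rel_ext set)" using Y by blast
  next
    fix C :: "('e, 'm, 'a, 'i) rel_ext set"
    assume "C \<in> rel_ext_class G I S A act ` (rel_extensions G I S A act :: ('e, 'm, 'a, 'i) rel_ext set)"
    then obtain Y :: "('e, 'm, 'a, 'i) rel_ext" where Y: "Y \<in> rel_extensions G I S A act"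
      and C: "C = rel_ext_class G I S A act Y" by (rule imageE)
    obtain F' Z' where sp: "splits F' Z'" and equiv: "rel_ext_equivalent I S A (split_ext F' Z') Y"
      using Y by (rule rel_extension_splits)
    obtain \<eta> \<zeta> where \<eta>\<zeta>: "\<eta> \<in> family_1" "\<zeta> \<in> carrier (cochains G A act 2)"
      "in_star G I S 1 \<eta> \<in> carrier (rel_cocycles G I S A act 2)"
      "ev_star G I S A 2 \<zeta> = coboundary G 1 \<eta>"
      and val: "\<And>g k. g \<in> carrier G \<Longrightarrow> k \<in> cosets \<Longrightarrow> val \<eta> g k = F' g k"
      using relative_cocycle_of_splits[OF sp] by metis
    have t: "(\<eta>, \<zeta>) \<in> R" using \<eta>\<zeta> by (simp add: R_def)
    \<comment> \<open>\<eta> is known to have the values F' only on the group and the cosets, so the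
      extensions are compared through T = 0 and c = 0 instead of by equality.\<close>
    have "cohomologous (F (\<eta>, \<zeta>)) F'"
      unfolding cohomologous_def
      by (intro exI[of _ "\<lambda>_. \<one>\<^bsub>A\<^esub>"])
        (use splits_closed[OF sp] in \<open>simp add: F_def val\<close>)
    from split_ext_equivalent_of_cohomologous[OF splits[OF t] sp this]
    have "rel_ext_equivalent I S A (X (\<eta>, \<zeta>)) (split_ext F' Z')" unfolding X_eq[OF t] .
    then have "rel_ext_equivalent I S A (X (\<eta>, \<zeta>)) Y"
      by (rule rel_ext_equivalent_trans[OF M.is_group X_ext[OF t] split_ext_rel_extension[OF sp] Y _ equiv])
    then have "L (\<eta>, \<zeta>) = C"
      unfolding L_def C using rel_ext_class_eq_iff[OF X_ext[OF t] Y inj[OF t]] by simp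
    then show "C \<in> L ` R" using t by blast
  qed
  ultimately have "bij_betw \<Phi> (carrier (rel_cohomology G I S A act 2))
      (rel_ext_classes G I S A act :: ('e, 'm, 'a, 'i) rel_ext set set)"
    using \<Phi>(1) by simp
  moreover have "cocycle_rel_ext G S A act \<zeta> \<eta> \<in> rel_extensions G I S A act \<and>
      \<Phi> (rel_cohomology_class G I S A act 2 \<xi>) =
        rel_ext_class G I S A act (cocycle_rel_ext G S A act \<zeta> \<eta>)"
    if "\<xi> \<in> carrier (rel_cocycles G I S A act 2)" "\<eta> \<in> family_1" "\<zeta> \<in> carrier (cochains G A act 2)"
      "in_star G I S 1 \<eta> = \<xi>" "ev_star G I S A 2 \<zeta> = coboundary G 1 \<eta>" for \<xi> \<eta> \<zeta>
  proof -
    have t: "(\<eta>, \<zeta>) \<in> R" using that by (simp add: R_def)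
    show ?thesis using X_ext[OF t] \<Phi>(2)[OF t] that(4) by (simp add: X_def K_def L_def)
  qed
  ultimately show ?thesis by blast
qed

end

theorem theorem4p2:
  fixes G :: "('g, 'd) monoid_scheme" and I :: "'i set" and S :: "'i \<Rightarrow> 'g set"
    and A :: "('a, 'c) monoid_scheme" and act :: "'g \<Rightarrow> 'a \<Rightarrow> 'a"
  assumes "group G" and "I \<noteq> {}" and "\<And>i. i \<in> I \<Longrightarrow> subgroup (S i) G"
    and "gmodule G A act"
    \<comment> \<open>The type \<open>'e\<close> of the total groups is arbitrary but large enough to hold a copy of the
        set \<open>A \<times> G\<close>; a type that is too small contains no extension of \<open>G\<close> by \<open>A\<close> at all.\<close>
    and "\<exists>j :: 'a \<times> 'g \<Rightarrow> 'e. inj_on j (carrier A \<times> carrier G)"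
  shows
    "(\<forall>\<xi>\<in>carrier (rel_cocycles G I S A act 2).
        (\<exists>\<eta>\<in>carrier (family_cochains G I S A act 1). in_star G I S 1 \<eta> = \<xi>) \<and>
        (\<forall>\<eta>\<in>carrier (family_cochains G I S A act 1). in_star G I S 1 \<eta> = \<xi> \<longrightarrow>
           (\<exists>!\<zeta>. \<zeta> \<in> carrier (cochains G A act 2) \<and>
                  ev_star G I S A 2 \<zeta> = coboundary G 1 \<eta>))) \<and>
     (\<exists>\<Phi>. bij_betw \<Phi> (carrier (rel_cohomology G I S A act 2))
             (rel_ext_classes G I S A act :: ('e, 'a, 'g, 'i) rel_ext set set) \<and>
        (\<forall>\<xi>\<in>carrier (rel_cocycles G I S A act 2).
         \<forall>\<eta>\<in>carrier (family_cochains G I S A act 1).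
         \<forall>\<zeta>\<in>carrier (cochains G A act 2).
           in_star G I S 1 \<eta> = \<xi> \<and> ev_star G I S A 2 \<zeta> = coboundary G 1 \<eta> \<longrightarrow>
           cocycle_rel_ext G S A act \<zeta> \<eta> \<in> rel_extensions G I S A act \<and>
           \<Phi> (rel_cohomology_class G I S A act 2 \<xi>) =
             rel_ext_class G I S A act (cocycle_rel_ext G S A act \<zeta> \<eta>)))"
proof -
  interpret relative_module G I S A act
    using assms(1-3) gmodule_linear_action[OF assms(4)]
    by (intro relative_module.intro subgroup_family.intro subgroup_family_axioms.intro)
  obtain j :: "'a \<times> 'g \<Rightarrow> 'e" where j: "inj_on j (carrier A \<times> carrier G)" using assms(5) by blast
  show ?thesis
  proof (rule conjI[OF _ relative_extension_bijection[OF j]], intro ballI conjI impI)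
    fix \<xi> assume \<xi>: "\<xi> \<in> carrier (rel_cocycles G I S A act 2)"
    then have "\<xi> \<in> carrier (cochains G HD HD_act 1)"
      using HD.cocycles_1_iff[of \<xi>] by (simp add: rel_cocycles_def One_nat_def)
    then show "\<exists>\<eta>\<in>family_1. in_star G I S 1 \<eta> = \<xi>" by (rule in_star_surj) blast
    show "\<exists>!\<zeta>. \<zeta> \<in> carrier (cochains G A act 2) \<and> ev_star G I S A 2 \<zeta> = coboundary G 1 \<eta>"
      if "\<eta> \<in> family_1" "in_star G I S 1 \<eta> = \<xi>" for \<eta>
      using ev_star_unique[OF that(1)] \<xi> that(2) by simp
  qed
qed

end
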